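(* For each $N\ge1$ let $B_1(t)<\dots<B_N(t)$, $t\in[0,1]$, be $N$ non-intersecting Brownian bridges starting and ending at $0$ (so that $B_N$ is the top path). Then for every $r\in\mathbb R$, $$\lim_{N\to\infty}\mathbb P\Big(2N^{1/6}\big(\max_{t\in[0,1]}B_N(t)-\sqrt N\big)\le r\Big)=F_{\mathrm{GOE}}(4^{1/3}r),$$ where $F_{\mathrm{GOE}}$ is the Tracy-Widom GOE distribution function.
   Context: Tracy-Widom GOE distribution: $F_{\mathrm{GOE}}(r)=\det(\mathsf I-\mathsf P_0\mathsf B_r\mathsf P_0)_{L^2(\mathbb R)}$ (Fredholm determinant), where $\mathsf P_0f(x)=f(x)\mathbf 1_{x>0}$ and $\mathsf B_r$ is the integral operator with kernel $\mathsf B_r(x,y)=\mathrm{Ai}(x+y+r)$, $\mathrm{Ai}$ the Airy function. Non-intersecting Brownian bridges: $(B_1(t),\dots,B_N(t))_{t\in[0,1]}$ is a collection of $N$ independent standard Brownian bridges (each with variance $t(1-t)$ at time $t$), all starting from $0$ at time $0$ and ending at $0$ at time $1$, conditioned in the sense of Doob not to intersect for $t\in(0,1)$, and ordered so that $B_1(t)<\dots<B_N(t)$ for $t\in(0,1)$. Concretely, it is the process with continuous paths, equal to $0$ at $t=0$ and $t=1$, such that for $0<t_1<\dots<t_k<1$ the joint density of $(B(t_1),\dots,B(t_k))$ at $(x^1,\dots,x^k)$, with each $x^j\in\{x\in\mathbb R^N:x_1<\dots<x_N\}$, is proportional to $$\Delta(x^1)\prod_{i=1}^N e^{-(x^1_i)^2/(2t_1)}\;\prod_{j=1}^{k-1}\det\big[p_{t_{j+1}-t_j}(x^j_a,x^{j+1}_b)\big]_{a,b=1}^N\;\Delta(x^k)\prod_{i=1}^N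 e^{-(x^k_i)^2/(2(1-t_k))},$$ where $p_s(x,y)=(2\pi s)^{-1/2}e^{-(x-y)^2/(2s)}$ and $\Delta(x)=\prod_{i<j}(x_j-x_i)$. *)

theory Defs
  imports "HOL-Probability.Probability" "Jordan_Normal_Form.Determinant"
begin

section \<open>The Tracy--Widom GOE distribution\<close>

text \<open>The integral over \<open>{0..}\<close> is only conditionally convergent, hence the explicit limit.\<close>

definition airy :: "real \<Rightarrow> real" where
  "airy x = Lim at_top (\<lambda>R. integral {0..R} (\<lambda>s. cos (s ^ 3 / 3 + x * s))) / pi"

text \<open>The Fredholm determinant \<open>det(I - K)\<close> on \<open>L\<^sup>2(\<real>)\<close> of the integral operator with kernel
  \<open>K\<close>, given by the Fredholm series. HOL-Analysis also has a \<open>det\<close> and a \<open>mat\<close>, for matrices whose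
  size is a type; the matrices here are \<open>n \<times> n\<close> with \<open>n\<close> the summation index.\<close>

definition fredholm_det :: "(real \<Rightarrow> real \<Rightarrow> real) \<Rightarrow> real" where
  "fredholm_det K =
     (\<Sum>n. (-1) ^ n / fact n *
        (LINT x|(\<Pi>\<^sub>M i\<in>{..<n}. lborel). Determinant.det (Matrix.mat n n (\<lambda>(i, j). K (x i) (x j)))))"

definition B_kernel :: "real \<Rightarrow> real \<Rightarrow> real \<Rightarrow> real" where
  "B_kernel r x y = airy (x + y + r)"

text \<open>The kernel of \<open>P\<^sub>0 B\<^sub>r P\<^sub>0\<close>, where \<open>P\<^sub>0\<close> is multiplication by the indicator of \<open>(0, \<infinity>)\<close>.\<close>

definition PBP_kernel :: "real \<Rightarrow> real \<Rightarrow> real \<Rightarrow> real" where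
  "PBP_kernel r x y = indicator {0<..} x * B_kernel r x y * indicator {0<..} y"

lemma PBP_kernel_operator:
  "(LINT y|lborel. PBP_kernel r x y * f y) =
   indicator {0<..} x * (LINT y|lborel. B_kernel r x y * (f y * indicator {0<..} y))"
  by (simp add: PBP_kernel_def mult.assoc mult.commute[of "f _"]
           flip: integral_mult_right_zero)

definition F_GOE :: "real \<Rightarrow> real" where
  "F_GOE r = fredholm_det (PBP_kernel r)"


section \<open>Non-intersecting Brownian bridges\<close>

text \<open>Paths are indexed by \<open>1, \<dots>, N\<close> and observation times by \<open>1, \<dots>, k\<close>.\<close>

definition heat_kernel :: "real \<Rightarrow> real \<Rightarrow> real \<Rightarrow> real" where
  "heat_kernel s x y = exp (- (x - y)\<^sup>2 / (2 * s)) / sqrt (2 * pi * s)"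

definition vandermonde :: "nat \<Rightarrow> (nat \<Rightarrow> real) \<Rightarrow> real" where
  "vandermonde N x = (\<Prod>j\<in>{1..N}. \<Prod>i\<in>{1..<j}. x j - x i)"

definition weyl_chamber :: "nat \<Rightarrow> (nat \<Rightarrow> real) set" where
  "weyl_chamber N = {x. strict_mono_on {1..N} x}"

text \<open>The position of path \<open>i\<close> at the \<open>j\<close>-th time is \<open>x (j, i)\<close>. Matrix indices start at \<open>0\<close>,
  whence the \<open>Suc\<close>s in the transition determinant.\<close>

definition bridges_weight :: "nat \<Rightarrow> nat \<Rightarrow> (nat \<Rightarrow> real) \<Rightarrow> (nat \<times> nat \<Rightarrow> real) \<Rightarrow> real" where
  "bridges_weight N k t x =
     (if \<forall>j\<in>{1..k}. (\<lambda>i. x (j, i)) \<in> weyl_chamber N then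
        vandermonde N (\<lambda>i. x (1, i)) * (\<Prod>i\<in>{1..N}. exp (- (x (1, i))\<^sup>2 / (2 * t 1))) *
        (\<Prod>j\<in>{1..<k}. Determinant.det (Matrix.mat N N
           (\<lambda>(a, b). heat_kernel (t (Suc j) - t j) (x (j, Suc a)) (x (Suc j, Suc b))))) *
        vandermonde N (\<lambda>i. x (k, i)) * (\<Prod>i\<in>{1..N}. exp (- (x (k, i))\<^sup>2 / (2 * (1 - t k))))
      else 0)"

text \<open>Continuity is required of every path, so that suprema over \<open>[0,1]\<close> are measurable.
  The ordering is only required almost surely, as is usual for a conditioning in the sense of Doob.
  The constant \<open>c\<close> is the normalisation of the density.\<close>

definition nonintersecting_bridges ::
    "'a measure \<Rightarrow> nat \<Rightarrow> (nat \<Rightarrow> real \<Rightarrow> 'a \<Rightarrow> real) \<Rightarrow> bool" where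
  "nonintersecting_bridges M N B \<longleftrightarrow>
     prob_space M \<and>
     (\<forall>i\<in>{1..N}. \<forall>\<omega>\<in>space M. continuous_on {0..1} (\<lambda>t. B i t \<omega>) \<and> B i 0 \<omega> = 0 \<and> B i 1 \<omega> = 0) \<and>
     (AE \<omega> in M. \<forall>t\<in>{0<..<1}. (\<lambda>i. B i t \<omega>) \<in> weyl_chamber N) \<and>
     (\<forall>k t. 1 \<le> k \<and> strict_mono_on {1..k} t \<and> t ` {1..k} \<subseteq> {0<..<1} \<longrightarrow>
        (\<exists>c>0. distributed M (\<Pi>\<^sub>M p\<in>{1..k} \<times> {1..N}. lborel)
           (\<lambda>\<omega>. \<lambda>(j, i)\<in>{1..k} \<times> {1..N}. B i (t j) \<omega>)
           (\<lambda>x. ennreal (c * bridges_weight N k t x))))"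

end

theory Submission
  imports Defs "HOL-Complex_Analysis.Complex_Analysis" "HOL-Real_Asymp.Real_Asymp"
begin

text \<open>By the identity of Andreief, the probability that all paths stay below \<open>m\<close> at the times of a
  grid is a ratio of two \<open>N \<times> N\<close> determinants of one-particle integrals. As the grid is refined, the
  one-particle kernels converge to those of Brownian motion absorbed at \<open>m\<close>, which the reflection
  principle makes explicit. In generating-function coordinates the free part becomes the identity
  matrix and the reflected part a matrix \<open>H\<close>, so that the probability that the maximum is at most
  \<open>m\<close> is \<open>det (I - H)\<close> with \<open>\<Sum>\<^sub>b H\<^sub>a\<^sub>b z\<^sup>b = exp (2 m z - 2 m\<^sup>2) (2 m - z)\<^sup>a\<close>. The entries of \<open>H\<close> are
  circle integrals; at \<open>m = \<surd>N + r / (2 N\<^bsup>1/6\<^esup>)\<close>, with indices counted downwards from \<open>N - 1\<close> in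
  units of \<open>\<kappa> = (2 N)\<^bsup>1/3\<^esup>\<close>, two saddle points merge and steepest descent gives
  \<open>\<kappa> H \<rightarrow> Ai (4\<^bsup>1/3\<^esup> r + x + y)\<close> with exponential bounds in the indices. The expansion of
  \<open>det (I - H)\<close> into principal minors is a Fredholm series of a step kernel, and the inequality of
  Hadamard dominates it termwise.\<close>

section \<open>Determinants over finite index sets\<close>

text \<open>The joint density is available only at times inside \<open>(0, 1)\<close>, so the grid
  fills \<open>[d, 1 - d]\<close> and there are two limits: the mesh goes to 0 at fixed
  \<open>d\<close>, and only then \<open>d\<close> goes to 0. The Vandermonde-Gaussian factors at
  the two end times can be written as determinants with any polynomials of degrees
  \<open>0, ..., N - 1\<close>; \<open>gamma_fun\<close> picks those whose generating function, run
  over total time 1, no longer depends on \<open>d\<close>. The pairing over the whole line is then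
  exact for every \<open>d\<close>, and the second limit only has to remove the mass beyond
  \<open>m\<close> at the two end times, which is exponentially small in \<open>1 / d\<close>.
  Absorption tested at grid times is compared with continuous absorption by pointwise inequalities,
  so signed one-particle functions are split into positive and negative parts first. Total
  positivity of the heat kernel enters because the density is an \<open>ennreal\<close>, where a
  negative weight would be cut to 0. The entries of \<open>H\<close> carry powers of
  \<open>sqrt N\<close> that would spoil uniform bounds; they form a diagonal conjugation, which the
  determinant does not see.\<close>

definition sdet :: "'i set \<Rightarrow> ('i \<Rightarrow> 'i \<Rightarrow> 'r :: comm_ring_1) \<Rightarrow> 'r" where
  "sdet S A = (\<Sum>p | p permutes S. of_int (sign p) * (\<Prod>i\<in>S. A i (p i)))"

lemma sdet_empty [simp]: "sdet {} A = 1"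
  by (simp add: sdet_def)

lemma sdet_cong:
  assumes "\<And>i j. i \<in> S \<Longrightarrow> j \<in> S \<Longrightarrow> A i j = B i j"
  shows "sdet S A = sdet S B"
  unfolding sdet_def
proof (intro sum.cong refl, clarsimp)
  fix p assume "p permutes S"
  then have "(\<Prod>i\<in>S. A i (p i)) = (\<Prod>i\<in>S. B i (p i))"
    by (intro prod.cong refl assms) (auto simp: permutes_in_image)
  then show "of_int (sign p) * (\<Prod>i\<in>S. A i (p i)) = of_int (sign p) * (\<Prod>i\<in>S. B i (p i))" by simp
qed

text \<open>Link to the matrix library, where Laplace expansion and multiplicativity live. Indexing
  by a set makes a principal minor simply \<open>sdet T A\<close> and lets the ranges
  \<open>{1..N}\<close> and \<open>{..<n}\<close> coexist.\<close>

lemma det_mat_eq_sdet: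
  "Determinant.det (Matrix.mat n n (\<lambda>(i, j). A i j)) = sdet {..<n} A"
  unfolding sdet_def Determinant.det_def
  by (auto simp: atLeast0LessThan intro!: sum.cong prod.cong dest: permutes_in_image)

lemma sdet_transpose:
  assumes "finite S" shows "sdet S (\<lambda>i j. A j i) = sdet S A"
proof -
  have "sdet S (\<lambda>i j. A j i) = (\<Sum>p | p permutes S. of_int (sign (inv_into UNIV p)) * (\<Prod>i\<in>S. A (inv_into UNIV p i) i))"
    unfolding sdet_def by (rule sum_permutations_inverse)
  also have "\<dots> = sdet S A"
    unfolding sdet_def
  proof (intro sum.cong refl, clarsimp)
    fix p assume p: "p permutes S"
    have "(\<Prod>i\<in>S. A (inv_into UNIV p i) i) = (\<Prod>i\<in>S. A (inv_into UNIV p (p i)) (p i))"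
      using p by (intro prod.reindex_bij_betw[symmetric] permutes_imp_bij)
    also have "\<dots> = (\<Prod>i\<in>S. A i (p i))"
      using permutes_inverses[OF p] by simp
    finally show "of_int (sign (inv_into UNIV p)) * (\<Prod>i\<in>S. A (inv_into UNIV p i) i) = of_int (sign p) * (\<Prod>i\<in>S. A i (p i))"
      using sign_inverse[OF permutation_permutes[THEN iffD2, OF exI, OF conjI, OF assms p]] by simp
  qed
  finally show ?thesis .
qed

text \<open>Transporting permutations along \<open>e\<close> is a bijection of the two permutation
  groups that preserves signs.\<close>

lemma sdet_reindex:
  assumes e: "bij_betw e T S" and fin: "finite T"
  shows "sdet T (\<lambda>i j. A (e i) (e j)) = sdet S A"
proof -
  define F where "F p = (\<lambda>x. if x \<in> S then e (p (inv_into T e x)) else x)" for p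
  have bF: "bij_betw F {p. p permutes T} {p. p permutes S}"
    unfolding F_def by (rule bij_betw_permutations[OF e])
  have "sdet S A = (\<Sum>p | p permutes T. of_int (sign (F p)) * (\<Prod>i\<in>S. A i (F p i)))"
    unfolding sdet_def by (rule sum.reindex_bij_betw[OF bF, symmetric])
  also have "\<dots> = sdet T (\<lambda>i j. A (e i) (e j))"
    unfolding sdet_def
  proof (intro sum.cong refl, clarsimp)
    fix p assume p: "p permutes T"
    have inj: "inj_on e T" and im: "e ` T = S" using e by (auto simp: bij_betw_def)
    have "map_permutation T e p = F p"
      unfolding map_permutation_def F_def im by (auto simp: fun_eq_iff)
    then have "sign (F p) = sign p"
      using sign_map_permutation[OF inj p fin] by simp
    moreover have "(\<Prod>i\<in>S. A i (F p i)) = (\<Prod>i\<in>T. A (e i) (F p (e i)))"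
      by (rule prod.reindex_bij_betw[OF e, symmetric])
    moreover have "F p (e i) = e (p i)" if "i \<in> T" for i
      using that inj im by (auto simp: F_def)
    ultimately show "of_int (sign (F p)) * (\<Prod>i\<in>S. A i (F p i)) = of_int (sign p) * (\<Prod>i\<in>T. A (e i) (e (p i)))"
      by simp
  qed
  finally show ?thesis by simp
qed

lemma sdet_permute_columns:
  assumes s: "\<sigma> permutes S" and fin: "finite S"
  shows "sdet S (\<lambda>i j. A i (\<sigma> j)) = of_int (sign \<sigma>) * sdet S A"
proof -
  have "of_int (sign \<sigma>) * sdet S A
      = (\<Sum>p | p permutes S. of_int (sign \<sigma>) * (of_int (sign (\<sigma> \<circ> p)) * (\<Prod>i\<in>S. A i ((\<sigma> \<circ> p) i))))"
    unfolding sdet_def by (subst setum_permutations_compose_left[OF s]) (simp add: sum_distrib_left)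
  also have "\<dots> = sdet S (\<lambda>i j. A i (\<sigma> j))"
    unfolding sdet_def
  proof (intro sum.cong refl, clarsimp)
    fix p assume p: "p permutes S"
    have "sign (\<sigma> \<circ> p) = sign \<sigma> * sign p"
      using s p fin by (auto intro!: sign_compose simp: permutation_permutes)
    then show "of_int (sign \<sigma>) * (of_int (sign (\<sigma> \<circ> p)) * (\<Prod>i\<in>S. A i (\<sigma> (p i)))) = of_int (sign p) * (\<Prod>i\<in>S. A i (\<sigma> (p i)))"
      by (simp add: sign_def)
  qed
  finally show ?thesis by simp
qed

lemma sdet_mult_rows:
  assumes "finite S" shows "sdet S (\<lambda>i j. c i * A i j) = (\<Prod>i\<in>S. c i) * sdet S A"
  unfolding sdet_def by (simp add: prod.distrib sum_distrib_left algebra_simps)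

lemma sdet_mult_columns:
  assumes "finite S" shows "sdet S (\<lambda>i j. A i j * c j) = sdet S A * (\<Prod>i\<in>S. c i)"
proof -
  have "sdet S (\<lambda>i j. A i j * c j) = sdet S (\<lambda>i j. c i * A j i)"
    by (subst sdet_transpose[OF assms, symmetric]) (simp add: mult.commute)
  then show ?thesis
    by (simp add: sdet_mult_rows[OF assms] sdet_transpose[OF assms, of A] mult.commute)
qed

text \<open>Exchanging the two columns changes the sign but not the matrix; the sort constraint is
  what lets \<open>x = - x\<close> give \<open>x = 0\<close>.\<close>

lemma sdet_equal_columns:
  fixes A :: "'i \<Rightarrow> 'i \<Rightarrow> 'r :: {comm_ring_1, ring_char_0, semiring_no_zero_divisors}"
  assumes fin: "finite S" and jk: "j \<in> S" "k \<in> S" "j \<noteq> k" and eq: "\<And>i. i \<in> S \<Longrightarrow> A i j = A i k"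
  shows "sdet S A = 0"
proof -
  let ?t = "Transposition.transpose j k"
  have t: "?t permutes S" using jk(1,2) by (rule permutes_swap_id)
  have "sdet S A = sdet S (\<lambda>i l. A i (?t l))"
    using eq by (intro sdet_cong) (auto simp: Transposition.transpose_def)
  also have "\<dots> = - sdet S A"
    using sdet_permute_columns[OF t fin, of A] jk by (simp add: sign_swap_id)
  finally show ?thesis
    by (metis add_self_div_2 equation_minus_iff neg_equal_iff_equal neg_eq_iff_add_eq_0 add_eq_0_iff mult_2 mult_eq_0_iff zero_neq_numeral)
qed

text \<open>Expand every entry \<open>\<delta>\<^sub>i\<^sub>j + A\<^sub>i\<^sub>j\<close>; choosing \<open>\<delta>\<close> outside \<open>T\<close> forces the permutation to fix the
  complement of \<open>T\<close>.\<close>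

lemma sdet_one_plus:
  assumes fin: "finite S"
  shows "sdet S (\<lambda>i j. (if i = j then 1 else 0) + A i j) = (\<Sum>T\<in>Pow S. sdet T A)"
proof -
  have "sdet S (\<lambda>i j. (if i = j then 1 else 0) + A i j) =
    (\<Sum>p | p permutes S. of_int (sign p) * (\<Prod>i\<in>S. A i (p i) + (if i = p i then 1 else 0)))"
    unfolding sdet_def by (simp add: add.commute)
  also have "\<dots> = (\<Sum>p | p permutes S. \<Sum>T\<in>Pow S. of_int (sign p) * ((\<Prod>i\<in>T. A i (p i)) * (\<Prod>i\<in>S - T. if i = p i then 1 else 0)))"
    by (intro sum.cong refl) (simp add: prod_add[OF fin] sum_distrib_left)
  also have "\<dots> = (\<Sum>T\<in>Pow S. \<Sum>p | p permutes S. of_int (sign p) * ((\<Prod>i\<in>T. A i (p i)) * (\<Prod>i\<in>S - T. if i = p i then 1 else 0)))"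
    by (rule sum.swap)
  also have "\<dots> = (\<Sum>T\<in>Pow S. sdet T A)"
  proof (intro sum.cong refl)
    fix T assume "T \<in> Pow S"
    then have T: "T \<subseteq> S" by simp
    have sub: "{p. p permutes T} \<subseteq> {p. p permutes S}"
      using T by (auto intro: permutes_subset)
    have "(\<Sum>p | p permutes S. of_int (sign p) * ((\<Prod>i\<in>T. A i (p i)) * (\<Prod>i\<in>S - T. if i = p i then 1 else 0)))
      = (\<Sum>p | p permutes T. of_int (sign p) * ((\<Prod>i\<in>T. A i (p i)) * (\<Prod>i\<in>S - T. if i = p i then 1 else 0)))"
    proof (rule sum.mono_neutral_right)
      show "finite {p. p permutes S}" using fin by (rule finite_permutations)
      show "{p. p permutes T} \<subseteq> {p. p permutes S}" by (rule sub)
      show "\<forall>p\<in>{p. p permutes S} - {p. p permutes T}.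
         of_int (sign p) * ((\<Prod>i\<in>T. A i (p i)) * (\<Prod>i\<in>S - T. if i = p i then 1 else 0)) = 0"
      proof
        fix p assume "p \<in> {p. p permutes S} - {p. p permutes T}"
        then have p: "p permutes S" "\<not> p permutes T" by auto
        have "\<exists>i\<in>S - T. i \<noteq> p i"
          using p permutes_superset[OF p(1), of T] by metis
        then have "(\<Prod>i\<in>S - T. if i = p i then 1 else 0 :: 'b) = 0"
          using fin by (intro prod_zero) auto
        then show "of_int (sign p) * ((\<Prod>i\<in>T. A i (p i)) * (\<Prod>i\<in>S - T. if i = p i then 1 else 0)) = 0"
          by simp
      qed
    qed
    also have "\<dots> = sdet T A"
      unfolding sdet_def
    proof (intro sum.cong refl, clarsimp)
      fix p assume p: "p permutes T"
      have "(\<Prod>i\<in>S - T. if i = p i then 1 else 0 :: 'b) = 1"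
        using p by (intro prod.neutral) (auto simp: permutes_not_in)
      then show "of_int (sign p) * ((\<Prod>i\<in>T. A i (p i)) * (\<Prod>i\<in>S - T. if i = p i then 1 else 0)) =
         of_int (sign p) * (\<Prod>i\<in>T. A i (p i))" by simp
    qed
    finally show "(\<Sum>p | p permutes S. of_int (sign p) * ((\<Prod>i\<in>T. A i (p i)) * (\<Prod>i\<in>S - T. if i = p i then 1 else 0))) = sdet T A" .
  qed
  finally show ?thesis .
qed

text \<open>A non-injective \<open>f\<close> repeats a column, and every \<open>n\<close>-subset is
  the image of exactly \<open>n!\<close> injections. This turns sums of principal minors into sums
  over index tuples, the form produced by integrating a step kernel.\<close>

lemma sum_sdet_functions:
  fixes A :: "'i \<Rightarrow> 'i \<Rightarrow> 'r :: {comm_ring_1, ring_char_0, semiring_no_zero_divisors}"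
  assumes fin: "finite S"
  shows "(\<Sum>f\<in>{..<n::nat} \<rightarrow>\<^sub>E S. sdet {..<n} (\<lambda>a b. A (f a) (f b))) =
    of_nat (fact n) * (\<Sum>T | T \<subseteq> S \<and> card T = n. sdet T A)"
proof -
  let ?I = "{f \<in> {..<n} \<rightarrow>\<^sub>E S. inj_on f {..<n}}"
  have finE: "finite ({..<n} \<rightarrow>\<^sub>E S)" using fin by (intro finite_PiE) auto
  have "(\<Sum>f\<in>{..<n} \<rightarrow>\<^sub>E S. sdet {..<n} (\<lambda>a b. A (f a) (f b)))
    = (\<Sum>f\<in>?I. sdet {..<n} (\<lambda>a b. A (f a) (f b)))"
  proof (rule sum.mono_neutral_right[OF finE])
    show "\<forall>f\<in>({..<n} \<rightarrow>\<^sub>E S) - ?I. sdet {..<n} (\<lambda>a b. A (f a) (f b)) = 0"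
    proof
      fix f assume "f \<in> ({..<n} \<rightarrow>\<^sub>E S) - ?I"
      then obtain a b where "a < n" "b < n" "a \<noteq> b" "f a = f b"
        by (auto simp: inj_on_def)
      then show "sdet {..<n} (\<lambda>a b. A (f a) (f b)) = 0"
        by (intro sdet_equal_columns[of _ a b]) auto
    qed
  qed auto
  also have "\<dots> = (\<Sum>f\<in>?I. sdet (f ` {..<n}) A)"
    by (intro sum.cong refl sdet_reindex) (auto simp: inj_on_imp_bij_betw)
  also have "\<dots> = (\<Sum>T | T \<subseteq> S \<and> card T = n. \<Sum>f | f \<in> ?I \<and> f ` {..<n} = T. sdet (f ` {..<n}) A)"
  proof (rule sum.group[symmetric])
    show "finite ?I" using finE by simp
    show "finite {T. T \<subseteq> S \<and> card T = n}" using fin by simp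
    show "(\<lambda>f. f ` {..<n}) ` ?I \<subseteq> {T. T \<subseteq> S \<and> card T = n}"
      by (auto simp: card_image PiE_iff)
  qed
  also have "\<dots> = (\<Sum>T | T \<subseteq> S \<and> card T = n. of_nat (fact n) * sdet T A)"
  proof (intro sum.cong refl, clarify)
    fix T assume T: "T \<subseteq> S" "n = card T"
    have finT: "finite T" using T fin finite_subset by auto
    have "{f. f \<in> {f \<in> {..<card T} \<rightarrow>\<^sub>E S. inj_on f {..<card T}} \<and> f ` {..<card T} = T} = {f \<in> {..<card T} \<rightarrow>\<^sub>E T. inj_on f {..<card T}}"
    proof (intro equalityI subsetI)
      fix f assume f: "f \<in> {f \<in> {..<card T} \<rightarrow>\<^sub>E T. inj_on f {..<card T}}"
      then have "f ` {..<card T} = T"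
        by (intro card_subset_eq[OF finT]) (auto simp: card_image PiE_iff)
      with f T show "f \<in> {f. f \<in> {f \<in> {..<card T} \<rightarrow>\<^sub>E S. inj_on f {..<card T}} \<and> f ` {..<card T} = T}"
        by (auto simp: PiE_iff)
    qed (auto simp: PiE_iff)
    moreover have "card {f \<in> {..<card T} \<rightarrow>\<^sub>E T. inj_on f {..<card T}} = fact (card T)"
      using card_inj_on_subset_funcset[of "{..<card T}" T "{..<card T}"] finT
      by (simp add: fact_prod_rev)
    moreover have "(\<Sum>f | f \<in> {f \<in> {..<card T} \<rightarrow>\<^sub>E S. inj_on f {..<card T}} \<and> f ` {..<card T} = T. sdet (f ` {..<card T}) A)
      = (\<Sum>f | f \<in> {f \<in> {..<card T} \<rightarrow>\<^sub>E S. inj_on f {..<card T}} \<and> f ` {..<card T} = T. sdet T A)"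
      by (intro sum.cong refl) auto
    ultimately show "(\<Sum>f | f \<in> {f \<in> {..<card T} \<rightarrow>\<^sub>E S. inj_on f {..<card T}} \<and> f ` {..<card T} = T. sdet (f ` {..<card T}) A) = of_nat (fact (card T)) * sdet T A"
      by simp
  qed
  finally show ?thesis by (simp add: sum_distrib_left)
qed

section \<open>Total positivity and the inequality of Hadamard\<close>

text \<open>The cofactors \<open>C\<close> see only the first \<open>n\<close> columns, so the
  determinant is one fixed linear functional of the last column. This is what allows the last point
  to be treated as a free variable below.\<close>

lemma sdet_expand_last_column:
  fixes A :: "nat \<Rightarrow> nat \<Rightarrow> real"
  obtains C where "\<And>B. (\<And>i j. i \<le> n \<Longrightarrow> j < n \<Longrightarrow> B i j = A i j) \<Longrightarrow>
      sdet {..<Suc n} B = (\<Sum>i\<le>n. B i n * C i)"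
    and "C n = sdet {..<n} A"
proof -
  define C where "C i = (-1) ^ (i + n) * Determinant.det (mat_delete (Matrix.mat (Suc n) (Suc n) (\<lambda>(i, j). A i j)) i n)" for i
  show thesis
  proof (rule that[of C])
    fix B :: "nat \<Rightarrow> nat \<Rightarrow> real"
    assume B: "\<And>i j. i \<le> n \<Longrightarrow> j < n \<Longrightarrow> B i j = A i j"
    let ?B = "Matrix.mat (Suc n) (Suc n) (\<lambda>(i, j). B i j)"
    have "mat_delete ?B i n = mat_delete (Matrix.mat (Suc n) (Suc n) (\<lambda>(i, j). A i j)) i n" if "i \<le> n" for i
      using that B by (intro eq_matI) (auto simp: mat_delete_def)
    moreover have "Determinant.det ?B = (\<Sum>i<Suc n. ?B $$ (i, n) * cofactor ?B i n)"
      by (rule laplace_expansion_column) auto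
    ultimately show "sdet {..<Suc n} B = (\<Sum>i\<le>n. B i n * C i)"
      unfolding det_mat_eq_sdet lessThan_Suc_atMost
      by (auto simp: C_def cofactor_def simp flip: det_mat_eq_sdet intro!: sum.cong)
  next
    have "mat_delete (Matrix.mat (Suc n) (Suc n) (\<lambda>(i, j). A i j)) n n = Matrix.mat n n (\<lambda>(i, j). A i j)"
      by (intro eq_matI) (auto simp: mat_delete_def)
    then show "C n = sdet {..<n} A"
      by (simp add: C_def det_mat_eq_sdet flip: power_mult_distrib mult_2)
  qed
qed

lemma sdet_block_last_column:
  fixes A :: "nat \<Rightarrow> nat \<Rightarrow> real"
  assumes "\<And>i. i < n \<Longrightarrow> A i n = 0"
  shows "sdet {..<Suc n} A = A n n * sdet {..<n} A"
proof -
  obtain C where C: "\<And>B. (\<And>i j. i \<le> n \<Longrightarrow> j < n \<Longrightarrow> B i j = A i j) \<Longrightarrow>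
      sdet {..<Suc n} B = (\<Sum>i\<le>n. B i n * C i)" and Cn: "C n = sdet {..<n} A"
    using sdet_expand_last_column[of n A] by blast
  have "sdet {..<Suc n} A = (\<Sum>i\<le>n. A i n * C i)" by (rule C) auto
  also have "\<dots> = A n n * C n"
    using assms by (simp add: sum.atMost_Suc lessThan_Suc_atMost[symmetric])
  finally show ?thesis using Cn by simp
qed

text \<open>One zero of the derivative lies strictly between two neighbouring zeros; keeping the
  families increasing allows the count to be iterated.\<close>

lemma Rolle_zeros:
  fixes f :: "real \<Rightarrow> real"
  assumes d: "\<And>x. (f has_real_derivative f' x) (at x)"
    and z: "strict_mono_on {..<Suc n} z" "\<And>i. i < Suc n \<Longrightarrow> f (z i) = 0"
  obtains w where "strict_mono_on {..<n} w" "\<And>i. i < n \<Longrightarrow> f' (w i) = 0"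
proof -
  have "\<exists>w. z i < w \<and> w < z (Suc i) \<and> f' w = 0" if "i < n" for i
  proof -
    have "z i < z (Suc i)" using z(1) that by (auto simp: strict_mono_on_def)
    moreover have "f (z i) = f (z (Suc i))" using z(2) that by simp
    moreover have "continuous_on {z i..z (Suc i)} f"
      using d by (auto intro!: DERIV_continuous_on intro: has_field_derivative_at_within)
    ultimately obtain w where "z i < w" "w < z (Suc i)" "(*) (f' w) = (\<lambda>v. 0)"
      using Rolle_deriv[of "z i" "z (Suc i)" f "\<lambda>x. (*) (f' x)"] d
      by (auto simp: has_field_derivative_def)
    moreover from this have "f' w = 0" by (metis mult.right_neutral)
    ultimately show ?thesis by blast
  qed
  then obtain w where w: "\<And>i. i < n \<Longrightarrow> z i < w i \<and> w i < z (Suc i) \<and> f' (w i) = 0" by metis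
  have "w i < w j" if "i < j" "j < n" for i j
  proof -
    have "w i < z (Suc i)" using w that by simp
    also have "z (Suc i) \<le> z j"
      using z(1) that by (cases "Suc i = j") (auto simp: strict_mono_on_def less_imp_le)
    also have "z j < w j" using w that by simp
    finally show ?thesis .
  qed
  then show thesis using w by (intro that[of w]) (auto simp: strict_mono_on_def)
qed

text \<open>Exponentials with distinct rates form a Chebyshev system. Dividing by
  \<open>exp (x n * y)\<close> makes the last term constant, differentiation removes it, and Rolle's
  theorem loses only one zero.\<close>

lemma exp_sum_zeros:
  fixes c x z :: "nat \<Rightarrow> real"
  assumes "inj_on x {..<n}" "strict_mono_on {..<n} z" "\<And>i. i < n \<Longrightarrow> (\<Sum>a<n. c a * exp (x a * z i)) = 0"
  shows "\<forall>a<n. c a = 0"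
  using assms
proof (induction n arbitrary: c x z)
  case (Suc n)
  define f where "f y = (\<Sum>a<Suc n. c a * exp ((x a - x n) * y))" for y
  define f' where "f' y = (\<Sum>a<n. (c a * (x a - x n)) * exp ((x a - x n) * y))" for y
  have "(f has_real_derivative f' y) (at y)" for y
    unfolding f_def f'_def by (auto intro!: derivative_eq_intros sum.cong simp: algebra_simps)
  moreover have "f (z i) = 0" if "i < Suc n" for i
  proof -
    have "f (z i) = exp (- x n * z i) * (\<Sum>a<Suc n. c a * exp (x a * z i))"
      unfolding f_def sum_distrib_left
      by (intro sum.cong refl) (simp add: left_diff_distrib exp_diff exp_minus field_simps)
    then show ?thesis using Suc.prems(3)[OF that] by simp
  qed
  ultimately obtain w where w: "strict_mono_on {..<n} w" "\<And>i. i < n \<Longrightarrow> f' (w i) = 0"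
    using Rolle_zeros[of f f' n z] Suc.prems(2) by blast
  have "\<forall>a<n. c a * (x a - x n) = 0"
    by (rule Suc.IH[of "\<lambda>a. x a - x n" w])
       (use Suc.prems(1) w in \<open>auto simp: inj_on_def f'_def\<close>)
  moreover have "x a \<noteq> x n" if "a < n" for a
    using Suc.prems(1) that by (auto simp: inj_on_def)
  ultimately have c0: "\<forall>a<n. c a = 0" by auto
  then have "c n = 0"
    using Suc.prems(3)[of 0] by simp
  with c0 show ?case by (auto simp: less_Suc_eq)
qed simp

text \<open>Let the last point \<open>t\<close> vary. The determinant is an exponential sum
  \<open>f\<close> that vanishes at the other \<open>n\<close> points, so a further zero to their
  right would kill all coefficients, while \<open>C n\<close> is positive by induction. Hence
  \<open>f\<close> keeps one sign there, and its growth at infinity shows that the sign is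
  positive.\<close>

lemma sdet_exp_pos:
  fixes x y :: "nat \<Rightarrow> real"
  assumes "strict_mono_on {..<n} x" "strict_mono_on {..<n} y"
  shows "sdet {..<n} (\<lambda>a b. exp (x a * y b)) > 0"
  using assms
proof (induction n arbitrary: x y)
  case (Suc n)
  let ?A = "\<lambda>a b. exp (x a * y b)"
  obtain C where C: "\<And>B. (\<And>i j. i \<le> n \<Longrightarrow> j < n \<Longrightarrow> B i j = ?A i j) \<Longrightarrow>
      sdet {..<Suc n} B = (\<Sum>i\<le>n. B i n * C i)" and Cn: "C n = sdet {..<n} ?A"
    using sdet_expand_last_column[of n ?A] by blast
  have Cpos: "C n > 0"
    unfolding Cn by (rule Suc.IH) (use Suc.prems in \<open>auto simp: strict_mono_on_def\<close>)
  define f where "f t = (\<Sum>a\<le>n. C a * exp (x a * t))" for t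
  have f_det: "f t = sdet {..<Suc n} (\<lambda>a b. exp (x a * (y(n := t)) b))" for t
    unfolding f_def by (subst C) (auto simp: mult.commute)
  have f_zero: "f (y j) = 0" if "j < n" for j
    unfolding f_det by (rule sdet_equal_columns[of _ j n]) (use that in auto)
  have cont: "continuous_on A f" for A
    unfolding f_def by (intro continuous_intros)
  have nz: "f t \<noteq> 0" if t: "\<And>j. j < n \<Longrightarrow> y j < t" for t
  proof
    assume ft: "f t = 0"
    have "\<forall>a<Suc n. C a = 0"
    proof (rule exp_sum_zeros[of x "Suc n" "y(n := t)"])
      show "inj_on x {..<Suc n}" using Suc.prems(1) by (rule strict_mono_on_imp_inj_on)
      show "strict_mono_on {..<Suc n} (y(n := t))"
        using Suc.prems(2) t by (auto simp: strict_mono_on_def less_Suc_eq)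
      show "(\<Sum>a<Suc n. C a * exp (x a * (y(n := t)) i)) = 0" if "i < Suc n" for i
        using f_zero[of i] ft that unfolding f_def lessThan_Suc_atMost by (auto simp: less_Suc_eq)
    qed
    with Cpos show False by simp
  qed
  \<comment> \<open>The largest rate \<open>x n\<close> dominates, so \<open>f\<close> is eventually
    positive because \<open>C n\<close> is.\<close>
  have lim: "((\<lambda>t. exp (- x n * t) * f t) \<longlongrightarrow> C n) at_top"
  proof -
    have "((\<lambda>t. (\<Sum>a<n. C a * exp ((x a - x n) * t)) + C n) \<longlongrightarrow> (\<Sum>a<n. C a * 0) + C n) at_top"
    proof (intro tendsto_intros)
      fix a assume "a \<in> {..<n}"
      then have "x a - x n < 0" using Suc.prems(1) by (auto simp: strict_mono_on_def)
      then show "((\<lambda>t. exp ((x a - x n) * t)) \<longlongrightarrow> 0) at_top"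
        by real_asymp
    qed
    moreover have "exp (- x n * t) * f t = (\<Sum>a<n. C a * exp ((x a - x n) * t)) + C n" for t
      unfolding f_def lessThan_Suc_atMost[symmetric] sum.lessThan_Suc distrib_left sum_distrib_left
      by (intro arg_cong2[where f="(+)"] sum.cong refl)
         (simp_all add: left_diff_distrib exp_diff exp_minus field_simps)
    ultimately show ?thesis by simp
  qed
  have "f (y n) > 0"
  proof (rule ccontr)
    assume "\<not> f (y n) > 0"
    have "\<forall>\<^sub>F t in at_top. exp (- x n * t) * f t > 0 \<and> t \<ge> y n"
      using order_tendstoD(1)[OF lim Cpos] eventually_ge_at_top[of "y n"] by eventually_elim auto
    then obtain t where t: "t \<ge> y n" "f t > 0"
      using eventually_happens'[OF trivial_limit_at_top_linorder] by (fastforce simp: zero_less_mult_iff)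
    obtain s where "y n \<le> s" "s \<le> t" "f s = 0"
      using IVT'[of f "y n" 0 t] t \<open>\<not> f (y n) > 0\<close> cont by auto
    moreover have "y j < s" if "j < n" for j
    proof -
      have "y j < y n" using Suc.prems(2) that by (auto simp: strict_mono_on_def)
      then show ?thesis using \<open>y n \<le> s\<close> by simp
    qed
    ultimately show False using nz by blast
  qed
  then show ?case unfolding f_det by simp
qed simp

text \<open>As a function of the last point the determinant is a polynomial of degree at most
  \<open>n\<close> with the other points as roots and a known coefficient at degree
  \<open>n\<close>; this determines it if the points are distinct.\<close>

lemma sdet_poly_vandermonde:
  fixes g :: "nat \<Rightarrow> real poly" and x :: "nat \<Rightarrow> real"
  assumes deg: "\<And>a. a < n \<Longrightarrow> degree (g a) \<le> a"
  shows "sdet {..<n} (\<lambda>a i. poly (g a) (x i)) = (\<Prod>a<n. coeff (g a) a) * (\<Prod>j<n. \<Prod>i<j. x j - x i)"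
  using deg
proof (induction n)
  case (Suc n)
  let ?A = "\<lambda>a i. poly (g a) (x i)"
  show ?case
  proof (cases "inj_on x {..<Suc n}")
    case False
    then obtain i j where ij: "i < j" "j < Suc n" "x i = x j"
      unfolding inj_on_def by (metis lessThan_iff linorder_neqE_nat)
    then have "sdet {..<Suc n} ?A = 0" by (intro sdet_equal_columns[of _ i j]) auto
    moreover have "(\<Prod>j<Suc n. \<Prod>i<j. x j - x i) = 0"
      by (rule prod_zero, simp, rule bexI[of _ j], rule prod_zero, simp, rule bexI[of _ i]) (use ij in auto)
    ultimately show ?thesis by simp
  next
    case True
    obtain C where C: "\<And>B. (\<And>i j. i \<le> n \<Longrightarrow> j < n \<Longrightarrow> B i j = ?A i j) \<Longrightarrow>
        sdet {..<Suc n} B = (\<Sum>i\<le>n. B i n * C i)" and Cn: "C n = sdet {..<n} ?A"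
      using sdet_expand_last_column[of n ?A] by blast
    define P where "P = (\<Sum>i\<le>n. Polynomial.smult (C i) (g i))"
    define Q where "Q = Polynomial.smult (C n * coeff (g n) n) (\<Prod>i<n. [:- x i, 1:])"
    have P_det: "poly P t = sdet {..<Suc n} (\<lambda>a i. poly (g a) ((x(n := t)) i))" for t
      unfolding P_def by (subst C) (auto simp: poly_sum mult.commute)
    have P0: "poly P (x i) = 0" if "i < n" for i
      unfolding P_det by (rule sdet_equal_columns[of _ i n]) (use that in auto)
    have degP: "degree P \<le> n"
      unfolding P_def
    proof (intro degree_sum_le)
      fix p assume "p \<in> {..n}"
      then show "degree (Polynomial.smult (C p) (g p)) \<le> n"
        using degree_smult_le[of "C p" "g p"] Suc.prems[of p] by auto
    qed simp
    have degprod: "degree (\<Prod>i<n. [:- x i, 1:]) = n" "lead_coeff (\<Prod>i<n. [:- x i, 1:]) = 1"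
      by (subst degree_prod_eq_sum_degree) (auto simp: lead_coeff_prod)
    have degQ: "degree Q \<le> n"
      unfolding Q_def using degree_smult_le[of _ "\<Prod>i<n. [:- x i, 1:]"] degprod by simp
    have coeffP: "coeff P n = C n * coeff (g n) n"
    proof -
      have "coeff P n = (\<Sum>i\<le>n. C i * coeff (g i) n)" by (simp add: P_def coeff_sum)
      also have "\<dots> = (\<Sum>i<n. C i * coeff (g i) n) + C n * coeff (g n) n"
        by (simp add: lessThan_Suc_atMost[symmetric])
      also have "(\<Sum>i<n. C i * coeff (g i) n) = 0"
      proof (intro sum.neutral ballI)
        fix i assume "i \<in> {..<n}"
        then have "degree (g i) < n" using Suc.prems[of i] by auto
        then show "C i * coeff (g i) n = 0" by (simp add: coeff_eq_0)
      qed
      finally show ?thesis by simp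
    qed
    \<comment> \<open>The leading terms cancel, so a nonzero difference would have degree below
      \<open>n\<close> but \<open>n\<close> distinct roots.\<close>
    have "P - Q = 0"
    proof (rule ccontr)
      assume nz: "P - Q \<noteq> 0"
      have "coeff (P - Q) n = 0"
        using degprod by (simp add: coeffP Q_def)
      moreover have "degree (P - Q) \<le> n" using degP degQ by (rule degree_diff_le)
      ultimately have lt: "degree (P - Q) < n"
        using nz by (metis le_neq_implies_less leading_coeff_0_iff)
      have "x ` {..<n} \<subseteq> {t. poly (P - Q) t = 0}"
        using P0 by (auto simp: Q_def poly_prod intro!: prod_zero)
      then have "card (x ` {..<n}) \<le> degree (P - Q)"
        using card_poly_roots_bound[OF nz] poly_roots_finite[OF nz] card_mono order_trans by blast
      moreover have "card (x ` {..<n}) = n"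
        using card_image[OF inj_on_subset[OF True, of "{..<n}"]] by simp
      ultimately show False using lt by simp
    qed
    then have "sdet {..<Suc n} ?A = poly Q (x n)" using P_det[of "x n"] by simp
    also have "\<dots> = C n * coeff (g n) n * (\<Prod>i<n. x n - x i)"
      by (simp add: Q_def poly_prod)
    also have "C n = (\<Prod>a<n. coeff (g a) a) * (\<Prod>j<n. \<Prod>i<j. x j - x i)"
      unfolding Cn by (rule Suc.IH) (use Suc.prems in auto)
    finally show ?thesis by (simp add: mult_ac)
  qed
qed simp

text \<open>Hadamard's inequality, by Schur complements of the Gram matrix.\<close>

definition psd :: "nat \<Rightarrow> (nat \<Rightarrow> nat \<Rightarrow> real) \<Rightarrow> bool" where
  "psd n G \<longleftrightarrow> (\<forall>i<n. \<forall>j<n. G i j = G j i) \<and> (\<forall>v. 0 \<le> (\<Sum>i<n. \<Sum>j<n. v i * v j * G i j))"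

lemma psd_diag_nonneg: "psd n G \<Longrightarrow> i < n \<Longrightarrow> 0 \<le> G i i"
proof -
  assume G: "psd n G" and i: "i < n"
  have "0 \<le> (\<Sum>k<n. \<Sum>l<n. of_bool (k = i) * of_bool (l = i) * G k l)"
    by (rule G[unfolded psd_def, THEN conjunct2, THEN spec])
  also have "\<dots> = (\<Sum>k<n. if k = i then (\<Sum>l<n. if l = i then G k l else 0) else 0)"
    by (intro sum.cong refl) (auto intro!: sum.cong)
  finally show ?thesis using i by simp
qed

text \<open>The quadratic form at \<open>v\<close> extended by the last coordinate \<open>t\<close>.
  Choosing \<open>t\<close> is the only way positivity is exploited in the elimination
  below.\<close>

lemma psd_Suc:
  assumes G: "psd (Suc n) G"
  shows "0 \<le> (\<Sum>i<n. \<Sum>j<n. v i * v j * G i j) + 2 * t * (\<Sum>i<n. v i * G i n) + t\<^sup>2 * G n n"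
proof -
  let ?v = "v(n := t)"
  have sym: "G n i = G i n" if "i < n" for i using G that by (auto simp: psd_def)
  have "0 \<le> (\<Sum>i<Suc n. \<Sum>j<Suc n. ?v i * ?v j * G i j)"
    by (rule G[unfolded psd_def, THEN conjunct2, THEN spec])
  also have "\<dots> = (\<Sum>i<n. (\<Sum>j<n. v i * v j * G i j) + v i * t * G i n) + ((\<Sum>j<n. t * v j * G j n) + t * t * G n n)"
    using sym by simp
  also have "\<dots> = (\<Sum>i<n. \<Sum>j<n. v i * v j * G i j) + 2 * t * (\<Sum>i<n. v i * G i n) + t\<^sup>2 * G n n"
    by (simp add: sum.distrib sum_distrib_left power2_eq_square algebra_simps)
  finally show ?thesis .
qed

text \<open>Eliminating the last index gives \<open>G n n\<close> times the determinant of the Schur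
  complement, which is again positive semidefinite and has a smaller diagonal. If
  \<open>G n n\<close> vanishes, the whole last column does.\<close>

lemma psd_det_bounds:
  assumes "psd n G"
  shows "0 \<le> sdet {..<n} G \<and> sdet {..<n} G \<le> (\<Prod>i<n. G i i)"
  using assms
proof (induction n arbitrary: G)
  case (Suc n)
  have sym: "G i j = G j i" if "i \<le> n" "j \<le> n" for i j
    using Suc.prems that by (auto simp: psd_def)
  have dn: "0 \<le> G i i" if "i \<le> n" for i
    using psd_diag_nonneg[OF Suc.prems, of i] that by simp
  show ?case
  proof (cases "G n n = 0")
    case True
    have z: "G i n = 0" if i: "i < n" for i
    proof (rule ccontr)
      assume ne: "G i n \<noteq> 0"
      \<comment> \<open>With \<open>G n n = 0\<close> the form is affine in \<open>t\<close> with
        slope \<open>2 * G i n\<close>; at this value it equals -1.\<close>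
      let ?t = "- (G i i + 1) / (2 * G i n)"
      have "0 \<le> (\<Sum>k<n. \<Sum>j<n. of_bool (k = i) * of_bool (j = i) * G k j) + 2 * ?t * (\<Sum>k<n. of_bool (k = i) * G k n) + ?t\<^sup>2 * G n n"
        by (rule psd_Suc[OF Suc.prems])
      moreover have "(\<Sum>k<n. \<Sum>j<n. of_bool (k = i) * of_bool (j = i) * G k j) = (\<Sum>k<n. if k = i then (\<Sum>l<n. if l = i then G k l else 0) else 0)"
        by (intro sum.cong refl) (auto intro!: sum.cong)
      moreover have "(\<Sum>k<n. of_bool (k = i) * G k n) = (\<Sum>k<n. if k = i then G k n else 0)"
        by (intro sum.cong) auto
      ultimately have "0 \<le> G i i + 2 * ?t * G i n" using i True by simp
      then show False using ne by (simp add: field_simps)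
    qed
    have "sdet {..<Suc n} G = 0" using sdet_block_last_column[of n G] z True by simp
    moreover have "(\<Prod>i<Suc n. G i i) = 0" using True by simp
    ultimately show ?thesis by (metis order_refl)
  next
    case False
    then have pos: "G n n > 0" using dn[of n] by simp
    define S where "S i j = G i j - G i n * G n j / G n n" for i j
    have psdS: "psd n S"
      unfolding psd_def
    proof (intro conjI allI impI)
      show "S i j = S j i" if "i < n" "j < n" for i j
        using sym that by (simp add: S_def mult.commute)
      fix v
      let ?b = "\<Sum>i<n. v i * G i n"
      \<comment> \<open>The value \<open>- ?b / G n n\<close> minimises the quadratic in
        \<open>t\<close>, and the minimum is the form of the Schur complement at
        \<open>v\<close>.\<close>
      have "0 \<le> (\<Sum>i<n. \<Sum>j<n. v i * v j * G i j) + 2 * (- ?b / G n n) * ?b + (- ?b / G n n)\<^sup>2 * G n n"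
        by (rule psd_Suc[OF Suc.prems])
      also have "\<dots> = (\<Sum>i<n. \<Sum>j<n. v i * v j * G i j) - ?b * ?b / G n n"
        using pos by (simp add: field_simps power2_eq_square)
      also have "?b * ?b = (\<Sum>i<n. \<Sum>j<n. v i * v j * (G i n * G n j))"
        unfolding sum_product using sym by (intro sum.cong refl) (auto simp: mult_ac)
      also have "(\<Sum>i<n. \<Sum>j<n. v i * v j * G i j) - (\<Sum>i<n. \<Sum>j<n. v i * v j * (G i n * G n j)) / G n n = (\<Sum>i<n. \<Sum>j<n. v i * v j * S i j)"
        unfolding S_def by (simp add: sum_divide_distrib right_diff_distrib sum_subtractf)
      finally show "0 \<le> (\<Sum>i<n. \<Sum>j<n. v i * v j * S i j)" .
    qed
    \<comment> \<open>The column-reduced matrix: multiples of the last column are subtracted from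
      the others, so the last row vanishes off the diagonal. The multiplier \<open>?E\<close> below
      is unit triangular, hence the determinant is kept.\<close>
    define S' where "S' i j = (if j = n then G i n else G i j - G i n * G n j / G n n)" for i j
    have "sdet {..<Suc n} G = sdet {..<Suc n} S'"
    proof -
      let ?G = "Matrix.mat (Suc n) (Suc n) (\<lambda>(i, j). G i j)"
      let ?E = "Matrix.mat (Suc n) (Suc n) (\<lambda>(i, j). if i = j then 1 else if i = n then - G n j / G n n else 0)"
      have "Determinant.det ?E = prod_list (diag_mat ?E)"
        by (rule det_lower_triangular[of "Suc n"]) auto
      also have "\<dots> = 1" by (simp add: prod_list_diag_prod)
      finally have "Determinant.det (?G * ?E) = Determinant.det ?G"
        by (subst det_mult[of _ "Suc n"]) auto
      moreover have "?G * ?E = Matrix.mat (Suc n) (Suc n) (\<lambda>(i, j). S' i j)"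
      proof (rule eq_matI)
        fix i j assume "i < dim_row (Matrix.mat (Suc n) (Suc n) (\<lambda>(i, j). S' i j))" "j < dim_col (Matrix.mat (Suc n) (Suc n) (\<lambda>(i, j). S' i j))"
        then have ij: "i \<le> n" "j \<le> n" by auto
        have "(?G * ?E) $$ (i, j) = (\<Sum>k<Suc n. G i k * (if k = j then 1 else if k = n then - G n j / G n n else 0))"
          using ij by (auto simp: scalar_prod_def atLeast0LessThan simp del: sum.lessThan_Suc intro!: sum.cong)
        also have "\<dots> = (\<Sum>k<n. G i k * (if k = j then 1 else if k = n then - G n j / G n n else 0)) + G i n * (if n = j then 1 else - G n j / G n n)"
          by simp
        also have "(\<Sum>k<n. G i k * (if k = j then 1 else if k = n then - G n j / G n n else 0)) = (\<Sum>k<n. if k = j then G i k else 0)"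
          by (intro sum.cong) auto
        also have "(\<Sum>k<n. if k = j then G i k else 0) + G i n * (if n = j then 1 else - G n j / G n n) = S' i j"
          using ij by (auto simp: S'_def)
        finally show "(?G * ?E) $$ (i, j) = Matrix.mat (Suc n) (Suc n) (\<lambda>(i, j). S' i j) $$ (i, j)"
          using ij by simp
      qed auto
      ultimately show ?thesis unfolding det_mat_eq_sdet[symmetric] by simp
    qed
    also have "\<dots> = sdet {..<Suc n} (\<lambda>i j. S' j i)" by (rule sdet_transpose[symmetric]) simp
    also have "\<dots> = S' n n * sdet {..<n} (\<lambda>i j. S' j i)"
      by (rule sdet_block_last_column) (use pos in \<open>auto simp: S'_def\<close>)
    also have "sdet {..<n} (\<lambda>i j. S' j i) = sdet {..<n} S'" by (rule sdet_transpose) simp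
    also have "sdet {..<n} S' = sdet {..<n} S" by (rule sdet_cong) (auto simp: S'_def S_def)
    also have "S' n n = G n n" by (simp add: S'_def)
    finally have eq: "sdet {..<Suc n} G = G n n * sdet {..<n} S" .
    note IH = Suc.IH[OF psdS]
    have "(\<Prod>i<n. S i i) \<le> (\<Prod>i<n. G i i)"
    proof (rule prod_mono, safe)
      fix i assume "i < n"
      then show "0 \<le> S i i" using psd_diag_nonneg[OF psdS] by simp
      show "S i i \<le> G i i" using sym[of n i] pos \<open>i < n\<close> by (simp add: S_def)
    qed
    then show ?thesis
      unfolding eq using IH pos by (auto simp: mult.commute intro!: mult_left_mono)
  qed
qed simp

text \<open>The Gram matrix of the rows has determinant \<open>(sdet {..<n} A)\<^sup>2\<close> and
  diagonal entries at most \<open>n\<close>.\<close>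

lemma Hadamard_unit_entries:
  fixes A :: "nat \<Rightarrow> nat \<Rightarrow> real"
  assumes A: "\<And>i j. i < n \<Longrightarrow> j < n \<Longrightarrow> \<bar>A i j\<bar> \<le> 1"
  shows "\<bar>sdet {..<n} A\<bar> \<le> sqrt (real n ^ n)"
proof -
  define G where "G i j = (\<Sum>k<n. A i k * A j k)" for i j
  have "psd n G"
    unfolding psd_def
  proof (intro conjI allI impI)
    show "G i j = G j i" for i j by (simp add: G_def mult.commute)
    fix v
    have "(\<Sum>i<n. \<Sum>j<n. v i * v j * G i j) = (\<Sum>i<n. \<Sum>j<n. \<Sum>k<n. (v i * A i k) * (v j * A j k))"
      unfolding G_def sum_distrib_left by (intro sum.cong refl) (simp add: mult_ac)
    also have "\<dots> = (\<Sum>i<n. \<Sum>k<n. \<Sum>j<n. (v i * A i k) * (v j * A j k))"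
      by (intro sum.cong refl sum.swap)
    also have "\<dots> = (\<Sum>k<n. \<Sum>i<n. \<Sum>j<n. (v i * A i k) * (v j * A j k))"
      by (rule sum.swap)
    also have "\<dots> = (\<Sum>k<n. (\<Sum>i<n. v i * A i k)\<^sup>2)"
      by (simp add: sum_product power2_eq_square)
    finally show "0 \<le> (\<Sum>i<n. \<Sum>j<n. v i * v j * G i j)" by (simp add: sum_nonneg)
  qed
  then have le: "sdet {..<n} G \<le> (\<Prod>i<n. G i i)" using psd_det_bounds by blast
  let ?A = "Matrix.mat n n (\<lambda>(i, j). A i j)"
  have "?A * transpose_mat ?A = Matrix.mat n n (\<lambda>(i, j). G i j)"
    by (intro eq_matI) (auto simp: scalar_prod_def G_def atLeast0LessThan)
  then have "sdet {..<n} G = (sdet {..<n} A)\<^sup>2"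
    unfolding det_mat_eq_sdet[symmetric]
    by (metis (no_types, lifting) det_mult det_transpose mat_carrier power2_eq_square transpose_carrier_mat)
  also have "(\<Prod>i<n. G i i) \<le> (\<Prod>i<n. real n)"
  proof (rule prod_mono, safe)
    fix i assume i: "i < n"
    show "0 \<le> G i i" by (auto simp: G_def intro: sum_nonneg)
    have "A i k * A i k \<le> 1" if "k < n" for k
      using A[OF i that] abs_square_le_1[of "A i k"] by (simp add: power2_eq_square)
    then have "G i i \<le> (\<Sum>k<n. 1)" unfolding G_def by (intro sum_mono) auto
    then show "G i i \<le> real n" by simp
  qed
  ultimately have "(sdet {..<n} A)\<^sup>2 \<le> real n ^ n" using le by simp
  then show ?thesis by (rule real_le_rsqrt[of "\<bar>_\<bar>", simplified])
qed

text \<open>Rows and columns are rescaled to unit entries. The weights will decay in the variables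
  of the kernel, which makes the bound integrable over an unbounded domain.\<close>

lemma Hadamard_weighted:
  fixes A :: "nat \<Rightarrow> nat \<Rightarrow> real"
  assumes A: "\<And>i j. i < n \<Longrightarrow> j < n \<Longrightarrow> \<bar>A i j\<bar> \<le> \<alpha> i * \<beta> j"
    and pos: "\<And>i. \<alpha> i > 0" "\<And>i. \<beta> i > 0"
  shows "\<bar>sdet {..<n} A\<bar> \<le> sqrt (real n ^ n) * (\<Prod>i<n. \<alpha> i * \<beta> i)"
proof -
  define B where "B i j = A i j / (\<alpha> i * \<beta> j)" for i j
  have nz: "\<alpha> i \<noteq> 0" "\<beta> i \<noteq> 0" for i using pos less_irrefl by metis+
  have "sdet {..<n} A = sdet {..<n} (\<lambda>i j. \<alpha> i * (B i j * \<beta> j))"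
    by (intro sdet_cong) (simp add: B_def nz)
  also have "\<dots> = (\<Prod>i<n. \<alpha> i) * (sdet {..<n} B * (\<Prod>i<n. \<beta> i))"
    by (simp add: sdet_mult_rows sdet_mult_columns)
  also have "\<bar>\<dots>\<bar> = \<bar>sdet {..<n} B\<bar> * (\<Prod>i<n. \<alpha> i * \<beta> i)"
    using pos by (simp add: abs_mult prod.distrib abs_prod less_imp_le)
  also have "\<dots> \<le> sqrt (real n ^ n) * (\<Prod>i<n. \<alpha> i * \<beta> i)"
    using A pos by (intro mult_right_mono Hadamard_unit_entries prod_nonneg)
      (auto simp: B_def abs_mult divide_le_eq_1 less_imp_le)
  finally show ?thesis .
qed

section \<open>The identity of Andreief and chains of determinants\<close>

text \<open>The permutation is the rank: any sorting permutation must send \<open>i\<close> to the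
  number of \<open>k\<close> with \<open>y k \<le> y i\<close>.\<close>

lemma ex1_sorting_permutation:
  fixes y :: "nat \<Rightarrow> real"
  assumes inj: "inj_on y {1..N}"
  shows "\<exists>!\<sigma>. \<sigma> permutes {1..N} \<and> strict_mono_on {1..N} (y \<circ> inv_into UNIV \<sigma>)"
proof -
  define rk where "rk i = card {k\<in>{1..N}. y k \<le> y i}" for i
  define \<rho> where "\<rho> i = (if i \<in> {1..N} then rk i else i)" for i
  have rk_less: "rk i < rk j" if "i \<in> {1..N}" "j \<in> {1..N}" "y i < y j" for i j
  proof -
    define R where "R i = {k\<in>{1..N}. y k \<le> y i}" for i
    have "j \<in> R j" "j \<notin> R i" "R i \<subseteq> R j" "finite (R j)" using that by (auto simp: R_def)
    then have "card (R i) < card (R j)" by (intro psubset_card_mono) auto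
    then show ?thesis by (simp add: R_def rk_def)
  qed
  have rk_mem: "rk i \<in> {1..N}" if "i \<in> {1..N}" for i
  proof -
    have "{k\<in>{1..N}. y k \<le> y i} \<noteq> {}" using that by auto
    moreover have "card {k\<in>{1..N}. y k \<le> y i} \<le> card {1..N}" by (intro card_mono) auto
    ultimately show ?thesis by (auto simp: rk_def card_gt_0_iff Suc_le_eq)
  qed
  have rk_inj: "inj_on rk {1..N}"
  proof (rule inj_onI, rule ccontr)
    fix i j assume ij: "i \<in> {1..N}" "j \<in> {1..N}" "rk i = rk j" "i \<noteq> j"
    then have "y i \<noteq> y j" using inj_onD[OF inj, of i j] by blast
    then consider "y i < y j" | "y j < y i" by linarith
    then show False by cases (use rk_less[OF ij(1,2)] rk_less[OF ij(2,1)] ij(3) in auto)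
  qed
  have "bij_betw rk {1..N} {1..N}"
    unfolding bij_betw_def
  proof
    show "rk ` {1..N} = {1..N}" by (rule endo_inj_surj[OF _ image_subsetI[OF rk_mem] rk_inj]) auto
  qed (rule rk_inj)
  then have \<rho>: "\<rho> permutes {1..N}"
    by (intro bij_imp_permutes, subst bij_betw_cong[where g = rk]) (auto simp: \<rho>_def)
  show ?thesis
  proof (rule ex1I[of _ \<rho>], safe)
    show "\<rho> permutes {1..N}" by (rule \<rho>)
    show "strict_mono_on {1..N} (y \<circ> inv_into UNIV \<rho>)"
    proof (rule strict_mono_onI)
      fix i j assume ij: "i \<in> {1..N}" "j \<in> {1..N}" "i < j"
      define a b where "a = inv_into UNIV \<rho> i" and "b = inv_into UNIV \<rho> j"
      have ab: "a \<in> {1..N}" "b \<in> {1..N}"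
        using ij permutes_in_image[OF permutes_inv[OF \<rho>]] by (auto simp: a_def b_def)
      have "rk a = i" "rk b = j"
        using permutes_inverses(1)[OF \<rho>, of i] permutes_inverses(1)[OF \<rho>, of j] ab
        by (auto simp: a_def[symmetric] b_def[symmetric] \<rho>_def split: if_splits)
      moreover have "y a = y b \<Longrightarrow> a = b" using inj_onD[OF inj _ ab] by blast
      ultimately have "\<not> y b \<le> y a"
        using rk_less[OF ab(2,1)] ij(3) by (metis less_asym' less_irrefl less_eq_real_def)
      then show "(y \<circ> inv_into UNIV \<rho>) i < (y \<circ> inv_into UNIV \<rho>) j" by (simp add: a_def b_def)
    qed
    fix \<sigma> assume \<sigma>: "\<sigma> permutes {1..N}" and mono: "strict_mono_on {1..N} (y \<circ> inv_into UNIV \<sigma>)"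
    show "\<sigma> = \<rho>"
    proof
      fix i
      show "\<sigma> i = \<rho> i"
      proof (cases "i \<in> {1..N}")
        case False
        then show ?thesis using \<sigma> by (auto simp: \<rho>_def permutes_not_in)
      next
        case True
        have si: "\<sigma> i \<in> {1..N}" using True permutes_in_image[OF \<sigma>] by simp
        have le: "y k \<le> y i \<longleftrightarrow> \<sigma> k \<le> \<sigma> i" if "k \<in> {1..N}" for k
        proof -
          have sk: "\<sigma> k \<in> {1..N}" using that permutes_in_image[OF \<sigma>] by simp
          show ?thesis
            using strict_mono_on_leD[OF mono sk si] strict_mono_onD[OF mono si sk] permutes_inverses(2)[OF \<sigma>]
            by (auto simp: not_le[symmetric])
        qed
        have "{k\<in>{1..N}. y k \<le> y i} = {k\<in>{1..N}. \<sigma> k \<le> \<sigma> i}" using le by auto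
        moreover have "card {k\<in>{1..N}. \<sigma> k \<le> \<sigma> i} = card (\<sigma> ` {k\<in>{1..N}. \<sigma> k \<le> \<sigma> i})"
          using permutes_inj_on[OF \<sigma>] by (subst card_image) auto
        moreover have "\<sigma> ` {k\<in>{1..N}. \<sigma> k \<le> \<sigma> i} = {1..\<sigma> i}"
        proof (intro equalityI subsetI)
          fix j assume "j \<in> {1..\<sigma> i}"
          then have "j \<in> \<sigma> ` {1..N}" using si permutes_image[OF \<sigma>] by auto
          then show "j \<in> \<sigma> ` {k\<in>{1..N}. \<sigma> k \<le> \<sigma> i}" using \<open>j \<in> {1..\<sigma> i}\<close> by auto
        qed (use permutes_in_image[OF \<sigma>] in auto)
        ultimately have "card {k\<in>{1..N}. y k \<le> y i} = \<sigma> i" by simp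
        then show ?thesis using True by (simp add: \<rho>_def rk_def)
      qed
    qed
  qed
qed

text \<open>Both measures agree on boxes. Used for permuting coordinates and for identifying the
  coordinates of one time, indexed by pairs, with \<open>{1..N}\<close>.\<close>

lemma distr_PiM_lborel_reindex:
  assumes e: "bij_betw e J I" and fin: "finite J"
  shows "distr (Pi\<^sub>M I (\<lambda>_. lborel)) (Pi\<^sub>M J (\<lambda>_. lborel)) (\<lambda>x. \<lambda>j\<in>J. x (e j)) = Pi\<^sub>M J (\<lambda>_. lborel :: real measure)"
proof -
  interpret I: product_sigma_finite "\<lambda>_::'b. lborel :: real measure" ..
  interpret J: product_sigma_finite "\<lambda>_::'a. lborel :: real measure" ..
  have inj: "inj_on e J" and im: "e ` J = I" using e by (auto simp: bij_betw_def)
  have finI: "finite I" using im fin by auto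
  have meas: "(\<lambda>x. \<lambda>j\<in>J. x (e j)) \<in> Pi\<^sub>M I (\<lambda>_. lborel) \<rightarrow>\<^sub>M Pi\<^sub>M J (\<lambda>_. lborel :: real measure)"
    by (rule measurable_restrict) (use im in auto)
  show ?thesis
  proof (rule J.PiM_eqI[OF fin])
    fix A :: "'a \<Rightarrow> real set" assume A: "\<And>j. j \<in> J \<Longrightarrow> A j \<in> sets lborel"
    have "(\<lambda>x. \<lambda>j\<in>J. x (e j)) -` Pi\<^sub>E J A \<inter> space (Pi\<^sub>M I (\<lambda>_. lborel)) = Pi\<^sub>E I (\<lambda>i. A (inv_into J e i))"
      using inj im by (auto simp: space_PiM PiE_iff inv_into_f_f)
    then have "emeasure (distr (Pi\<^sub>M I (\<lambda>_. lborel)) (Pi\<^sub>M J (\<lambda>_. lborel)) (\<lambda>x. \<lambda>j\<in>J. x (e j))) (Pi\<^sub>E J A)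
       = emeasure (Pi\<^sub>M I (\<lambda>_. lborel)) (Pi\<^sub>E I (\<lambda>i. A (inv_into J e i)))"
      using A fin by (subst emeasure_distr[OF meas]) (auto intro!: sets_PiM_I_finite)
    also have "\<dots> = (\<Prod>i\<in>I. emeasure lborel (A (inv_into J e i)))"
      by (rule I.emeasure_PiM[OF finI]) (use A im in \<open>auto simp: inv_into_into\<close>)
    also have "\<dots> = (\<Prod>j\<in>J. emeasure lborel (A (inv_into J e (e j))))"
      by (rule prod.reindex_bij_betw[OF e, symmetric])
    also have "\<dots> = (\<Prod>j\<in>J. emeasure lborel (A j))" using inj by (intro prod.cong) auto
    finally show "emeasure (distr (Pi\<^sub>M I (\<lambda>_. lborel)) (Pi\<^sub>M J (\<lambda>_. lborel)) (\<lambda>x. \<lambda>j\<in>J. x (e j))) (Pi\<^sub>E J A)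
       = (\<Prod>j\<in>J. emeasure lborel (A j))" .
  qed simp
qed

lemma
  fixes f :: "('a \<Rightarrow> real) \<Rightarrow> real"
  assumes e: "bij_betw e J I" and fin: "finite J"
  shows integrable_PiM_lborel_reindex:
      "integrable (Pi\<^sub>M J (\<lambda>_. lborel)) f \<Longrightarrow> integrable (Pi\<^sub>M I (\<lambda>_. lborel)) (\<lambda>x. f (\<lambda>j\<in>J. x (e j)))"
    and integral_PiM_lborel_reindex:
      "f \<in> borel_measurable (Pi\<^sub>M J (\<lambda>_. lborel)) \<Longrightarrow>
       (LINT x|Pi\<^sub>M I (\<lambda>_. lborel). f (\<lambda>j\<in>J. x (e j))) = (LINT x|Pi\<^sub>M J (\<lambda>_. lborel). f x)"
proof -
  have meas: "(\<lambda>x. \<lambda>j\<in>J. x (e j)) \<in> Pi\<^sub>M I (\<lambda>_. lborel) \<rightarrow>\<^sub>M Pi\<^sub>M J (\<lambda>_. lborel :: real measure)"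
    by (rule measurable_restrict) (use e in \<open>auto simp: bij_betw_def\<close>)
  note d = distr_PiM_lborel_reindex[OF e fin]
  show "integrable (Pi\<^sub>M J (\<lambda>_. lborel)) f \<Longrightarrow> integrable (Pi\<^sub>M I (\<lambda>_. lborel)) (\<lambda>x. f (\<lambda>j\<in>J. x (e j)))"
    by (rule integrable_distr[OF meas]) (simp add: d)
  show "f \<in> borel_measurable (Pi\<^sub>M J (\<lambda>_. lborel)) \<Longrightarrow>
       (LINT x|Pi\<^sub>M I (\<lambda>_. lborel). f (\<lambda>j\<in>J. x (e j))) = (LINT x|Pi\<^sub>M J (\<lambda>_. lborel). f x)"
    using integral_distr[OF meas, of f] by (simp add: d)
qed

lemma borel_measurable_sdet [measurable (raw)]:
  fixes A :: "'x \<Rightarrow> 'i \<Rightarrow> 'i \<Rightarrow> real"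
  assumes "\<And>i j. i \<in> S \<Longrightarrow> j \<in> S \<Longrightarrow> (\<lambda>x. A x i j) \<in> borel_measurable M"
  shows "(\<lambda>x. sdet S (A x)) \<in> borel_measurable M"
  unfolding sdet_def
  by (intro borel_measurable_sum borel_measurable_times borel_measurable_prod borel_measurable_const assms)
     (auto simp: permutes_in_image)

lemma measurable_strict_mono_on [measurable]:
  "Measurable.pred (Pi\<^sub>M {1..N::nat} (\<lambda>_. lborel :: real measure)) (strict_mono_on {1..N})"
  unfolding strict_mono_on_def[abs_def]
proof -
  have "Measurable.pred (Pi\<^sub>M {1..N} (\<lambda>_. lborel :: real measure)) (\<lambda>x. \<forall>r\<in>{1..N}. \<forall>s\<in>{1..N}. r < s \<longrightarrow> x r < x s)"
    by (intro pred_intros_finite) measurable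
  moreover have "(\<lambda>x::nat \<Rightarrow> real. \<forall>r\<in>{1..N}. \<forall>s\<in>{1..N}. r < s \<longrightarrow> x r < x s) = (\<lambda>f. \<forall>r s. r \<in> {1..N} \<and> s \<in> {1..N} \<and> r < s \<longrightarrow> f r < f s)"
    by (auto simp: fun_eq_iff)
  ultimately show "Measurable.pred (Pi\<^sub>M {1..N} (\<lambda>_. lborel :: real measure)) (\<lambda>f. \<forall>r s. r \<in> {1..N} \<and> s \<in> {1..N} \<and> r < s \<longrightarrow> f r < f s)"
    by simp
qed

text \<open>Andreief's identity. The integral over the chamber equals the integral over the whole space of
  the diagonal term of one of the determinants, because the images of the chamber under permutations
  of the coordinates cover every point at which the other determinant does not vanish exactly once.\<close>

lemma
  fixes \<phi> \<psi> :: "nat \<Rightarrow> real \<Rightarrow> real" and N :: nat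
  defines "S \<equiv> {1..N}"
  assumes meas [measurable]: "\<And>a. a \<in> S \<Longrightarrow> \<phi> a \<in> borel_measurable borel" "\<And>a. a \<in> S \<Longrightarrow> \<psi> a \<in> borel_measurable borel"
    and int: "\<And>a b. a \<in> S \<Longrightarrow> b \<in> S \<Longrightarrow> integrable lborel (\<lambda>x. \<phi> a x * \<psi> b x)"
  shows integrable_Andreief:
      "integrable (Pi\<^sub>M S (\<lambda>_. lborel))
        (\<lambda>x. of_bool (strict_mono_on S x) * (sdet S (\<lambda>a i. \<phi> a (x i)) * sdet S (\<lambda>b i. \<psi> b (x i))))" (is ?int)
    and integral_Andreief:
      "(LINT x|Pi\<^sub>M S (\<lambda>_. lborel).
          of_bool (strict_mono_on S x) * (sdet S (\<lambda>a i. \<phi> a (x i)) * sdet S (\<lambda>b i. \<psi> b (x i)))) =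
       sdet S (\<lambda>a b. LINT x|lborel. \<phi> a x * \<psi> b x)" (is ?eq)
proof -
  interpret product_sigma_finite "\<lambda>_::nat. lborel :: real measure" ..
  have fin: "finite S" by (simp add: S_def)
  let ?P = "Pi\<^sub>M S (\<lambda>_. lborel :: real measure)"
  define W where "W x = (of_bool (strict_mono_on S x) :: real)" for x :: "nat \<Rightarrow> real"
  define D where "D x = sdet S (\<lambda>b i. \<psi> b (x i))" for x
  have D_alt: "D x = (\<Sum>\<tau> | \<tau> permutes S. of_int (sign \<tau>) * (\<Prod>i\<in>S. \<psi> (\<tau> i) (x i)))" for x
    unfolding D_def by (subst sdet_transpose[OF fin, symmetric]) (simp add: sdet_def)
  have Wm [measurable]: "W \<in> borel_measurable ?P"
    unfolding W_def S_def by measurable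
  have Dm: "D \<in> borel_measurable ?P"
    unfolding D_def
  proof (rule borel_measurable_sdet)
    fix i j assume "i \<in> S" "j \<in> S"
    then show "(\<lambda>x. \<psi> i (x j)) \<in> borel_measurable ?P" by measurable
  qed
  have int_prod: "integrable ?P (\<lambda>x. \<Prod>i\<in>S. \<phi> (\<sigma> i) (x i) * \<psi> (\<tau> i) (x i))"
    if "\<sigma> permutes S" "\<tau> permutes S" for \<sigma> \<tau>
    using that by (intro product_integrable_prod fin int) (auto simp: permutes_in_image)
  have int_D: "integrable ?P (\<lambda>x. (\<Prod>i\<in>S. \<phi> (\<sigma> i) (x i)) * D x)" if \<sigma>: "\<sigma> permutes S" for \<sigma>
  proof -
    have "integrable ?P (\<lambda>x. \<Sum>\<tau> | \<tau> permutes S. of_int (sign \<tau>) * (\<Prod>i\<in>S. \<phi> (\<sigma> i) (x i) * \<psi> (\<tau> i) (x i)))"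
      by (intro Bochner_Integration.integrable_sum integrable_mult_right int_prod \<sigma>) auto
    then show ?thesis
      by (simp add: D_alt sum_distrib_left prod.distrib mult_ac)
  qed
  \<comment> \<open>The diagonal term of the first determinant times the second one, restricted to
    the image of the chamber under a permutation of the coordinates.\<close>
  define G where "G \<sigma> y = of_bool (strict_mono_on S (y \<circ> inv_into UNIV \<sigma>)) * ((\<Prod>i\<in>S. \<phi> i (y i)) * D y)" for \<sigma> y
  have int_G: "integrable ?P (G \<sigma>)" if \<sigma>: "\<sigma> permutes S" for \<sigma>
  proof (rule Bochner_Integration.integrable_bound)
    show "integrable ?P (\<lambda>x. (\<Prod>i\<in>S. \<phi> i (x i)) * D x)" using int_D[OF permutes_id] by simp
    have "(\<lambda>y. of_bool (strict_mono_on S (\<lambda>i\<in>S. y (inv_into UNIV \<sigma> i))) :: real) \<in> borel_measurable ?P"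
    proof (rule measurable_compose[OF measurable_restrict, of _ _ _ _ W, unfolded W_def])
      fix i assume "i \<in> S"
      then have "inv_into UNIV \<sigma> i \<in> S" using permutes_in_image[OF permutes_inv[OF \<sigma>]] by simp
      then show "(\<lambda>x. x (inv_into UNIV \<sigma> i)) \<in> ?P \<rightarrow>\<^sub>M lborel" by measurable
    qed (use Wm in \<open>simp add: W_def[abs_def]\<close>)
    moreover have "strict_mono_on S (\<lambda>i\<in>S. y (inv_into UNIV \<sigma> i)) = strict_mono_on S (y \<circ> inv_into UNIV \<sigma>)" for y :: "nat \<Rightarrow> real"
      by (auto simp: strict_mono_on_def)
    ultimately have "(\<lambda>y. of_bool (strict_mono_on S (y \<circ> inv_into UNIV \<sigma>)) :: real) \<in> borel_measurable ?P" by simp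
    moreover have "(\<lambda>x. (\<Prod>i\<in>S. \<phi> i (x i)) * D x) \<in> borel_measurable ?P"
      using borel_measurable_integrable[OF int_D[OF permutes_id]] by simp
    ultimately show "G \<sigma> \<in> borel_measurable ?P"
      unfolding G_def by (rule borel_measurable_times)
  qed (auto simp: G_def abs_mult)
  \<comment> \<open>\<open>D\<close> is antisymmetric, and this supplies exactly the sign which the
    permutation has in the expansion of the first determinant.\<close>
  have G_comp: "G \<sigma> (\<lambda>a\<in>S. x (\<sigma> a)) = W x * (of_int (sign \<sigma>) * (\<Prod>a\<in>S. \<phi> a (x (\<sigma> a))) * D x)" if \<sigma>: "\<sigma> permutes S" for \<sigma> x
  proof -
    have "strict_mono_on S ((\<lambda>a\<in>S. x (\<sigma> a)) \<circ> inv_into UNIV \<sigma>) = strict_mono_on S x"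
      using permutes_in_image[OF permutes_inv[OF \<sigma>]] permutes_inverses(1)[OF \<sigma>] by (auto simp: strict_mono_on_def)
    moreover have "D (\<lambda>a\<in>S. x (\<sigma> a)) = of_int (sign \<sigma>) * D x"
      unfolding D_def sdet_permute_columns[OF \<sigma> fin, symmetric] by (rule sdet_cong) auto
    ultimately show ?thesis by (simp add: G_def W_def mult_ac)
  qed
  have \<sigma>_bij: "bij_betw \<sigma> S S" if "\<sigma> permutes S" for \<sigma> using that by (rule permutes_imp_bij)
  have expand: "of_bool (strict_mono_on S x) * (sdet S (\<lambda>a i. \<phi> a (x i)) * sdet S (\<lambda>b i. \<psi> b (x i)))
    = (\<Sum>\<sigma> | \<sigma> permutes S. G \<sigma> (\<lambda>a\<in>S. x (\<sigma> a)))" for x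
  proof -
    have "(\<Sum>\<sigma> | \<sigma> permutes S. G \<sigma> (\<lambda>a\<in>S. x (\<sigma> a))) = (\<Sum>\<sigma> | \<sigma> permutes S. W x * (of_int (sign \<sigma>) * (\<Prod>a\<in>S. \<phi> a (x (\<sigma> a))) * D x))"
      using G_comp by (intro sum.cong) auto
    also have "\<dots> = W x * (sdet S (\<lambda>a i. \<phi> a (x i)) * D x)"
      by (simp add: sdet_def sum_distrib_left sum_distrib_right)
    finally show ?thesis by (simp add: W_def D_def)
  qed
  show ?int
    unfolding expand
    by (intro Bochner_Integration.integrable_sum integrable_PiM_lborel_reindex \<sigma>_bij fin int_G) auto
  \<comment> \<open>Off the diagonals exactly one permuted chamber contains \<open>y\<close>; at a
    point with a repeated coordinate none does, but there \<open>D\<close> vanishes.\<close>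
  have sumG: "(\<Sum>\<sigma> | \<sigma> permutes S. G \<sigma> y) = (\<Prod>i\<in>S. \<phi> i (y i)) * D y" for y
  proof (cases "inj_on y S")
    case True
    obtain \<rho> where \<rho>: "\<rho> permutes S" "strict_mono_on S (y \<circ> inv_into UNIV \<rho>)"
      and uniq: "\<And>\<sigma>. \<sigma> permutes S \<Longrightarrow> strict_mono_on S (y \<circ> inv_into UNIV \<sigma>) \<Longrightarrow> \<sigma> = \<rho>"
      using ex1_sorting_permutation[OF True[unfolded S_def]] unfolding S_def by metis
    have "(\<Sum>\<sigma> | \<sigma> permutes S. G \<sigma> y) = (\<Sum>\<sigma> | \<sigma> permutes S. if \<sigma> = \<rho> then (\<Prod>i\<in>S. \<phi> i (y i)) * D y else 0)"
    proof (intro sum.cong refl)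
      fix \<sigma> assume "\<sigma> \<in> {\<sigma>. \<sigma> permutes S}"
      then have "strict_mono_on S (y \<circ> inv_into UNIV \<sigma>) \<longleftrightarrow> \<sigma> = \<rho>"
        using \<rho>(2) uniq[of \<sigma>] by blast
      then show "G \<sigma> y = (if \<sigma> = \<rho> then (\<Prod>i\<in>S. \<phi> i (y i)) * D y else 0)" by (simp add: G_def)
    qed
    then show ?thesis using \<rho> fin by (simp add: finite_permutations)
  next
    case False
    then obtain i j where "i \<in> S" "j \<in> S" "i \<noteq> j" "y i = y j" by (auto simp: inj_on_def)
    then have "D y = 0" unfolding D_def by (intro sdet_equal_columns[OF fin, of i j]) auto
    then show ?thesis by (simp add: G_def)
  qed
  have "(LINT x|?P. of_bool (strict_mono_on S x) * (sdet S (\<lambda>a i. \<phi> a (x i)) * sdet S (\<lambda>b i. \<psi> b (x i))))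
     = (\<Sum>\<sigma> | \<sigma> permutes S. LINT x|?P. G \<sigma> (\<lambda>a\<in>S. x (\<sigma> a)))"
    unfolding expand
    by (intro Bochner_Integration.integral_sum integrable_PiM_lborel_reindex \<sigma>_bij fin int_G) auto
  also have "\<dots> = (\<Sum>\<sigma> | \<sigma> permutes S. LINT y|?P. G \<sigma> y)"
    by (intro sum.cong refl integral_PiM_lborel_reindex \<sigma>_bij fin borel_measurable_integrable int_G) auto
  also have "\<dots> = (LINT y|?P. (\<Sum>\<sigma> | \<sigma> permutes S. G \<sigma> y))"
    by (intro Bochner_Integration.integral_sum[symmetric] int_G) auto
  also have "\<dots> = (LINT y|?P. (\<Sum>\<tau> | \<tau> permutes S. of_int (sign \<tau>) * (\<Prod>i\<in>S. \<phi> i (y i) * \<psi> (\<tau> i) (y i))))"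
    unfolding sumG by (simp add: D_alt sum_distrib_left prod.distrib mult_ac)
  also have "\<dots> = (\<Sum>\<tau> | \<tau> permutes S. of_int (sign \<tau>) * (LINT y|?P. (\<Prod>i\<in>S. \<phi> i (y i) * \<psi> (\<tau> i) (y i))))"
    using int_prod[OF permutes_id] by (subst Bochner_Integration.integral_sum) (auto intro!: integrable_mult_right)
  also have "\<dots> = sdet S (\<lambda>a b. LINT x|lborel. \<phi> a x * \<psi> b x)"
    unfolding sdet_def
    by (intro sum.cong refl arg_cong2[where f = "(*)"] product_integral_prod fin int) (auto simp: permutes_in_image)
  finally show ?eq .
qed

section \<open>Integrating out a chain of transition determinants\<close>

primrec evolve :: "(nat \<Rightarrow> real \<Rightarrow> real \<Rightarrow> real) \<Rightarrow> (nat \<Rightarrow> real \<Rightarrow> real) \<Rightarrow> nat \<Rightarrow> nat \<Rightarrow> real \<Rightarrow> real" where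
  "evolve \<kappa> \<phi> 0 = \<phi>"
| "evolve \<kappa> \<phi> (Suc j) = (\<lambda>a y. LINT x|lborel. evolve \<kappa> \<phi> j a x * \<kappa> (Suc j) x y)"

text \<open>The kernels are sub-Markov, so a step does not increase the integral of the absolute
  value and Fubini's theorem applies. The starting functions may change sign.\<close>

lemma evolve_integrable:
  assumes \<phi>: "integrable lborel (\<phi> a)"
    and \<kappa>m [measurable]: "\<And>j. case_prod (\<kappa> j) \<in> borel_measurable (lborel \<Otimes>\<^sub>M lborel)"
    and \<kappa>0: "\<And>j x y. 0 \<le> \<kappa> j x y"
    and \<kappa>i: "\<And>j x. integrable lborel (\<kappa> j x)" "\<And>j x. (LINT y|lborel. \<kappa> j x y) \<le> 1"
  shows "integrable lborel (evolve \<kappa> \<phi> j a)"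
proof (induction j)
  case (Suc j)
  let ?f = "evolve \<kappa> \<phi> j a"
  have [measurable]: "?f \<in> borel_measurable lborel" using Suc by auto
  have "integrable (lborel \<Otimes>\<^sub>M lborel) (\<lambda>(x, y). ?f x * \<kappa> (Suc j) x y)"
  proof (rule lborel_pair.Fubini_integrable)
    show "(\<lambda>(x, y). ?f x * \<kappa> (Suc j) x y) \<in> borel_measurable (lborel \<Otimes>\<^sub>M lborel)" by measurable
    have eq: "(LINT y|lborel. norm (case (x, y) of (x, y) \<Rightarrow> ?f x * \<kappa> (Suc j) x y)) = \<bar>?f x\<bar> * (LINT y|lborel. \<kappa> (Suc j) x y)" for x
      using \<kappa>0 by (simp add: abs_mult)
    show "integrable lborel (\<lambda>x. LINT y|lborel. norm (case (x, y) of (x, y) \<Rightarrow> ?f x * \<kappa> (Suc j) x y))"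
      unfolding eq
    proof (rule Bochner_Integration.integrable_bound[OF integrable_abs[OF Suc]])
      show "(\<lambda>x. \<bar>?f x\<bar> * (LINT y|lborel. \<kappa> (Suc j) x y)) \<in> borel_measurable lborel" by measurable
      have "\<bar>?f x * (LINT y|lborel. \<kappa> (Suc j) x y)\<bar> \<le> \<bar>?f x\<bar>" for x
        using \<kappa>i(2)[of "Suc j" x] Bochner_Integration.integral_nonneg[of lborel "\<kappa> (Suc j) x"] \<kappa>0
        by (simp add: abs_mult mult_left_le)
      then show "AE x in lborel. norm (\<bar>?f x\<bar> * (LINT y|lborel. \<kappa> (Suc j) x y)) \<le> norm \<bar>?f x\<bar>" by (simp add: abs_mult)
    qed
    show "AE x in lborel. integrable lborel (\<lambda>y. case (x, y) of (x, y) \<Rightarrow> ?f x * \<kappa> (Suc j) x y)"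
      using \<kappa>i(1) by auto
  qed
  from lborel_pair.integrable_snd[OF this] show ?case by simp
qed (simp add: \<phi>)

lemma ball_atLeastAtMost_Suc:
  "(\<forall>j\<in>{1..Suc k}. P j) \<longleftrightarrow> P (Suc k) \<and> (\<forall>j\<in>{1..k}. P j)"
proof -
  have "{1..Suc k} = insert (Suc k) {1..k}" by auto
  then show ?thesis by simp
qed

text \<open>The terminal determinant is kept outside, because in the induction its place is taken by
  the last transition.\<close>

definition chain_weight :: "nat \<Rightarrow> nat \<Rightarrow> (nat \<Rightarrow> real \<Rightarrow> real) \<Rightarrow> (nat \<Rightarrow> real \<Rightarrow> real \<Rightarrow> real) \<Rightarrow> (nat \<times> nat \<Rightarrow> real) \<Rightarrow> real" where
  "chain_weight N k \<phi> \<kappa> x =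
     of_bool (\<forall>j\<in>{1..k}. strict_mono_on {1..N} (\<lambda>i. x (j, i))) *
     sdet {1..N} (\<lambda>a i. \<phi> a (x (1, i))) *
     (\<Prod>j\<in>{1..<k}. sdet {1..N} (\<lambda>a b. \<kappa> j (x (j, a)) (x (Suc j, b))))"

text \<open>The last time is integrated out first, so that the determinant of the transition to it
  plays the role of the final weight \<open>\<psi>\<close> in the induction hypothesis.\<close>

lemma integral_chain_weight:
  fixes \<phi> \<psi> :: "nat \<Rightarrow> real \<Rightarrow> real" and N :: nat
  defines "S \<equiv> {1..N}"
  assumes \<phi>: "\<And>a. a \<in> S \<Longrightarrow> integrable lborel (\<phi> a)"
    and \<kappa>m [measurable]: "\<And>j. case_prod (\<kappa> j) \<in> borel_measurable (lborel \<Otimes>\<^sub>M lborel)"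
    and \<kappa>0: "\<And>j x y. 0 \<le> \<kappa> j x y"
    and \<kappa>C: "\<And>j x y. \<kappa> j x y \<le> C j"
    and \<kappa>i: "\<And>j x. integrable lborel (\<kappa> j x)" "\<And>j x. (LINT y|lborel. \<kappa> j x y) \<le> 1"
  shows "\<lbrakk>\<And>b. b \<in> S \<Longrightarrow> \<psi> b \<in> borel_measurable borel; \<And>b x. b \<in> S \<Longrightarrow> \<bar>\<psi> b x\<bar> \<le> C';
     integrable (Pi\<^sub>M ({1..Suc k} \<times> S) (\<lambda>_. lborel)) (\<lambda>x. chain_weight N (Suc k) \<phi> \<kappa> x * sdet S (\<lambda>b i. \<psi> b (x (Suc k, i))))\<rbrakk>
    \<Longrightarrow> (LINT x|Pi\<^sub>M ({1..Suc k} \<times> S) (\<lambda>_. lborel). chain_weight N (Suc k) \<phi> \<kappa> x * sdet S (\<lambda>b i. \<psi> b (x (Suc k, i))))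
      = sdet S (\<lambda>a b. LINT x|lborel. evolve \<kappa> \<phi> k a x * \<psi> b x)"
proof (induction k arbitrary: \<psi> C')
  case (0 \<psi>)
  have fin: "finite S" by (simp add: S_def)
  have e: "bij_betw (\<lambda>i. (1, i)) S ({1..Suc 0} \<times> S)"
    by (auto simp: bij_betw_def inj_on_def)
  let ?f = "\<lambda>x. of_bool (strict_mono_on S x) * (sdet S (\<lambda>a i. \<phi> a (x i)) * sdet S (\<lambda>b i. \<psi> b (x i)))"
  have int: "integrable lborel (\<lambda>x. \<phi> a x * \<psi> b x)" if "a \<in> S" "b \<in> S" for a b
  proof (rule Bochner_Integration.integrable_bound)
    show "integrable lborel (\<lambda>x. C' * \<phi> a x)" using \<phi>[OF that(1)] by simp
    show "(\<lambda>x. \<phi> a x * \<psi> b x) \<in> borel_measurable lborel"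
      using \<phi>[OF that(1)] 0(1)[OF that(2)] by auto
    have "\<bar>\<phi> a x * \<psi> b x\<bar> \<le> \<bar>C' * \<phi> a x\<bar>" for x
      using mult_right_mono[of "\<bar>\<psi> b x\<bar>" "\<bar>C'\<bar>" "\<bar>\<phi> a x\<bar>"] 0(2)[OF that(2), of x] by (simp add: abs_mult mult.commute)
    then show "AE x in lborel. norm (\<phi> a x * \<psi> b x) \<le> norm (C' * \<phi> a x)" by simp
  qed
  have \<phi>m: "\<phi> a \<in> borel_measurable borel" if "a \<in> S" for a using \<phi>[OF that] by auto
  have "chain_weight N (Suc 0) \<phi> \<kappa> x * sdet S (\<lambda>b i. \<psi> b (x (Suc 0, i))) = ?f (\<lambda>i\<in>S. x (1, i))" for x
  proof -
    have "strict_mono_on S (\<lambda>i\<in>S. x (1, i)) = strict_mono_on S (\<lambda>i. x (1, i))"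
      by (auto simp: strict_mono_on_def)
    moreover have "sdet S (\<lambda>a i. \<phi> a ((\<lambda>i\<in>S. x (1, i)) i)) = sdet S (\<lambda>a i. \<phi> a (x (1, i)))"
      "sdet S (\<lambda>a i. \<psi> a ((\<lambda>i\<in>S. x (1, i)) i)) = sdet S (\<lambda>a i. \<psi> a (x (1, i)))"
      by (auto intro!: sdet_cong)
    ultimately show ?thesis by (simp add: chain_weight_def S_def)
  qed
  then show ?case
    using integral_PiM_lborel_reindex[OF e fin, of ?f]
      borel_measurable_integrable[OF integrable_Andreief[where N = N and \<phi> = \<phi> and \<psi> = \<psi>]] integral_Andreief[where N = N and \<phi> = \<phi> and \<psi> = \<psi>]
      \<phi>m 0(1) int unfolding S_def by simp
next
  case (Suc k \<psi>)
  have fin: "finite S" by (simp add: S_def)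
  interpret product_sigma_finite "\<lambda>_::nat \<times> nat. lborel :: real measure" ..
  define I where "I = {Suc (Suc k)} \<times> S"
  define J where "J = {1..Suc k} \<times> S"
  have IJ: "I \<inter> J = {}" "finite I" "finite J" "{1..Suc (Suc k)} \<times> S = I \<union> J"
    using fin by (auto simp: I_def J_def)
  interpret I: finite_product_sigma_finite "\<lambda>_::nat \<times> nat. lborel :: real measure" I by standard fact
  interpret J: finite_product_sigma_finite "\<lambda>_::nat \<times> nat. lborel :: real measure" J by standard fact
  interpret P: pair_sigma_finite "Pi\<^sub>M I (\<lambda>_. lborel :: real measure)" "Pi\<^sub>M J (\<lambda>_. lborel :: real measure)" ..
  let ?F = "\<lambda>x. chain_weight N (Suc (Suc k)) \<phi> \<kappa> x * sdet S (\<lambda>b i. \<psi> b (x (Suc (Suc k), i)))"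
  let ?y = "\<lambda>y b. y (Suc (Suc k), b)"
  \<comment> \<open>\<open>w\<close> collects what depends on the last time only; \<open>H\<close>
    is the shorter chain with the last transition, at frozen end positions \<open>y\<close>, as its
    terminal determinant.\<close>
  define w where "w y = of_bool (strict_mono_on S (?y y)) * sdet S (\<lambda>b i. \<psi> b (?y y i))" for y :: "nat \<times> nat \<Rightarrow> real"
  define H where "H y x = chain_weight N (Suc k) \<phi> \<kappa> x * sdet S (\<lambda>b i. \<kappa> (Suc k) (x (Suc k, i)) (?y y b))" for y x
  have F: "integrable (Pi\<^sub>M (I \<union> J) (\<lambda>_. lborel)) ?F" using Suc.prems(3) IJ(4) by simp
  have F_merge: "?F (merge I J (y, x)) = w y * H y x" for y x
  proof -
    let ?m = "merge I J (y, x)"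
    have m1: "?m (Suc (Suc k), b) = ?y y b" if "b \<in> S" for b using that by (simp add: merge_def I_def)
    have m2: "?m (j, b) = x (j, b)" if "b \<in> S" "j \<in> {1..Suc k}" for b j using that by (auto simp: merge_def I_def J_def)
    have sm2: "strict_mono_on S (\<lambda>i. ?m (j, i)) = strict_mono_on S (\<lambda>i. x (j, i))" if "j \<in> {1..Suc k}" for j
      using m2 that by (auto simp: strict_mono_on_def)
    have sm1: "strict_mono_on S (\<lambda>i. ?m (Suc (Suc k), i)) = strict_mono_on S (?y y)"
      using m1 by (auto simp: strict_mono_on_def)
    have "(\<forall>j\<in>{1..Suc (Suc k)}. strict_mono_on S (\<lambda>i. ?m (j, i))) \<longleftrightarrow>
       strict_mono_on S (\<lambda>i. ?m (Suc (Suc k), i)) \<and> (\<forall>j\<in>{1..Suc k}. strict_mono_on S (\<lambda>i. ?m (j, i)))"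
      by (rule ball_atLeastAtMost_Suc)
    also have "\<dots> \<longleftrightarrow> strict_mono_on S (?y y) \<and> (\<forall>j\<in>{1..Suc k}. strict_mono_on S (\<lambda>i. x (j, i)))"
      using sm1 sm2 by auto
    finally have a: "(\<forall>j\<in>{1..Suc (Suc k)}. strict_mono_on S (\<lambda>i. ?m (j, i))) \<longleftrightarrow>
       strict_mono_on S (?y y) \<and> (\<forall>j\<in>{1..Suc k}. strict_mono_on S (\<lambda>i. x (j, i)))" .
    have b: "sdet S (\<lambda>a i. \<phi> a (?m (1, i))) = sdet S (\<lambda>a i. \<phi> a (x (1, i)))"
      using m2 by (intro sdet_cong) auto
    have c: "(\<Prod>j\<in>{1..<Suc (Suc k)}. sdet S (\<lambda>a b. \<kappa> j (?m (j, a)) (?m (Suc j, b))))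
      = (\<Prod>j\<in>{1..<Suc k}. sdet S (\<lambda>a b. \<kappa> j (x (j, a)) (x (Suc j, b)))) * sdet S (\<lambda>a b. \<kappa> (Suc k) (x (Suc k, a)) (?y y b))"
    proof -
      have "{1..<Suc (Suc k)} = insert (Suc k) {1..<Suc k}" by auto
      moreover have "(\<Prod>j\<in>{1..<Suc k}. sdet S (\<lambda>a b. \<kappa> j (?m (j, a)) (?m (Suc j, b)))) = (\<Prod>j\<in>{1..<Suc k}. sdet S (\<lambda>a b. \<kappa> j (x (j, a)) (x (Suc j, b))))"
        using m2 by (intro prod.cong refl sdet_cong) auto
      moreover have "sdet S (\<lambda>a b. \<kappa> (Suc k) (?m (Suc k, a)) (?m (Suc (Suc k), b))) = sdet S (\<lambda>a b. \<kappa> (Suc k) (x (Suc k, a)) (?y y b))"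
        using m1 m2 by (intro sdet_cong) auto
      ultimately show ?thesis by (simp add: mult.commute)
    qed
    have d: "sdet S (\<lambda>b i. \<psi> b (?m (Suc (Suc k), i))) = sdet S (\<lambda>b i. \<psi> b (?y y i))"
      using m1 by (intro sdet_cong) auto
    have t: "sdet S (\<lambda>a b. \<kappa> (Suc k) (x (Suc k, a)) (?y y b)) = sdet S (\<lambda>b i. \<kappa> (Suc k) (x (Suc k, i)) (?y y b))"
      by (rule sdet_transpose[OF fin])
    show ?thesis
      unfolding chain_weight_def w_def H_def S_def[symmetric] a b c d t by auto
  qed
  have f_int: "integrable (Pi\<^sub>M I (\<lambda>_. lborel) \<Otimes>\<^sub>M Pi\<^sub>M J (\<lambda>_. lborel)) (\<lambda>x. ?F (merge I J x))"
    by (rule integrable_distr[OF measurable_merge]) (simp only: distr_merge[OF IJ(1-3)] F)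
  have \<phi>i: "integrable lborel (evolve \<kappa> \<phi> j a)" if "a \<in> S" for j a
    by (rule evolve_integrable[where \<kappa> = \<kappa> and \<phi> = \<phi>, OF \<phi>[OF that] \<kappa>m \<kappa>0 \<kappa>i])
  have inner: "(LINT x|Pi\<^sub>M J (\<lambda>_. lborel). w y * H y x) = w y * sdet S (\<lambda>a b. evolve \<kappa> \<phi> (Suc k) a (?y y b))"
    if int: "integrable (Pi\<^sub>M J (\<lambda>_. lborel)) (\<lambda>x. w y * H y x)" for y
  \<comment> \<open>If \<open>w y\<close> is nonzero it can be cancelled from the integrable
    product, which yields the integrability that the induction hypothesis demands; otherwise both
    sides are 0.\<close>
  proof (cases "w y = 0")
    case False
    then have "integrable (Pi\<^sub>M J (\<lambda>_. lborel)) (H y)"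
      using int by simp
    then have "(LINT x|Pi\<^sub>M J (\<lambda>_. lborel). H y x) = sdet S (\<lambda>a b. LINT x|lborel. evolve \<kappa> \<phi> k a x * \<kappa> (Suc k) x (?y y b))"
      unfolding H_def J_def
    proof (intro Suc.IH[of "\<lambda>b x. \<kappa> (Suc k) x (?y y b)" "C (Suc k)"])
      show "\<bar>\<kappa> (Suc k) x (?y y b)\<bar> \<le> C (Suc k)" for b x using \<kappa>0 \<kappa>C by simp
      show "(\<lambda>x. \<kappa> (Suc k) x (?y y b)) \<in> borel_measurable borel" for b
        by measurable
    qed
    then show ?thesis by simp
  qed simp
  let ?G = "\<lambda>x. of_bool (strict_mono_on S x) * (sdet S (\<lambda>a i. evolve \<kappa> \<phi> (Suc k) a (x i)) * sdet S (\<lambda>b i. \<psi> b (x i)))"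
  have e: "bij_betw (\<lambda>i. (Suc (Suc k), i)) S I"
    by (auto simp: bij_betw_def inj_on_def I_def)
  have wG: "w y * sdet S (\<lambda>a b. evolve \<kappa> \<phi> (Suc k) a (?y y b)) = ?G (\<lambda>i\<in>S. ?y y i)" for y
  proof -
    have "strict_mono_on S (\<lambda>i\<in>S. ?y y i) = strict_mono_on S (?y y)"
      by (auto simp: strict_mono_on_def)
    moreover have "sdet S (\<lambda>a i. evolve \<kappa> \<phi> (Suc k) a ((\<lambda>i\<in>S. ?y y i) i)) = sdet S (\<lambda>a i. evolve \<kappa> \<phi> (Suc k) a (?y y i))"
      "sdet S (\<lambda>a i. \<psi> a ((\<lambda>i\<in>S. ?y y i) i)) = sdet S (\<lambda>a i. \<psi> a (?y y i))"
      by (intro sdet_cong; simp)+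
    ultimately show ?thesis by (simp add: w_def del: evolve.simps)
  qed
  have int: "integrable lborel (\<lambda>x. evolve \<kappa> \<phi> (Suc k) a x * \<psi> b x)" if "a \<in> S" "b \<in> S" for a b
  proof (rule Bochner_Integration.integrable_bound)
    show "integrable lborel (\<lambda>x. C' * evolve \<kappa> \<phi> (Suc k) a x)" using \<phi>i[OF that(1)] by (rule integrable_mult_right)
    show "(\<lambda>x. evolve \<kappa> \<phi> (Suc k) a x * \<psi> b x) \<in> borel_measurable lborel"
      using \<phi>i[OF that(1), of "Suc k"] Suc.prems(1)[OF that(2)] by (intro borel_measurable_times) auto
    have "\<bar>evolve \<kappa> \<phi> (Suc k) a x * \<psi> b x\<bar> \<le> \<bar>C' * evolve \<kappa> \<phi> (Suc k) a x\<bar>" for x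
      using mult_right_mono[of "\<bar>\<psi> b x\<bar>" "\<bar>C'\<bar>" "\<bar>evolve \<kappa> \<phi> (Suc k) a x\<bar>"] Suc.prems(2)[OF that(2), of x]
      by (simp add: abs_mult mult.commute del: evolve.simps)
    then show "AE x in lborel. norm (evolve \<kappa> \<phi> (Suc k) a x * \<psi> b x) \<le> norm (C' * evolve \<kappa> \<phi> (Suc k) a x)" by simp
  qed
  have \<phi>m: "evolve \<kappa> \<phi> (Suc k) a \<in> borel_measurable borel" if "a \<in> S" for a
    using borel_measurable_integrable[OF \<phi>i[OF that]] by simp
  have intG: "integrable (Pi\<^sub>M S (\<lambda>_. lborel)) ?G"
    unfolding S_def by (rule integrable_Andreief) (use \<phi>m Suc.prems(1) int in \<open>auto simp: S_def simp del: evolve.simps\<close>)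
  have "(LINT x|Pi\<^sub>M ({1..Suc (Suc k)} \<times> S) (\<lambda>_. lborel). ?F x)
      = (LINT y|Pi\<^sub>M I (\<lambda>_. lborel). LINT x|Pi\<^sub>M J (\<lambda>_. lborel). ?F (merge I J (y, x)))"
    unfolding IJ(4) by (rule product_integral_fold[OF IJ(1-3) F])
  also have "\<dots> = (LINT y|Pi\<^sub>M I (\<lambda>_. lborel). ?G (\<lambda>i\<in>S. ?y y i))"
  proof (rule integral_cong_AE)
    show "(\<lambda>y. LINT x|Pi\<^sub>M J (\<lambda>_. lborel). ?F (merge I J (y, x))) \<in> borel_measurable (Pi\<^sub>M I (\<lambda>_. lborel))"
      using borel_measurable_integrable[OF P.integrable_fst'[OF f_int]] by simp
    show "(\<lambda>y. ?G (\<lambda>i\<in>S. ?y y i)) \<in> borel_measurable (Pi\<^sub>M I (\<lambda>_. lborel))"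
      by (rule borel_measurable_integrable[OF integrable_PiM_lborel_reindex[OF e fin intG]])
    show "AE y in Pi\<^sub>M I (\<lambda>_. lborel). (LINT x|Pi\<^sub>M J (\<lambda>_. lborel). ?F (merge I J (y, x))) = ?G (\<lambda>i\<in>S. ?y y i)"
      using P.AE_integrable_fst'[OF f_int]
    proof eventually_elim
      case (elim y)
      then show ?case using inner[of y] unfolding F_merge wG by simp
    qed
  qed
  also have "\<dots> = (LINT y|Pi\<^sub>M S (\<lambda>_. lborel). ?G y)"
    by (rule integral_PiM_lborel_reindex[OF e fin borel_measurable_integrable[OF intG]])
  also have "\<dots> = sdet S (\<lambda>a b. LINT x|lborel. evolve \<kappa> \<phi> (Suc k) a x * \<psi> b x)"
    unfolding S_def by (rule integral_Andreief) (use \<phi>m Suc.prems(1) int in \<open>auto simp: S_def simp del: evolve.simps\<close>)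
  finally show ?case .
qed

section \<open>The heat kernel with an absorbing wall\<close>

lemma heat_kernel_normal: "s > 0 \<Longrightarrow> heat_kernel s x y = normal_density x (sqrt s) y"
  by (simp add: heat_kernel_def normal_density_def power2_commute)

lemma heat_kernel_sym: "heat_kernel s x y = heat_kernel s y x"
  by (simp add: heat_kernel_def power2_commute)

lemma heat_kernel_reflect: "heat_kernel s (2 * m - x) y = heat_kernel s x (2 * m - y)"
  by (simp add: heat_kernel_def power2_eq_square algebra_simps)

lemma heat_kernel_pos: "s > 0 \<Longrightarrow> heat_kernel s x y > 0"
  by (simp add: heat_kernel_def)

lemma heat_kernel_nonneg [simp]: "s > 0 \<Longrightarrow> heat_kernel s x y \<ge> 0"
  by (simp add: heat_kernel_def)

lemma heat_kernel_le: "s > 0 \<Longrightarrow> heat_kernel s x y \<le> 1 / sqrt (2 * pi * s)"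
  unfolding heat_kernel_def by (intro divide_right_mono) auto

lemma borel_measurable_heat_kernel [measurable]:
  assumes [measurable]: "f \<in> borel_measurable M" "g \<in> borel_measurable M"
  shows "(\<lambda>x. heat_kernel s (f x) (g x)) \<in> borel_measurable M"
  unfolding heat_kernel_def by measurable

lemma integrable_heat_kernel: "s > 0 \<Longrightarrow> integrable lborel (heat_kernel s x)"
proof -
  assume "s > 0"
  moreover from this have "heat_kernel s x = normal_density x (sqrt s)"
    by (simp add: fun_eq_iff heat_kernel_normal)
  ultimately show ?thesis by simp
qed

lemma integral_heat_kernel: "s > 0 \<Longrightarrow> (LINT y|lborel. heat_kernel s x y) = 1"
  by (simp add: heat_kernel_normal integral_normal_density)

lemma integrable_heat_kernel': "s > 0 \<Longrightarrow> integrable lborel (\<lambda>x. heat_kernel s x y)"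
  using integrable_heat_kernel[of s y] by (subst heat_kernel_sym)

lemma integral_heat_kernel': "s > 0 \<Longrightarrow> (LINT x|lborel. heat_kernel s x y) = 1"
  using integral_heat_kernel[of s y] by (subst heat_kernel_sym)

lemma integrable_mult_heat_kernel:
  assumes "s > 0" "integrable lborel f"
  shows "integrable lborel (\<lambda>x. f x * heat_kernel s x y)"
proof (rule Bochner_Integration.integrable_bound)
  show "integrable lborel (\<lambda>x. f x * (1 / sqrt (2 * pi * s)))" using assms(2) by simp
  show "(\<lambda>x. f x * heat_kernel s x y) \<in> borel_measurable lborel"
    using assms(2) by (intro borel_measurable_times) auto
  show "AE x in lborel. norm (f x * heat_kernel s x y) \<le> norm (f x * (1 / sqrt (2 * pi * s)))"
    unfolding norm_mult using heat_kernel_le[OF assms(1)] heat_kernel_nonneg[OF assms(1)] assms(1)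
    by (intro AE_I2 mult_left_mono) auto
qed

text \<open>After a shift by \<open>z\<close> this is the convolution of two centred normal
  densities.\<close>

lemma heat_kernel_semigroup:
  assumes "s > 0" "t > 0"
  shows "(LINT y|lborel. heat_kernel s x y * heat_kernel t y z) = heat_kernel (s + t) x z"
proof -
  have "(\<integral>\<^sup>+y. ennreal (heat_kernel s x y * heat_kernel t y z) \<partial>lborel)
     = (\<integral>\<^sup>+y. ennreal (heat_kernel s x (z + y) * heat_kernel t (z + y) z) \<partial>lborel)"
    using nn_integral_real_affine[of "\<lambda>y. ennreal (heat_kernel s x y * heat_kernel t y z)" 1 z] by simp
  also have "\<dots> = (\<integral>\<^sup>+y. ennreal (normal_density 0 (sqrt s) ((x - z) - y) * normal_density 0 (sqrt t) y) \<partial>lborel)"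
    using assms by (intro nn_integral_cong) (simp add: heat_kernel_normal normal_density_def power2_commute algebra_simps)
  also have "\<dots> = ennreal (normal_density 0 (sqrt ((sqrt s)\<^sup>2 + (sqrt t)\<^sup>2)) (x - z))"
    using conv_normal_density_zero_mean[of "sqrt s" "sqrt t"] assms by (auto simp: fun_eq_iff)
  also have "\<dots> = ennreal (heat_kernel (s + t) x z)"
    using assms by (simp add: heat_kernel_normal normal_density_def power2_commute)
  finally have eq: "(\<integral>\<^sup>+y. ennreal (heat_kernel s x y * heat_kernel t y z) \<partial>lborel) = ennreal (heat_kernel (s + t) x z)" .
  show ?thesis
    by (subst integral_eq_nn_integral) (use assms eq in \<open>auto simp: less_imp_le heat_kernel_pos\<close>)
qed

lemma heat_kernel_convolve:
  assumes "s > 0" "t > 0" and f: "integrable lborel f"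
  shows "(LINT y|lborel. (LINT x|lborel. f x * heat_kernel s x y) * heat_kernel t y z)
       = (LINT x|lborel. f x * heat_kernel (s + t) x z)"
proof -
  have [measurable]: "f \<in> borel_measurable borel" using f by auto
  have int: "integrable (lborel \<Otimes>\<^sub>M lborel) (\<lambda>(x, y). f x * heat_kernel s x y * heat_kernel t y z)"
  proof (rule lborel_pair.Fubini_integrable)
    have "(LINT y|lborel. norm (f x * heat_kernel s x y * heat_kernel t y z)) = \<bar>f x\<bar> * heat_kernel (s + t) x z" for x
      using assms by (simp add: abs_mult mult.assoc heat_kernel_semigroup)
    then show "integrable lborel (\<lambda>x. LINT y|lborel. norm (case (x, y) of (x, y) \<Rightarrow> f x * heat_kernel s x y * heat_kernel t y z))"
      using integrable_mult_heat_kernel[OF _ integrable_abs[OF f], of "s + t" z] assms by simp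
    show "AE x in lborel. integrable lborel (\<lambda>y. case (x, y) of (x, y) \<Rightarrow> f x * heat_kernel s x y * heat_kernel t y z)"
      using assms by (auto simp: mult.assoc intro!: integrable_mult_right integrable_mult_heat_kernel integrable_heat_kernel)
  qed measurable
  have "(LINT y|lborel. (LINT x|lborel. f x * heat_kernel s x y) * heat_kernel t y z)
     = (LINT y|lborel. LINT x|lborel. f x * heat_kernel s x y * heat_kernel t y z)"
    by simp
  also have "\<dots> = (LINT x|lborel. LINT y|lborel. f x * heat_kernel s x y * heat_kernel t y z)"
    by (rule lborel_pair.Fubini_integral[OF int])
  also have "\<dots> = (LINT x|lborel. f x * heat_kernel (s + t) x z)"
    using assms by (simp add: mult.assoc heat_kernel_semigroup)
  finally show ?thesis .
qed

text \<open>Half of the Gaussian exponent is given up: beyond \<open>m\<close> the kernel is at most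
  \<open>exp (- \<epsilon>\<^sup>2 / (4 * s))\<close> times the kernel of doubled variance, whose
  total mass is 1; \<open>sqrt 2\<close> is the ratio of the normalisations.\<close>

lemma heat_kernel_tail:
  assumes "s > 0" "\<epsilon> \<ge> 0" "y + \<epsilon> \<le> m"
  shows "(LINT x|lborel. indicator {m..} x * heat_kernel s y x) \<le> sqrt 2 * exp (- \<epsilon>\<^sup>2 / (4 * s))"
proof -
  have "(LINT x|lborel. indicator {m..} x * heat_kernel s y x)
     \<le> (LINT x|lborel. sqrt 2 * exp (- \<epsilon>\<^sup>2 / (4 * s)) * heat_kernel (2 * s) y x)"
  proof (rule integral_mono)
    show "integrable lborel (\<lambda>x. indicator {m..} x * heat_kernel s y x)"
      using integrable_mult_indicator[OF _ integrable_heat_kernel[OF assms(1)], of "{m..}" y] by simp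
    show "integrable lborel (\<lambda>x. sqrt 2 * exp (- \<epsilon>\<^sup>2 / (4 * s)) * heat_kernel (2 * s) y x)"
      using assms by (intro integrable_mult_right integrable_heat_kernel) auto
    fix x
    show "indicator {m..} x * heat_kernel s y x \<le> sqrt 2 * exp (- \<epsilon>\<^sup>2 / (4 * s)) * heat_kernel (2 * s) y x"
    proof (cases "x \<ge> m")
      case True
      have "\<epsilon>\<^sup>2 \<le> (y - x)\<^sup>2"
        using True assms by (subst power2_commute) (intro power_mono; simp)
      then have "- (y - x)\<^sup>2 / (2 * s) \<le> - \<epsilon>\<^sup>2 / (4 * s) + - (y - x)\<^sup>2 / (2 * (2 * s))"
        using assms(1) by (simp add: field_simps)
      then have "exp (- (y - x)\<^sup>2 / (2 * s)) \<le> exp (- \<epsilon>\<^sup>2 / (4 * s)) * exp (- (y - x)\<^sup>2 / (2 * (2 * s)))"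
        by (simp flip: exp_add)
      moreover have "sqrt 2 / sqrt (2 * pi * (2 * s)) = 1 / sqrt (2 * pi * s)"
        using assms(1) by (simp add: real_sqrt_mult field_simps)
      moreover have "sqrt 2 * exp (- \<epsilon>\<^sup>2 / (4 * s)) * heat_kernel (2 * s) y x
        = exp (- \<epsilon>\<^sup>2 / (4 * s)) * exp (- (y - x)\<^sup>2 / (2 * (2 * s))) * (sqrt 2 / sqrt (2 * pi * (2 * s)))"
        unfolding heat_kernel_def by simp
      moreover have "indicator {m..} x * heat_kernel s y x = exp (- (y - x)\<^sup>2 / (2 * s)) * (1 / sqrt (2 * pi * s))"
        using True by (simp add: heat_kernel_def)
      moreover have "exp (- (y - x)\<^sup>2 / (2 * s)) * (1 / sqrt (2 * pi * s))
        \<le> exp (- \<epsilon>\<^sup>2 / (4 * s)) * exp (- (y - x)\<^sup>2 / (2 * (2 * s))) * (1 / sqrt (2 * pi * s))"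
        using calculation(1) assms(1) by (intro mult_right_mono) auto
      ultimately show ?thesis by metis
    qed (use assms in simp)
  qed
  also have "\<dots> = sqrt 2 * exp (- \<epsilon>\<^sup>2 / (4 * s))"
    using assms by (simp add: integral_heat_kernel)
  finally show ?thesis .
qed

text \<open>Method of images: for a density supported below \<open>m\<close> and for
  \<open>y \<le> m\<close> this is the density of Brownian motion absorbed at \<open>m\<close>. It
  is defined for all \<open>y\<close>, as the extension that is antisymmetric about
  \<open>m\<close>.\<close>

definition absorbed :: "real \<Rightarrow> (real \<Rightarrow> real) \<Rightarrow> real \<Rightarrow> real \<Rightarrow> real" where
  "absorbed m \<phi> t y = (LINT x|lborel. \<phi> x * (heat_kernel t x y - heat_kernel t x (2 * m - y)))"

text \<open>Absorption tested only at multiples of \<open>h\<close>; between two tests the path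
  moves freely. The start is not cut off here.\<close>

primrec killed :: "real \<Rightarrow> real \<Rightarrow> (real \<Rightarrow> real) \<Rightarrow> nat \<Rightarrow> real \<Rightarrow> real" where
  "killed m h \<phi> 0 = \<phi>"
| "killed m h \<phi> (Suc n) = (\<lambda>y. LINT x|lborel. killed m h \<phi> n x * (heat_kernel h x y * indicator {..m} y))"

lemma killed_Suc: "killed m h \<phi> (Suc n) y = indicator {..m} y * (LINT x|lborel. killed m h \<phi> n x * heat_kernel h x y)"
  by (cases "y \<le> m") simp_all

section \<open>Discrete against continuous absorption\<close>

context
  fixes m h C :: real and \<phi> :: "real \<Rightarrow> real"
  assumes h: "h > 0" and \<phi>i: "integrable lborel \<phi>" and \<phi>0: "\<And>x. \<phi> x \<ge> 0"
    and \<phi>C: "\<And>x. \<phi> x \<le> C" and supp: "\<And>x. x > m \<Longrightarrow> \<phi> x = 0"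
begin

lemma C_nonneg: "C \<ge> 0" using \<phi>0[of 0] \<phi>C[of 0] by linarith

lemma absorbed_alt:
  assumes "t > 0"
  shows "absorbed m' \<phi> t y = (LINT x|lborel. \<phi> x * heat_kernel t x y) - (LINT x|lborel. \<phi> x * heat_kernel t x (2 * m' - y))"
  unfolding absorbed_def right_diff_distrib
  by (intro Bochner_Integration.integral_diff integrable_mult_heat_kernel assms \<phi>i)

lemma convolve_bounds:
  assumes "t > 0" shows "0 \<le> (LINT x|lborel. \<phi> x * heat_kernel t x y)" "(LINT x|lborel. \<phi> x * heat_kernel t x y) \<le> C"
proof -
  show "0 \<le> (LINT x|lborel. \<phi> x * heat_kernel t x y)"
    using \<phi>0 assms by (intro Bochner_Integration.integral_nonneg) auto
  have "(LINT x|lborel. \<phi> x * heat_kernel t x y) \<le> (LINT x|lborel. C * heat_kernel t x y)"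
    using \<phi>C assms by (intro integral_mono integrable_mult_heat_kernel \<phi>i integrable_mult_right integrable_heat_kernel' mult_right_mono) auto
  then show "(LINT x|lborel. \<phi> x * heat_kernel t x y) \<le> C" using assms by (simp add: integral_heat_kernel')
qed

lemma absorbed_reflect: "absorbed m' \<phi> t (2 * m' - y) = - absorbed m' \<phi> t y"
  unfolding absorbed_def by (subst Bochner_Integration.integral_minus[symmetric]) (simp add: algebra_simps)

lemma absorbed_nonneg:
  assumes "t > 0" "m \<le> m'" "y \<le> m'" shows "absorbed m' \<phi> t y \<ge> 0"
  unfolding absorbed_def
proof (intro Bochner_Integration.integral_nonneg)
  fix x
  show "0 \<le> \<phi> x * (heat_kernel t x y - heat_kernel t x (2 * m' - y))"
  proof (cases "x \<le> m")
    case True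
    have "0 \<le> (m' - x) * (m' - y)" using True assms by (intro mult_nonneg_nonneg) auto
    then have "(x - y)\<^sup>2 \<le> (x - (2 * m' - y))\<^sup>2"
      by (simp add: power2_eq_square algebra_simps)
    then have "heat_kernel t x (2 * m' - y) \<le> heat_kernel t x y"
      unfolding heat_kernel_def using assms(1) by (auto intro!: divide_right_mono)
    then show ?thesis using \<phi>0[of x] by simp
  qed (simp add: supp)
qed

lemma absorbed_nonpos:
  assumes "t > 0" "m \<le> m'" "y \<ge> m'" shows "absorbed m' \<phi> t y \<le> 0"
  using absorbed_nonneg[OF assms(1,2), of "2 * m' - y"] assms(3) by (simp add: absorbed_reflect)

lemma absorbed_bound: "t > 0 \<Longrightarrow> \<bar>absorbed m' \<phi> t y\<bar> \<le> C"
  using convolve_bounds[of t y] convolve_bounds[of t "2 * m' - y"] by (simp add: absorbed_alt)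

lemma integrable_convolve:
  assumes "t > 0" "integrable lborel f"
  shows "integrable lborel (\<lambda>y. LINT x|lborel. f x * heat_kernel t x y)"
proof -
  have [measurable]: "f \<in> borel_measurable borel" using assms(2) by auto
  have "integrable (lborel \<Otimes>\<^sub>M lborel) (\<lambda>(x, y). f x * heat_kernel t x y)"
  proof (rule lborel_pair.Fubini_integrable)
    have "(LINT y|lborel. norm (f x * heat_kernel t x y)) = \<bar>f x\<bar>" for x
      using assms by (simp add: abs_mult integral_heat_kernel)
    then show "integrable lborel (\<lambda>x. LINT y|lborel. norm (case (x, y) of (x, y) \<Rightarrow> f x * heat_kernel t x y))"
      using assms(2) by simp
    show "AE x in lborel. integrable lborel (\<lambda>y. case (x, y) of (x, y) \<Rightarrow> f x * heat_kernel t x y)"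
      using assms(1) by (auto intro!: integrable_mult_right integrable_heat_kernel)
  qed measurable
  from lborel_pair.integrable_snd[OF this] show ?thesis by simp
qed

lemma integrable_absorbed: "t > 0 \<Longrightarrow> integrable lborel (absorbed m' \<phi> t)"
proof -
  assume t: "t > 0"
  let ?c = "\<lambda>y. LINT x|lborel. \<phi> x * heat_kernel t x y"
  have "integrable lborel (\<lambda>y. ?c (2 * m' + (-1) * y))"
    by (rule lborel_integrable_real_affine[OF integrable_convolve[OF t \<phi>i]]) simp
  then show ?thesis
    unfolding absorbed_alt[OF t, abs_def] using integrable_convolve[OF t \<phi>i]
    by (intro Bochner_Integration.integrable_diff) auto
qed

text \<open>No wall acts in this step: free heat flow preserves antisymmetry about
  \<open>m'\<close>, and the antisymmetric extension simply follows the free semigroup.\<close>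

lemma absorbed_step:
  assumes t: "t > 0"
  shows "(LINT x|lborel. absorbed m' \<phi> t x * heat_kernel h x y) = absorbed m' \<phi> (t + h) y"
proof -
  let ?c = "\<lambda>y. LINT x|lborel. \<phi> x * heat_kernel t x y"
  have i1: "integrable lborel (\<lambda>x. ?c x * heat_kernel h x y)" for y
    by (intro integrable_mult_heat_kernel h integrable_convolve t \<phi>i)
  have i2: "integrable lborel (\<lambda>x. ?c (2 * m' + (-1) * x) * heat_kernel h x y)"
    using lborel_integrable_real_affine[OF integrable_convolve[OF t \<phi>i], of "-1" "2 * m'"]
    by (intro integrable_mult_heat_kernel h) auto
  have "(LINT x|lborel. absorbed m' \<phi> t x * heat_kernel h x y) = (LINT x|lborel. ?c x * heat_kernel h x y) - (LINT x|lborel. ?c (2 * m' + (-1) * x) * heat_kernel h x y)"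
    unfolding absorbed_alt[OF t] left_diff_distrib
    using Bochner_Integration.integral_diff[OF i1 i2] by simp
  also have "(LINT x|lborel. ?c (2 * m' + (-1) * x) * heat_kernel h x y) = (LINT x|lborel. ?c x * heat_kernel h (2 * m' - x) y)"
    using lborel_integral_real_affine[of "-1" "\<lambda>x. ?c x * heat_kernel h (2 * m' - x) y" "2 * m'"] by simp
  also have "\<dots> = (LINT x|lborel. ?c x * heat_kernel h x (2 * m' - y))"
    by (simp add: heat_kernel_reflect)
  finally show ?thesis
    by (simp add: heat_kernel_convolve[OF t h \<phi>i] absorbed_alt t h add_pos_pos)
qed

lemma killed_bounds:
  "integrable lborel (killed m h \<phi> n) \<and> (\<forall>x. 0 \<le> killed m h \<phi> n x \<and> killed m h \<phi> n x \<le> C) \<and> (\<forall>x>m. killed m h \<phi> n x = 0)"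
proof (induction n)
  case (Suc n)
  let ?k = "killed m h \<phi> n"
  have i: "integrable lborel (\<lambda>x. ?k x * heat_kernel h x y)" for y
    using Suc h by (intro integrable_mult_heat_kernel) auto
  have e: "killed m h \<phi> (Suc n) y = indicator {..m} y * (LINT x|lborel. ?k x * heat_kernel h x y)" for y
    by (rule killed_Suc)
  have "0 \<le> (LINT x|lborel. ?k x * heat_kernel h x y)" for y
    using Suc h by (intro Bochner_Integration.integral_nonneg) auto
  moreover have "(LINT x|lborel. ?k x * heat_kernel h x y) \<le> (LINT x|lborel. C * heat_kernel h x y)" for y
    using Suc h by (intro integral_mono i integrable_mult_right integrable_heat_kernel' mult_right_mono) auto
  moreover have "integrable lborel (\<lambda>y. indicator {..m} y *\<^sub>R (LINT x|lborel. ?k x * heat_kernel h x y))"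
    using Suc h by (intro integrable_mult_indicator integrable_convolve) auto
  ultimately show ?case
    unfolding e using h C_nonneg by (auto simp: integral_heat_kernel' indicator_def)
qed (use \<phi>i \<phi>0 \<phi>C supp in auto)

text \<open>Beyond \<open>m\<close> the discrete density is 0 and the antisymmetric extension is
  nonpositive, so the induction hypothesis holds on the whole line and can be integrated against the
  positive kernel.\<close>

lemma killed_ge_absorbed:
  "y \<le> m \<Longrightarrow> absorbed m \<phi> (real (Suc n) * h) y \<le> killed m h \<phi> (Suc n) y"
proof (induction n arbitrary: y)
  case 0
  then show ?case
    unfolding killed_Suc killed.simps(1) using convolve_bounds(1)[OF h, of "2 * m - y"] by (simp add: absorbed_alt h)
next
  case (Suc n)
  let ?t = "real (Suc n) * h"
  have t: "?t > 0" using h by simp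
  have "absorbed m \<phi> (?t + h) y = (LINT x|lborel. absorbed m \<phi> ?t x * heat_kernel h x y)"
    by (rule absorbed_step[OF t, symmetric])
  also have "\<dots> \<le> (LINT x|lborel. killed m h \<phi> (Suc n) x * heat_kernel h x y)"
  proof (intro integral_mono integrable_mult_heat_kernel h integrable_absorbed t mult_right_mono)
    fix x
    show "absorbed m \<phi> ?t x \<le> killed m h \<phi> (Suc n) x"
    proof (cases "x \<le> m")
      case True then show ?thesis by (rule Suc.IH)
    next
      case False
      then show ?thesis using killed_bounds[of "Suc n"] absorbed_nonpos[OF t order_refl, of x] by auto
    qed
  qed (use killed_bounds[of "Suc n"] h in auto)
  also have "\<dots> = killed m h \<phi> (Suc (Suc n)) y"
    using Suc.prems by (simp del: killed.simps(2) add: killed.simps(2)[of m h \<phi> "Suc n"])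
  finally show ?case by (simp add: algebra_simps)
qed

text \<open>Raising the wall by \<open>\<epsilon>\<close> keeps the absorbed density nonnegative up
  to \<open>m + \<epsilon>\<close>. The comparison fails only beyond that level, by at most
  \<open>C\<close>, and reaching it from \<open>y \<le> m\<close> in one step costs a Gaussian tail.
  Each of the \<open>Suc n\<close> steps contributes one such error.\<close>

lemma killed_le_absorbed:
  assumes \<epsilon>: "\<epsilon> \<ge> 0"
  shows "y \<le> m \<Longrightarrow> killed m h \<phi> (Suc n) y \<le> absorbed (m + \<epsilon>) \<phi> (real (Suc n) * h) y + real (Suc n) * (C * (sqrt 2 * exp (- \<epsilon>\<^sup>2 / (4 * h))))"
proof (induction n arbitrary: y)
  case 0
  have "(LINT x|lborel. \<phi> x * heat_kernel h x (2 * (m + \<epsilon>) - y)) \<le> (LINT x|lborel. C * (indicator {m + \<epsilon>..} (2 * (m + \<epsilon>) - x) * heat_kernel h y (2 * (m + \<epsilon>) - x)))"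
  proof (rule integral_mono)
    show "integrable lborel (\<lambda>x. \<phi> x * heat_kernel h x (2 * (m + \<epsilon>) - y))"
      by (intro integrable_mult_heat_kernel h \<phi>i)
    have "integrable lborel (\<lambda>x. indicator {m + \<epsilon>..} x *\<^sub>R heat_kernel h y x)"
      by (intro integrable_mult_indicator integrable_heat_kernel h) auto
    from lborel_integrable_real_affine[OF this, of "-1" "2 * (m + \<epsilon>)"]
    show "integrable lborel (\<lambda>x. C * (indicator {m + \<epsilon>..} (2 * (m + \<epsilon>) - x) * heat_kernel h y (2 * (m + \<epsilon>) - x)))"
      by (intro integrable_mult_right) simp
    fix x
    show "\<phi> x * heat_kernel h x (2 * (m + \<epsilon>) - y) \<le> C * (indicator {m + \<epsilon>..} (2 * (m + \<epsilon>) - x) * heat_kernel h y (2 * (m + \<epsilon>) - x))"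
    proof (cases "x \<le> m + \<epsilon>")
      case True
      have "heat_kernel h y (2 * (m + \<epsilon>) - x) = heat_kernel h x (2 * (m + \<epsilon>) - y)"
        by (simp add: heat_kernel_def power2_eq_square algebra_simps)
      then show ?thesis using True \<phi>C[of x] h by (auto intro!: mult_right_mono)
    next
      case False
      then show ?thesis
        using supp[of x] C_nonneg h \<epsilon> by (auto simp: indicator_def)
    qed
  qed
  also have "\<dots> = C * (LINT x|lborel. indicator {m + \<epsilon>..} x * heat_kernel h y x)"
    using lborel_integral_real_affine[of "-1" "\<lambda>x. indicator {m + \<epsilon>..} x * heat_kernel h y x" "2 * (m + \<epsilon>)"] by simp
  also have "\<dots> \<le> C * (sqrt 2 * exp (- \<epsilon>\<^sup>2 / (4 * h)))"
    using 0 \<epsilon> h by (intro mult_left_mono heat_kernel_tail C_nonneg) auto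
  finally show ?case
    unfolding killed_Suc killed.simps(1) using 0 by (simp add: absorbed_alt h)
next
  case (Suc n)
  let ?t = "real (Suc n) * h" and ?m = "m + \<epsilon>" and ?E = "C * (sqrt 2 * exp (- \<epsilon>\<^sup>2 / (4 * h)))"
  have t: "?t > 0" using h by simp
  have i: "integrable lborel (\<lambda>x. indicator {?m..} x * heat_kernel h x y)"
    using integrable_mult_indicator[OF _ integrable_heat_kernel'[OF h], of "{?m..}" y] by simp
  have E0: "?E \<ge> 0" using C_nonneg by simp
  have "killed m h \<phi> (Suc (Suc n)) y = (LINT x|lborel. killed m h \<phi> (Suc n) x * heat_kernel h x y)"
    using Suc.prems by (simp del: killed.simps(2) add: killed.simps(2)[of m h \<phi> "Suc n"])
  also have "\<dots> \<le> (LINT x|lborel. absorbed ?m \<phi> ?t x * heat_kernel h x y + (real (Suc n) * ?E * heat_kernel h x y + C * (indicator {?m..} x * heat_kernel h x y)))"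
  proof (rule integral_mono)
    show "integrable lborel (\<lambda>x. killed m h \<phi> (Suc n) x * heat_kernel h x y)"
      using killed_bounds[of "Suc n"] h by (intro integrable_mult_heat_kernel) auto
    show "integrable lborel (\<lambda>x. absorbed ?m \<phi> ?t x * heat_kernel h x y + (real (Suc n) * ?E * heat_kernel h x y + C * (indicator {?m..} x * heat_kernel h x y)))"
      by (intro Bochner_Integration.integrable_add integrable_mult_heat_kernel integrable_absorbed t h integrable_mult_right integrable_heat_kernel' i)
    fix x
    have "killed m h \<phi> (Suc n) x \<le> absorbed ?m \<phi> ?t x + (real (Suc n) * ?E + C * indicator {?m..} x)"
    proof -
      \<comment> \<open>Below \<open>m\<close> the induction hypothesis applies; in the gap the
        discrete density is 0 and the absorbed one nonnegative; above the raised wall the absorbed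
        one is at least \<open>- C\<close>.\<close>
      consider "x \<le> m" | "m < x" "x \<le> ?m" | "?m < x" by linarith
      then show ?thesis
      proof cases
        case 1
        then show ?thesis using Suc.IH[OF 1] \<epsilon> C_nonneg by (simp add: indicator_def del: killed.simps)
      next
        case 2
        then show ?thesis
          using killed_bounds[of "Suc n"] absorbed_nonneg[OF t, of ?m x] \<epsilon> E0 C_nonneg mult_nonneg_nonneg[OF of_nat_0_le_iff E0, of "Suc n"]
          by (simp add: indicator_def del: killed.simps)
      next
        case 3
        have "- C \<le> absorbed ?m \<phi> ?t x" using absorbed_bound[OF t, of ?m x] by linarith
        moreover have "killed m h \<phi> (Suc n) x = 0" using killed_bounds[of "Suc n"] 3 \<epsilon> by auto
        ultimately show ?thesis
          using 3 mult_nonneg_nonneg[OF of_nat_0_le_iff E0, of "Suc n"] by (simp add: indicator_def del: killed.simps)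
      qed
    qed
    from mult_right_mono[OF this heat_kernel_nonneg[OF h, of x y]]
    show "killed m h \<phi> (Suc n) x * heat_kernel h x y \<le> absorbed ?m \<phi> ?t x * heat_kernel h x y + (real (Suc n) * ?E * heat_kernel h x y + C * (indicator {?m..} x * heat_kernel h x y))"
      by (simp add: algebra_simps del: killed.simps)
  qed
  also have "\<dots> = absorbed ?m \<phi> (?t + h) y + (real (Suc n) * ?E + C * (LINT x|lborel. indicator {?m..} x * heat_kernel h x y))"
    by (subst Bochner_Integration.integral_add, intro integrable_mult_heat_kernel integrable_absorbed t h,
        intro Bochner_Integration.integrable_add integrable_mult_right integrable_heat_kernel' i h,
        subst Bochner_Integration.integral_add, intro integrable_mult_right integrable_heat_kernel' h, intro integrable_mult_right i)
       (simp add: absorbed_step[OF t] integral_heat_kernel' h del: of_nat_Suc)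
  also have "\<dots> \<le> absorbed ?m \<phi> (?t + h) y + (real (Suc n) * ?E + C * (sqrt 2 * exp (- \<epsilon>\<^sup>2 / (4 * h))))"
    using heat_kernel_tail[OF h \<epsilon>, of y ?m] Suc.prems
    by (intro add_left_mono mult_left_mono C_nonneg) (simp add: heat_kernel_sym[of h _ y])
  finally show ?case
    by (simp add: algebra_simps del: killed.simps)
qed

end

section \<open>Generating functions of the one-particle densities\<close>

text \<open>Once the lower coefficients agree, divide the difference by \<open>x ^ n\<close> and let
  \<open>x\<close> tend to 0. All pairings below are identified by comparing generating functions in
  this way.\<close>

lemma real_power_series_unique:
  fixes a b :: "nat \<Rightarrow> real"
  assumes a: "\<And>x. (\<lambda>n. a n * x ^ n) sums f x" and b: "\<And>x. (\<lambda>n. b n * x ^ n) sums f x"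
  shows "a n = b n"
proof -
  define c where "c n = a n - b n" for n
  have c: "(\<lambda>n. c n * x ^ n) sums 0" for x
    using sums_diff[OF a[of x] b[of x]] by (simp add: c_def left_diff_distrib)
  have "c n = 0"
  proof (induction n rule: less_induct)
    case (less n)
    have "((\<lambda>x::real. 0) \<longlongrightarrow> c (0 + n)) (at 0)"
    proof (rule powser_limit_0_strong[of 1 "\<lambda>k. c (k + n)"])
      fix x :: real assume "x \<noteq> 0"
      have "(\<lambda>k. c (k + n) * x ^ (k + n)) sums (0 - (\<Sum>i<n. c i * x ^ i))"
        using c[of x] by (subst sums_iff_shift) simp
      then have "(\<lambda>k. c (k + n) * x ^ (k + n)) sums 0" using less by simp
      then have "(\<lambda>k. c (k + n) * x ^ (k + n) / x ^ n) sums (0 / x ^ n)" by (rule sums_divide)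
      then show "(\<lambda>k. c (k + n) * x ^ k) sums 0" using \<open>x \<noteq> 0\<close> by (simp add: power_add)
    qed simp
    then show ?case by (simp add: tendsto_const_iff)
  qed
  then show ?thesis by (simp add: c_def)
qed

lemma exp_sums_real: "(\<lambda>n. (c ^ n / fact n) * x ^ n) sums exp (c * x :: real)"
  using exp_converges[of "c * x"] by (simp add: power_mult_distrib divide_inverse mult_ac)

text \<open>Taylor coefficients, in the variable \<open>y\<close>, of \<open>exp (\<alpha> x y - \<beta> y\<^sup>2)\<close>, as polynomials in \<open>x\<close>
  (Hermite polynomials up to scaling).\<close>

definition even_coeff :: "real \<Rightarrow> nat \<Rightarrow> real" where
  "even_coeff \<beta> n = (if even n then (- \<beta>) ^ (n div 2) / fact (n div 2) else 0)"

definition gen_poly :: "real \<Rightarrow> real \<Rightarrow> nat \<Rightarrow> real poly" where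
  "gen_poly \<alpha> \<beta> a = (\<Sum>i\<le>a. Polynomial.monom (\<alpha> ^ i / fact i * even_coeff \<beta> (a - i)) i)"

lemma degree_gen_poly: "degree (gen_poly \<alpha> \<beta> a) \<le> a"
  unfolding gen_poly_def by (intro degree_sum_le) (auto intro: order_trans[OF degree_monom_le])

lemma coeff_gen_poly: "coeff (gen_poly \<alpha> \<beta> a) a = \<alpha> ^ a / fact a"
  by (simp add: gen_poly_def coeff_sum even_coeff_def)

lemma poly_gen_poly: "poly (gen_poly \<alpha> \<beta> a) x * y ^ a = (\<Sum>i\<le>a. ((\<alpha> * x) ^ i / fact i * y ^ i) * (even_coeff \<beta> (a - i) * y ^ (a - i)))"
proof -
  have "poly (gen_poly \<alpha> \<beta> a) x * y ^ a = (\<Sum>i\<le>a. \<alpha> ^ i / fact i * even_coeff \<beta> (a - i) * x ^ i * y ^ a)"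
    by (simp add: gen_poly_def poly_sum poly_monom sum_distrib_right)
  also have "\<dots> = (\<Sum>i\<le>a. ((\<alpha> * x) ^ i / fact i * y ^ i) * (even_coeff \<beta> (a - i) * y ^ (a - i)))"
  proof (intro sum.cong refl)
    fix i assume "i \<in> {..a}"
    then have "y ^ a = y ^ i * y ^ (a - i)" by (simp flip: power_add)
    then show "\<alpha> ^ i / fact i * even_coeff \<beta> (a - i) * x ^ i * y ^ a = ((\<alpha> * x) ^ i / fact i * y ^ i) * (even_coeff \<beta> (a - i) * y ^ (a - i))"
      by (simp add: power_mult_distrib)
  qed
  finally show ?thesis .
qed

lemma even_coeff_sums: "(\<lambda>n. even_coeff \<beta> n * y ^ n) sums exp (- \<beta> * y\<^sup>2)"
proof -
  have "(\<lambda>n. even_coeff \<beta> (2 * n) * y ^ (2 * n)) sums exp (- \<beta> * y\<^sup>2)"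
    using exp_sums_real[of "- \<beta>" "y\<^sup>2"] by (simp add: even_coeff_def power_mult)
  then show ?thesis
    by (subst (asm) sums_mono_reindex[of "(*) 2" "\<lambda>n. even_coeff \<beta> n * y ^ n"])
       (auto simp: strict_mono_def even_coeff_def elim!: evenE)
qed

lemma abs_even_coeff: "\<beta> \<ge> 0 \<Longrightarrow> \<bar>even_coeff \<beta> n\<bar> = even_coeff (- \<beta>) n"
  by (simp add: even_coeff_def power_abs abs_mult)

lemma exp_terms_abs: "(\<lambda>n. \<bar>(c ^ n / fact n) * x ^ n\<bar>) sums exp (\<bar>c * x\<bar> :: real)"
  using exp_sums_real[of "\<bar>c\<bar>" "\<bar>x\<bar>"] by (simp add: abs_mult power_abs)

lemma even_terms_abs: "\<beta> \<ge> 0 \<Longrightarrow> (\<lambda>n. \<bar>even_coeff \<beta> n * y ^ n\<bar>) sums exp (\<beta> * y\<^sup>2)"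
  using even_coeff_sums[of "- \<beta>" "\<bar>y\<bar>"] by (simp add: abs_mult abs_even_coeff power_abs)

text \<open>The Cauchy product of the exponential series in \<open>\<alpha> * x * y\<close> and in
  \<open>- \<beta> * y\<^sup>2\<close>.\<close>

lemma gen_poly_sums:
  assumes "\<beta> \<ge> 0"
  shows "(\<lambda>a. poly (gen_poly \<alpha> \<beta> a) x * y ^ a) sums exp (\<alpha> * x * y - \<beta> * y\<^sup>2)"
proof -
  have "(\<lambda>a. poly (gen_poly \<alpha> \<beta> a) x * y ^ a) sums
     ((\<Sum>n. (\<alpha> * x) ^ n / fact n * y ^ n) * (\<Sum>n. even_coeff \<beta> n * y ^ n))"
    unfolding poly_gen_poly using exp_terms_abs[of "\<alpha> * x" y] even_terms_abs[OF assms, of y]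
    by (intro Cauchy_product_sums) (auto simp: sums_iff)
  also have "\<dots> = exp (\<alpha> * x * y) * exp (- \<beta> * y\<^sup>2)"
    using exp_sums_real[of "\<alpha> * x" y] even_coeff_sums[of \<beta> y] by (simp add: sums_iff)
  finally show ?thesis by (simp flip: exp_add)
qed

text \<open>The same Cauchy product with absolute values. The bound does not depend on
  \<open>n\<close>, as domination of the partial sums requires.\<close>

lemma gen_poly_sum_abs_le:
  assumes "\<beta> \<ge> 0"
  shows "(\<Sum>a<n. \<bar>poly (gen_poly \<alpha> \<beta> a) x * y ^ a\<bar>) \<le> exp (\<bar>\<alpha> * x * y\<bar> + \<beta> * y\<^sup>2)"
proof -
  let ?u = "\<lambda>n. \<bar>(\<alpha> * x) ^ n / fact n * y ^ n\<bar>" and ?v = "\<lambda>n. \<bar>even_coeff \<beta> n * y ^ n\<bar>"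
  have "(\<lambda>k. \<Sum>i\<le>k. ?u i * ?v (k - i)) sums ((\<Sum>n. ?u n) * (\<Sum>n. ?v n))"
    using exp_terms_abs[of "\<alpha> * x" y] even_terms_abs[OF assms, of y]
    by (intro Cauchy_product_sums) (auto simp: sums_iff)
  also have "(\<Sum>n. ?u n) * (\<Sum>n. ?v n) = exp (\<bar>\<alpha> * x * y\<bar> + \<beta> * y\<^sup>2)"
    using exp_terms_abs[of "\<alpha> * x" y] even_terms_abs[OF assms, of y] by (simp add: sums_iff exp_add)
  finally have s: "(\<lambda>k. \<Sum>i\<le>k. ?u i * ?v (k - i)) sums exp (\<bar>\<alpha> * x * y\<bar> + \<beta> * y\<^sup>2)" .
  have "(\<Sum>a<n. \<bar>poly (gen_poly \<alpha> \<beta> a) x * y ^ a\<bar>) \<le> (\<Sum>a<n. \<Sum>i\<le>a. ?u i * ?v (a - i))"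
    unfolding poly_gen_poly by (intro sum_mono order_trans[OF sum_abs]) (simp add: abs_mult)
  also have "\<dots> \<le> exp (\<bar>\<alpha> * x * y\<bar> + \<beta> * y\<^sup>2)"
    using s by (intro sum_le_suminf[of _ "{..<n}", THEN order_trans]) (auto simp: sums_iff intro!: sum_nonneg)
  finally show ?thesis .
qed

text \<open>The coefficient of \<open>y ^ a\<close> in
  \<open>exp (y\<^sup>2 / 2) * heat_kernel d y x\<close>; the parameter
  \<open>(1 - d) / (2 * d)\<close> is what completes the square. The factor
  \<open>exp (y\<^sup>2 / 2)\<close> is chosen because at time 1 it leaves a pure exponential
  \<open>exp (w * y)\<close> up to a function of \<open>w\<close>, hence monomials.\<close>

definition gamma_fun :: "real \<Rightarrow> nat \<Rightarrow> real \<Rightarrow> real" where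
  "gamma_fun d a x = poly (gen_poly (1 / d) ((1 - d) / (2 * d)) a) x * heat_kernel d 0 x"

text \<open>Absolute values turn the generating exponent into one in the absolute value of
  \<open>x * y\<close>, which is covered by two Gaussians, centred at \<open>y\<close> and
  \<open>- y\<close>.\<close>

definition gamma_dom :: "real \<Rightarrow> real \<Rightarrow> real \<Rightarrow> real" where
  "gamma_dom d y x = exp (y\<^sup>2 / d) * (heat_kernel d y x + heat_kernel d (- y) x)"

definition gamma_heat :: "real \<Rightarrow> real \<Rightarrow> nat \<Rightarrow> real \<Rightarrow> real" where
  "gamma_heat d t a z = (LINT x|lborel. gamma_fun d a x * heat_kernel t x z)"

lemma borel_measurable_gamma_fun [measurable]: "gamma_fun d a \<in> borel_measurable borel"
proof -
  have [measurable]: "poly p \<in> borel_measurable borel" for p :: "real poly"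
    by (intro borel_measurable_continuous_onI continuous_intros)
  show ?thesis unfolding gamma_fun_def by measurable
qed

lemma borel_measurable_gamma_heat [measurable]: "gamma_heat d t a \<in> borel_measurable borel"
  unfolding gamma_heat_def by measurable

section \<open>One-particle pairings through their generating functions\<close>

context
  fixes d :: real
  assumes d: "0 < d" "d < 1"
begin

lemma beta_nonneg: "(1 - d) / (2 * d) \<ge> 0" using d by simp

lemma gamma_fun_sums: "(\<lambda>a. gamma_fun d a x * y ^ a) sums (exp (y\<^sup>2 / 2) * heat_kernel d y x)"
proof -
  have "(\<lambda>a. poly (gen_poly (1 / d) ((1 - d) / (2 * d)) a) x * y ^ a * heat_kernel d 0 x) sums
     (exp (1 / d * x * y - (1 - d) / (2 * d) * y\<^sup>2) * heat_kernel d 0 x)"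
    by (intro sums_mult2 gen_poly_sums beta_nonneg)
  also have "exp (1 / d * x * y - (1 - d) / (2 * d) * y\<^sup>2) * heat_kernel d 0 x = exp (y\<^sup>2 / 2) * heat_kernel d y x"
  proof -
    have "1 / d * x * y - (1 - d) / (2 * d) * y\<^sup>2 + - (0 - x)\<^sup>2 / (2 * d) = y\<^sup>2 / 2 + - (y - x)\<^sup>2 / (2 * d)"
      using d by (simp add: field_simps power2_eq_square)
    then show ?thesis unfolding heat_kernel_def by (simp add: times_divide_eq_right flip: exp_add)
  qed
  finally show ?thesis by (simp add: gamma_fun_def mult_ac)
qed

lemma exp_abs_heat_kernel_le:
  "exp (\<bar>1 / d * x * y\<bar> + (1 - d) / (2 * d) * y\<^sup>2) * heat_kernel d 0 x \<le> gamma_dom d y x"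
proof -
  have e: "exp (s * (1 / d * x * y) + (1 - d) / (2 * d) * y\<^sup>2) * heat_kernel d 0 x \<le> exp (y\<^sup>2 / d) * heat_kernel d (s * y) x"
    if "s = 1 \<or> s = -1" for s
  proof -
    have s2: "s\<^sup>2 = 1" using that by auto
    have "s * (1 / d * x * y) + (1 - d) / (2 * d) * y\<^sup>2 + - (0 - x)\<^sup>2 / (2 * d) = (y\<^sup>2 / d - y\<^sup>2 / 2) + - (s * y - x)\<^sup>2 / (2 * d)"
      using d s2 by (simp add: field_simps power2_eq_square)
    also have "\<dots> \<le> y\<^sup>2 / d + - (s * y - x)\<^sup>2 / (2 * d)" by simp
    finally have "exp (s * (1 / d * x * y) + (1 - d) / (2 * d) * y\<^sup>2) * exp (- (0 - x)\<^sup>2 / (2 * d)) \<le> exp (y\<^sup>2 / d) * exp (- (s * y - x)\<^sup>2 / (2 * d))"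
      by (simp flip: exp_add)
    then show ?thesis unfolding heat_kernel_def times_divide_eq_right by (intro divide_right_mono) (use d in auto)
  qed
  define q where "q = 1 / d * x * y"
  define s :: real where "s = (if q \<ge> 0 then 1 else -1)"
  have "\<bar>q\<bar> = s * q" by (simp add: s_def)
  then have "\<bar>1 / d * x * y\<bar> = s * (1 / d * x * y)" by (simp only: q_def)
  then have "exp (\<bar>1 / d * x * y\<bar> + (1 - d) / (2 * d) * y\<^sup>2) * heat_kernel d 0 x \<le> exp (y\<^sup>2 / d) * heat_kernel d (s * y) x"
    using e[of s] by (simp only: s_def) (simp split: if_splits)
  also have "\<dots> \<le> gamma_dom d y x"
    unfolding gamma_dom_def using d by (intro mult_left_mono) (auto simp: s_def)
  finally show ?thesis .
qed

lemma gamma_fun_partial_sums_le: "(\<Sum>a<n. \<bar>gamma_fun d a x * y ^ a\<bar>) \<le> gamma_dom d y x"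
proof -
  have "(\<Sum>a<n. \<bar>gamma_fun d a x * y ^ a\<bar>) = (\<Sum>a<n. \<bar>poly (gen_poly (1 / d) ((1 - d) / (2 * d)) a) x * y ^ a\<bar>) * heat_kernel d 0 x"
    unfolding sum_distrib_right using d by (intro sum.cong refl) (simp add: gamma_fun_def abs_mult)
  also have "\<dots> \<le> exp (\<bar>1 / d * x * y\<bar> + (1 - d) / (2 * d) * y\<^sup>2) * heat_kernel d 0 x"
    using d by (intro mult_right_mono gen_poly_sum_abs_le beta_nonneg) auto
  also have "\<dots> \<le> gamma_dom d y x" by (rule exp_abs_heat_kernel_le)
  finally show ?thesis .
qed

text \<open>A Cauchy estimate: one term of the series is at most the bound for the whole. The radius
  \<open>y\<close> stays free and is tuned later against the tails.\<close>

lemma gamma_fun_le: "y > 0 \<Longrightarrow> \<bar>gamma_fun d a x\<bar> \<le> gamma_dom d y x / y ^ a"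
proof -
  assume y: "y > 0"
  have "\<bar>gamma_fun d a x * y ^ a\<bar> \<le> (\<Sum>i<Suc a. \<bar>gamma_fun d i x * y ^ i\<bar>)"
    by (intro member_le_sum) auto
  also have "\<dots> \<le> gamma_dom d y x" by (rule gamma_fun_partial_sums_le)
  finally show ?thesis using y by (simp add: abs_mult pos_le_divide_eq)
qed

lemma integrable_gamma_dom: "integrable lborel (gamma_dom d y)"
  unfolding gamma_dom_def using d
  by (intro integrable_mult_right Bochner_Integration.integrable_add integrable_heat_kernel)

lemma integral_gamma_dom: "(LINT x|lborel. gamma_dom d y x) = 2 * exp (y\<^sup>2 / d)"
  unfolding gamma_dom_def using d by (simp add: integrable_heat_kernel integral_heat_kernel)

lemma integrable_gamma_fun: "integrable lborel (gamma_fun d a)"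
proof (rule Bochner_Integration.integrable_bound[OF integrable_gamma_dom[of 1]])
  show "AE x in lborel. norm (gamma_fun d a x) \<le> norm (gamma_dom d 1 x)"
    using gamma_fun_le[of 1] by (auto intro!: AE_I2 order_trans[OF _ abs_ge_self])
qed simp

lemma gamma_fun_bounded: "\<exists>C. \<forall>x. \<bar>gamma_fun d a x\<bar> \<le> C"
proof (intro exI allI)
  fix x
  have "\<bar>gamma_fun d a x\<bar> \<le> gamma_dom d 1 x" using gamma_fun_le[of 1 a x] by simp
  also have "\<dots> \<le> exp (1\<^sup>2 / d) * (1 / sqrt (2 * pi * d) + 1 / sqrt (2 * pi * d))"
    unfolding gamma_dom_def using d by (intro mult_left_mono add_mono heat_kernel_le) auto
  finally show "\<bar>gamma_fun d a x\<bar> \<le> exp (1\<^sup>2 / d) * (1 / sqrt (2 * pi * d) + 1 / sqrt (2 * pi * d))" .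
qed

lemma integrable_gamma_fun_mult:
  assumes [measurable]: "w \<in> borel_measurable borel" and w: "\<And>x. \<bar>w x\<bar> \<le> W"
  shows "integrable lborel (\<lambda>x. gamma_fun d a x * w x)"
proof (rule Bochner_Integration.integrable_bound[OF integrable_mult_right[OF integrable_gamma_fun[of a], of W]])
  have "\<bar>w x\<bar> * \<bar>gamma_fun d a x\<bar> \<le> \<bar>W\<bar> * \<bar>gamma_fun d a x\<bar>" for x
    using order_trans[OF w[of x] abs_ge_self] by (intro mult_right_mono) auto
  then show "AE x in lborel. norm (gamma_fun d a x * w x) \<le> norm (W * gamma_fun d a x)"
    by (simp add: abs_mult mult.commute)
qed simp

text \<open>Dominated convergence with \<open>gamma_dom\<close> moves the series under the integral:
  the generating function of pairings with \<open>w\<close> is the heat flow of \<open>w\<close> for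
  time \<open>d\<close>, up to the Gaussian factor.\<close>

lemma gamma_integral_sums:
  assumes [measurable]: "w \<in> borel_measurable borel" and w: "\<And>x. \<bar>w x\<bar> \<le> W"
  shows "(\<lambda>a. (LINT x|lborel. gamma_fun d a x * w x) * y ^ a) sums (exp (y\<^sup>2 / 2) * (LINT x|lborel. heat_kernel d y x * w x))"
proof -
  have "(\<lambda>n. LINT x|lborel. (\<Sum>a<n. gamma_fun d a x * y ^ a) * w x) \<longlonglongrightarrow> (LINT x|lborel. exp (y\<^sup>2 / 2) * heat_kernel d y x * w x)"
  proof (rule integral_dominated_convergence[where w = "\<lambda>x. gamma_dom d y x * W"])
    show "integrable lborel (\<lambda>x. gamma_dom d y x * W)" by (intro integrable_mult_left integrable_gamma_dom)
    show "AE x in lborel. (\<lambda>n. (\<Sum>a<n. gamma_fun d a x * y ^ a) * w x) \<longlonglongrightarrow> exp (y\<^sup>2 / 2) * heat_kernel d y x * w x"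
      using gamma_fun_sums by (auto simp: sums_def intro!: tendsto_mult_right)
    show "AE x in lborel. norm ((\<Sum>a<n. gamma_fun d a x * y ^ a) * w x) \<le> gamma_dom d y x * W" for n
    proof (rule AE_I2)
      fix x
      have "\<bar>\<Sum>a<n. gamma_fun d a x * y ^ a\<bar> \<le> gamma_dom d y x"
        by (rule order_trans[OF sum_abs gamma_fun_partial_sums_le])
      moreover from this have "0 \<le> gamma_dom d y x" by linarith
      ultimately show "norm ((\<Sum>a<n. gamma_fun d a x * y ^ a) * w x) \<le> gamma_dom d y x * W"
        using w[of x] by (auto simp: abs_mult intro!: mult_mono)
    qed
  qed measurable
  moreover have "(LINT x|lborel. (\<Sum>a<n. gamma_fun d a x * y ^ a) * w x) = (\<Sum>a<n. (LINT x|lborel. gamma_fun d a x * w x) * y ^ a)" for n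
  proof -
    have "(LINT x|lborel. (\<Sum>a<n. gamma_fun d a x * y ^ a) * w x) = (LINT x|lborel. (\<Sum>a<n. (gamma_fun d a x * w x) * y ^ a))"
      by (intro Bochner_Integration.integral_cong refl, subst sum_distrib_right, intro sum.cong refl) simp
    also have "\<dots> = (\<Sum>a<n. LINT x|lborel. (gamma_fun d a x * w x) * y ^ a)"
      by (intro Bochner_Integration.integral_sum integrable_mult_left integrable_gamma_fun_mult[OF assms])
    finally show ?thesis by simp
  qed
  ultimately show ?thesis by (simp add: sums_def mult.assoc)
qed

lemma gamma_heat_sums:
  assumes "t > 0"
  shows "(\<lambda>a. (LINT x|lborel. gamma_fun d a x * heat_kernel t x z) * y ^ a) sums (exp (y\<^sup>2 / 2) * heat_kernel (d + t) y z)"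
  using gamma_integral_sums[of "\<lambda>x. heat_kernel t x z" "1 / sqrt (2 * pi * t)" y] assms heat_kernel_le[OF assms] d
  by (simp add: heat_kernel_semigroup abs_of_nonneg)

lemma gamma_heat_bounded:
  assumes t: "t > 0" shows "\<exists>C. \<forall>z. \<bar>gamma_heat d t a z\<bar> \<le> C"
proof -
  obtain C where C: "\<And>x. \<bar>gamma_fun d a x\<bar> \<le> C" using gamma_fun_bounded by blast
  have "\<bar>gamma_heat d t a z\<bar> \<le> C" for z
  proof -
    have "\<bar>gamma_heat d t a z\<bar> \<le> (LINT x|lborel. \<bar>gamma_fun d a x * heat_kernel t x z\<bar>)"
      unfolding gamma_heat_def by (rule integral_abs_bound)
    also have "\<dots> \<le> (LINT x|lborel. C * heat_kernel t x z)"
      using C t by (intro integral_mono integrable_abs integrable_mult_heat_kernel integrable_gamma_fun integrable_mult_right integrable_heat_kernel')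
        (auto simp: abs_mult intro!: mult_right_mono)
    finally show ?thesis using t by (simp add: integral_heat_kernel')
  qed
  then show ?thesis by blast
qed

text \<open>The previous principle with \<open>gamma_heat\<close> as weight: summing over
  \<open>b\<close> runs the flow for a further time \<open>d\<close> and evaluates it at
  \<open>z\<close>. Reflecting the weight replaces the evaluation point by
  \<open>2 * m - z\<close>.\<close>

lemma gamma_pair_sums:
  assumes "t > 0"
  shows "(\<lambda>b. (LINT x|lborel. gamma_fun d b x * gamma_heat d t a x) * z ^ b) sums (exp (z\<^sup>2 / 2) * gamma_heat d (t + d) a z)"
    and "(\<lambda>b. (LINT x|lborel. gamma_fun d b x * gamma_heat d t a (2 * m - x)) * z ^ b) sums (exp (z\<^sup>2 / 2) * gamma_heat d (t + d) a (2 * m - z))"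
proof -
  obtain C where C: "\<And>z. \<bar>gamma_heat d t a z\<bar> \<le> C" using gamma_heat_bounded[OF assms] by blast
  have e: "(LINT x|lborel. heat_kernel d z x * gamma_heat d t a x) = gamma_heat d (t + d) a z" for z
    using heat_kernel_convolve[OF assms d(1) integrable_gamma_fun, of a z]
    by (simp add: gamma_heat_def mult.commute heat_kernel_sym[of d z])
  show "(\<lambda>b. (LINT x|lborel. gamma_fun d b x * gamma_heat d t a x) * z ^ b) sums (exp (z\<^sup>2 / 2) * gamma_heat d (t + d) a z)"
    using gamma_integral_sums[of "gamma_heat d t a" C z] C e[of z] by simp
  have "(LINT x|lborel. heat_kernel d z x * gamma_heat d t a (2 * m - x)) = (LINT x|lborel. heat_kernel d z (2 * m - x) * gamma_heat d t a x)"
    using lborel_integral_real_affine[of "-1" "\<lambda>x. heat_kernel d z (2 * m - x) * gamma_heat d t a x" "2 * m"] by simp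
  also have "\<dots> = gamma_heat d (t + d) a (2 * m - z)"
    using e[of "2 * m - z"] heat_kernel_reflect[of d m z] by simp
  finally show "(\<lambda>b. (LINT x|lborel. gamma_fun d b x * gamma_heat d t a (2 * m - x)) * z ^ b) sums (exp (z\<^sup>2 / 2) * gamma_heat d (t + d) a (2 * m - z))"
    using gamma_integral_sums[of "\<lambda>x. gamma_heat d t a (2 * m - x)" C z] C by simp
qed

text \<open>At total time 1 the generating function in the index \<open>a\<close> is explicit and
  equals a Gaussian in the evaluation point times \<open>exp (w * y)\<close>; comparing coefficients
  gives monomials.\<close>

lemma gamma_heat_total:
  assumes "t + d = 1" "t > 0"
  shows "exp (z\<^sup>2 / 2) * gamma_heat d t a z = z ^ a / fact a / sqrt (2 * pi)"
    and "exp (z\<^sup>2 / 2) * gamma_heat d t a (2 * m - z) = exp (2 * m * z - 2 * m\<^sup>2) * (2 * m - z) ^ a / fact a / sqrt (2 * pi)"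
proof -
  have s: "(\<lambda>a. gamma_heat d t a w * y ^ a) sums (exp (y\<^sup>2 / 2) * heat_kernel 1 y w)" for y w
    using gamma_heat_sums[OF assms(2), of w y] assms(1) by (simp add: gamma_heat_def add.commute)
  have "exp (y\<^sup>2 / 2) * heat_kernel 1 y w = exp (- w\<^sup>2 / 2) / sqrt (2 * pi) * exp (w * y)" for y w
  proof -
    have "y\<^sup>2 / 2 + - (y - w)\<^sup>2 / 2 = - w\<^sup>2 / 2 + w * y" by (simp add: power2_eq_square field_simps)
    then show ?thesis unfolding heat_kernel_def by (simp flip: exp_add)
  qed
  then have s2: "(\<lambda>a. (exp (- w\<^sup>2 / 2) / sqrt (2 * pi) * (w ^ a / fact a)) * y ^ a) sums (exp (y\<^sup>2 / 2) * heat_kernel 1 y w)" for y w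
    using sums_mult[OF exp_sums_real[of w y], of "exp (- w\<^sup>2 / 2) / sqrt (2 * pi)"] by (simp add: mult.assoc)
  have g: "gamma_heat d t a w = exp (- w\<^sup>2 / 2) / sqrt (2 * pi) * (w ^ a / fact a)" for w
    by (rule real_power_series_unique[OF s s2])
  show "exp (z\<^sup>2 / 2) * gamma_heat d t a z = z ^ a / fact a / sqrt (2 * pi)"
    unfolding g by (simp add: exp_minus field_simps)
  have "z\<^sup>2 / 2 + - (2 * m - z)\<^sup>2 / 2 = 2 * m * z - 2 * m\<^sup>2" by (simp add: power2_eq_square field_simps)
  then have "exp (z\<^sup>2 / 2) * exp (- (2 * m - z)\<^sup>2 / 2) = exp (2 * m * z - 2 * m\<^sup>2)" by (simp flip: exp_add)
  then show "exp (z\<^sup>2 / 2) * gamma_heat d t a (2 * m - z) = exp (2 * m * z - 2 * m\<^sup>2) * (2 * m - z) ^ a / fact a / sqrt (2 * pi)"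
    unfolding g by (simp add: field_simps)
qed

text \<open>Both end functions contribute time \<open>d\<close> and the flow between them
  \<open>t\<close>, so the total time is 1 and the generating function in \<open>z\<close> is a
  single monomial. Nothing depends on \<open>d\<close> any more.\<close>

lemma gamma_pair_diagonal:
  assumes "t + 2 * d = 1" "t > 0"
  shows "(LINT x|lborel. gamma_fun d b x * gamma_heat d t a x) = (if a = b then 1 / fact a / sqrt (2 * pi) else 0)"
proof (rule real_power_series_unique[where a = "\<lambda>b. LINT x|lborel. gamma_fun d b x * gamma_heat d t a x"
      and b = "\<lambda>b. if a = b then 1 / fact a / sqrt (2 * pi) else 0" and f = "\<lambda>z. z ^ a / fact a / sqrt (2 * pi)"])
  fix z
  show "(\<lambda>b. (LINT x|lborel. gamma_fun d b x * gamma_heat d t a x) * z ^ b) sums (z ^ a / fact a / sqrt (2 * pi))"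
    using gamma_pair_sums(1)[OF assms(2), of a z] gamma_heat_total(1)[of "t + d" z a] assms d by simp
  have "(\<lambda>b. if b = a then z ^ b / fact a / sqrt (2 * pi) else 0) sums (z ^ a / fact a / sqrt (2 * pi))"
    by (rule sums_single)
  then show "(\<lambda>b. (if a = b then 1 / fact a / sqrt (2 * pi) else 0) * z ^ b) sums (z ^ a / fact a / sqrt (2 * pi))"
    by (rule sums_cong[THEN iffD1, rotated]) auto
qed

lemma gamma_pair_reflected_sums:
  assumes "t + 2 * d = 1" "t > 0"
  shows "(\<lambda>b. (LINT x|lborel. gamma_fun d b x * gamma_heat d t a (2 * m - x)) * z ^ b) sums
     (exp (2 * m * z - 2 * m\<^sup>2) * (2 * m - z) ^ a / fact a / sqrt (2 * pi))"
  using gamma_pair_sums(2)[OF assms(2), of a m z] gamma_heat_total(2)[of "t + d" z a m] assms d by simp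

end

section \<open>Non-intersecting bridges on a time grid\<close>

lemma sdet_diagonal:
  assumes fin: "finite S"
  shows "sdet S (\<lambda>a b. if a = b then c a else 0) = (\<Prod>a\<in>S. c a :: real)"
proof -
  have "sdet S (\<lambda>a b. if a = b then c a else 0) = sdet S (\<lambda>a b. c a * ((if a = b then 1 else 0) + 0))"
    by (rule sdet_cong) auto
  also have "\<dots> = (\<Prod>a\<in>S. c a) * (\<Sum>T\<in>Pow S. sdet T (\<lambda>_ _. 0))"
    by (subst sdet_mult_rows[OF fin], subst sdet_one_plus[OF fin]) simp
  also have "(\<Sum>T\<in>Pow S. sdet T (\<lambda>_ _. 0)) = (\<Sum>T\<in>Pow S. if T = {} then 1 else 0 :: real)"
    using fin by (intro sum.cong refl) (auto simp: sdet_def prod_zero finite_subset intro!: sum.neutral)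
  finally show ?thesis using fin by simp
qed

lemma bij_Suc_lessThan: "bij_betw Suc {..<N} {1..N}"
  by (auto simp: bij_betw_def image_Suc_lessThan)

lemma vandermonde_eq_sdet:
  assumes "\<And>a. a < N \<Longrightarrow> degree (g a) \<le> a"
  shows "sdet {1..N} (\<lambda>a i. poly (g (a - 1)) (y i)) = (\<Prod>a<N. coeff (g a) a) * vandermonde N y"
proof -
  have "sdet {1..N} (\<lambda>a i. poly (g (a - 1)) (y i)) = sdet {..<N} (\<lambda>a i. poly (g a) (y (Suc i)))"
    using sdet_reindex[OF bij_Suc_lessThan, of N "\<lambda>a i. poly (g (a - 1)) (y i)"] by simp
  also have "\<dots> = (\<Prod>a<N. coeff (g a) a) * (\<Prod>j<N. \<Prod>i<j. y (Suc j) - y (Suc i))"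
    by (rule sdet_poly_vandermonde) (rule assms)
  also have "(\<Prod>j<N. \<Prod>i<j. y (Suc j) - y (Suc i)) = vandermonde N y"
  proof -
    have "(\<Prod>i\<in>{1..<Suc j}. y (Suc j) - y i) = (\<Prod>i<j. y (Suc j) - y (Suc i))" for j
      using prod.reindex_bij_betw[OF bij_Suc_lessThan, of "\<lambda>i. y (Suc j) - y i" j]
      by (simp add: atLeastLessThanSuc_atLeastAtMost)
    then show ?thesis
      unfolding vandermonde_def using prod.reindex_bij_betw[OF bij_Suc_lessThan, of "\<lambda>j. \<Prod>i\<in>{1..<j}. y j - y i" N]
      by simp
  qed
  finally show ?thesis .
qed

text \<open>The polynomial with index \<open>a\<close> has degree at most \<open>a\<close>, so only
  its coefficient there matters. The result is the Vandermonde-Gaussian factor of the bridge density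
  at an end time; rows start at 1, polynomials at 0.\<close>

lemma sdet_gamma_fun:
  "sdet {1..N} (\<lambda>a i. gamma_fun d (a - 1) (y i)) =
    (\<Prod>a<N. (1 / d) ^ a / fact a) * (1 / sqrt (2 * pi * d)) ^ N * (vandermonde N y * (\<Prod>i\<in>{1..N}. exp (- (y i)\<^sup>2 / (2 * d))))"
proof -
  have "sdet {1..N} (\<lambda>a i. gamma_fun d (a - 1) (y i)) =
     sdet {1..N} (\<lambda>a i. poly (gen_poly (1 / d) ((1 - d) / (2 * d)) (a - 1)) (y i)) * (\<Prod>i\<in>{1..N}. heat_kernel d 0 (y i))"
    unfolding gamma_fun_def by (rule sdet_mult_columns) simp
  moreover have "(\<Prod>i\<in>{1..N}. heat_kernel d 0 (y i)) = (1 / sqrt (2 * pi * d)) ^ N * (\<Prod>i\<in>{1..N}. exp (- (y i)\<^sup>2 / (2 * d)))"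
  proof -
    have "heat_kernel d 0 z = (1 / sqrt (2 * pi * d)) * exp (- z\<^sup>2 / (2 * d))" for z
      by (simp add: heat_kernel_def)
    then show ?thesis by (simp only: prod.distrib prod_constant card_atLeastAtMost) simp
  qed
  ultimately show ?thesis
    using vandermonde_eq_sdet[of N "gen_poly (1 / d) ((1 - d) / (2 * d))" y] degree_gen_poly
    by (simp add: coeff_gen_poly)
qed

lemma det_heat_kernel_eq_sdet:
  "Determinant.det (Matrix.mat N N (\<lambda>(a, b). heat_kernel s (u (Suc a)) (v (Suc b)))) = sdet {1..N} (\<lambda>a b. heat_kernel s (u a) (v b))"
  using sdet_reindex[OF bij_Suc_lessThan, of N "\<lambda>a b. heat_kernel s (u a) (v b)"]
  by (simp add: det_mat_eq_sdet)

text \<open>Splitting off the two Gaussian factors leaves \<open>exp (x * y / s)\<close>, whose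
  determinants are positive at ordered points.\<close>

lemma sdet_heat_kernel_pos:
  fixes N :: nat
  assumes s: "s > 0" and u: "strict_mono_on {1..N} u" and v: "strict_mono_on {1..N} v"
  shows "sdet {1..N} (\<lambda>a b. heat_kernel s (u a) (v b)) > 0"
proof -
  have "heat_kernel s x y = (exp (- x\<^sup>2 / (2 * s)) / sqrt (2 * pi * s)) * (exp (x / s * y) * exp (- y\<^sup>2 / (2 * s)))" for x y
  proof -
    have "- (x - y)\<^sup>2 / (2 * s) = - x\<^sup>2 / (2 * s) + (x / s * y + - y\<^sup>2 / (2 * s))"
      using s by (simp add: power2_eq_square field_simps)
    then show ?thesis unfolding heat_kernel_def by (simp flip: exp_add)
  qed
  then have "sdet {1..N} (\<lambda>a b. heat_kernel s (u a) (v b)) =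
     sdet {1..N} (\<lambda>a b. (exp (- (u a)\<^sup>2 / (2 * s)) / sqrt (2 * pi * s)) * (exp (u a / s * v b) * exp (- (v b)\<^sup>2 / (2 * s))))"
    by (intro sdet_cong) blast
  also have "\<dots> = (\<Prod>i\<in>{1..N}. exp (- (u i)\<^sup>2 / (2 * s)) / sqrt (2 * pi * s)) * sdet {1..N} (\<lambda>a b. exp (u a / s * v b) * exp (- (v b)\<^sup>2 / (2 * s)))"
    by (rule sdet_mult_rows) simp
  also have "sdet {1..N} (\<lambda>a b. exp (u a / s * v b) * exp (- (v b)\<^sup>2 / (2 * s))) = sdet {1..N} (\<lambda>a b. exp (u a / s * v b)) * (\<Prod>i\<in>{1..N}. exp (- (v i)\<^sup>2 / (2 * s)))"
    by (rule sdet_mult_columns) simp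
  finally have "sdet {1..N} (\<lambda>a b. heat_kernel s (u a) (v b)) =
     (\<Prod>i\<in>{1..N}. exp (- (u i)\<^sup>2 / (2 * s)) / sqrt (2 * pi * s)) * (sdet {1..N} (\<lambda>a b. exp (u a / s * v b)) * (\<Prod>i\<in>{1..N}. exp (- (v i)\<^sup>2 / (2 * s))))" .
  moreover have "sdet {1..N} (\<lambda>a b. exp (u a / s * v b)) = sdet {..<N} (\<lambda>a b. exp (u (Suc a) / s * v (Suc b)))"
    using sdet_reindex[OF bij_Suc_lessThan, of N "\<lambda>a b. exp (u a / s * v b)"] by simp
  moreover have "sdet {..<N} (\<lambda>a b. exp (u (Suc a) / s * v (Suc b))) > 0"
    using u v s by (intro sdet_exp_pos) (auto simp: strict_mono_on_def divide_strict_right_mono)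
  ultimately show ?thesis using s by (simp add: prod_pos)
qed

lemma vandermonde_pos: "strict_mono_on {1..N} y \<Longrightarrow> vandermonde N y > 0"
  unfolding vandermonde_def by (intro prod_pos) (auto simp: strict_mono_on_def)

text \<open>The density is prescribed as an \<open>ennreal\<close>, which sends negative numbers to
  0; nonnegativity makes it agree with the real weight that the determinant identities
  concern.\<close>

lemma bridges_weight_nonneg:
  assumes t: "strict_mono_on {1..k} t" and k: "k \<ge> 1"
  shows "bridges_weight N k t x \<ge> 0"
proof (cases "\<forall>j\<in>{1..k}. (\<lambda>i. x (j, i)) \<in> weyl_chamber N")
  case True
  have V: "0 \<le> vandermonde N (\<lambda>i. x (j, i))" if "j \<in> {1..k}" for j
    using True that by (auto simp: weyl_chamber_def intro!: less_imp_le vandermonde_pos)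
    have "0 \<le> (\<Prod>j\<in>{1..<k}. Determinant.det (Matrix.mat N N
           (\<lambda>(a, b). heat_kernel (t (Suc j) - t j) (x (j, Suc a)) (x (Suc j, Suc b)))))"
    proof (intro prod_nonneg ballI)
      fix j assume j: "j \<in> {1..<k}"
      then have "t j < t (Suc j)" using t by (auto simp: strict_mono_on_def)
      then show "0 \<le> Determinant.det (Matrix.mat N N
           (\<lambda>(a, b). heat_kernel (t (Suc j) - t j) (x (j, Suc a)) (x (Suc j, Suc b))))"
        using sdet_heat_kernel_pos[of "t (Suc j) - t j" N "\<lambda>i. x (j, i)" "\<lambda>i. x (Suc j, i)"] True j
        by (simp add: det_heat_kernel_eq_sdet[of N _ "\<lambda>i. x (j, i)" "\<lambda>i. x (Suc j, i)"] weyl_chamber_def)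
    qed
    then show ?thesis
      unfolding bridges_weight_def using V[of 1] V[of k] k by (auto intro!: mult_nonneg_nonneg prod_nonneg)
qed (auto simp: bridges_weight_def)

lemma prod_indicator_all:
  "finite A \<Longrightarrow> (\<Prod>p\<in>A. indicator {..m} (f p)) = (of_bool (\<forall>p\<in>A. f p \<le> m) :: real)"
  by (induction A rule: finite_induct) auto

lemma prod_shift_first:
  fixes f :: "nat \<Rightarrow> 'b :: comm_monoid_mult"
  shows "(\<Prod>j\<in>{1..<Suc n}. f (Suc j)) * f 1 = (\<Prod>j\<in>{1..Suc n}. f j)"
proof -
  have "{1..Suc n} = insert 1 (Suc ` {1..<Suc n})" by (auto simp: image_Suc_atLeastLessThan)
  then have "(\<Prod>j\<in>{1..Suc n}. f j) = f 1 * (\<Prod>j\<in>Suc ` {1..<Suc n}. f j)"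
    by (simp only:) (rule prod.insert, auto)
  moreover have "(\<Prod>j\<in>Suc ` {1..<Suc n}. f j) = (\<Prod>j\<in>{1..<Suc n}. f (Suc j))"
    using prod.reindex[of Suc "{1..<Suc n}" f] by (simp only: o_def inj_on_def) simp
  ultimately show ?thesis by (metis mult.commute)
qed

text \<open>The grid keeps distance \<open>d\<close> from the pinned ends. \<open>n\<close> counts
  steps, so there are \<open>Suc n\<close> times, numbered from 1.\<close>

locale bridge_grid =
  fixes d m :: real and N n :: nat
  assumes d: "0 < d" "d < 1 / 2" and n: "n \<ge> 1"
begin

definition "step = (1 - 2 * d) / real n"
definition "time j = d + (real j - 1) * step"

lemma step_pos: "step > 0" using d n by (simp add: step_def)

lemma step_total: "real n * step = 1 - 2 * d" using n by (simp add: step_def)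

lemma time_Suc: "time (Suc j) - time j = step" by (simp add: time_def algebra_simps)

lemma time_1: "time 1 = d" "time (Suc 0) = d" by (simp_all add: time_def)

lemma time_last: "time (Suc n) = 1 - d" using step_total by (simp add: time_def)

lemma time_mono: "strict_mono_on {1..Suc n} time"
  using step_pos by (auto simp: strict_mono_on_def time_def)

lemma time_range: "time ` {1..Suc n} \<subseteq> {0<..<1}"
proof safe
  fix j assume j: "j \<in> {1..Suc n}"
  have "0 \<le> (real j - 1) * step" using j step_pos by simp
  moreover have "(real j - 1) * step \<le> real n * step" using j step_pos by (intro mult_right_mono) auto
  ultimately show "time j \<in> {0<..<1}" using d step_total by (auto simp: time_def)
qed

text \<open>A square because the factor of \<open>sdet_gamma_fun\<close> arises at both end
  times.\<close>

definition "norm_const = ((\<Prod>a<N. (1 / d) ^ a / fact a) * (1 / sqrt (2 * pi * d)) ^ N)\<^sup>2"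

lemma norm_const_pos: "norm_const > 0"
  unfolding norm_const_def using d by (intro zero_less_power mult_pos_pos prod_pos) auto

text \<open>The indicator sits at the arrival point only; the first time is tested by
  \<open>wall_start\<close>, so every time is tested exactly once.\<close>

definition "wall_kernel j x y = heat_kernel step x y * indicator {..m} y" for j :: nat
definition "free_kernel j x y = heat_kernel step x y" for j :: nat
definition "wall_start a x = gamma_fun d (a - 1) x * indicator {..m} x"
definition "free_start a x = gamma_fun d (a - 1) x"

lemma free_weight:
  "chain_weight N (Suc n) free_start free_kernel x * sdet {1..N} (\<lambda>b i. gamma_fun d (b - 1) (x (Suc n, i))) = norm_const * bridges_weight N (Suc n) time x"
proof -
  have "(\<Prod>j\<in>{1..<Suc n}. sdet {1..N} (\<lambda>a b. heat_kernel step (x (j, a)) (x (Suc j, b))))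
      = (\<Prod>j\<in>{1..<Suc n}. Determinant.det (Matrix.mat N N (\<lambda>(a, b). heat_kernel (time (Suc j) - time j) (x (j, Suc a)) (x (Suc j, Suc b)))))"
    by (simp add: time_Suc det_heat_kernel_eq_sdet[of N step "\<lambda>a. x (_, a)" "\<lambda>b. x (_, b)"])
  then show ?thesis
    unfolding chain_weight_def bridges_weight_def free_kernel_def free_start_def sdet_gamma_fun norm_const_def weyl_chamber_def time_1 time_last
    by (auto simp: power2_eq_square mult_ac)
qed

text \<open>The indicators depend on the column index alone and come out of each determinant;
  collected over all times they form the indicator of the event.\<close>

lemma wall_weight:
  "chain_weight N (Suc n) wall_start wall_kernel x * sdet {1..N} (\<lambda>b i. gamma_fun d (b - 1) (x (Suc n, i))) =
   of_bool (\<forall>p\<in>{1..Suc n} \<times> {1..N}. x p \<le> m) * (norm_const * bridges_weight N (Suc n) time x)"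
proof -
  let ?ind = "\<lambda>j. \<Prod>i\<in>{1..N}. indicator {..m} (x (j, i)) :: real"
  have "(\<Prod>j\<in>{1..<Suc n}. ?ind (Suc j)) * ?ind 1 = (\<Prod>j\<in>{1..Suc n}. ?ind j)"
    by (rule prod_shift_first)
  also have "\<dots> = (\<Prod>p\<in>{1..Suc n} \<times> {1..N}. indicator {..m} (x p))"
    by (subst prod.cartesian_product) (simp add: case_prod_unfold)
  also have "\<dots> = of_bool (\<forall>p\<in>{1..Suc n} \<times> {1..N}. x p \<le> m)"
    by (rule prod_indicator_all) auto
  finally have ind: "(\<Prod>j\<in>{1..<Suc n}. ?ind (Suc j)) * ?ind 1 = of_bool (\<forall>p\<in>{1..Suc n} \<times> {1..N}. x p \<le> m)" .
  have "chain_weight N (Suc n) wall_start wall_kernel x =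
     ((\<Prod>j\<in>{1..<Suc n}. ?ind (Suc j)) * ?ind 1) * chain_weight N (Suc n) free_start free_kernel x"
  proof -
    have "sdet {1..N} (\<lambda>a i. wall_start a (x (1, i))) = sdet {1..N} (\<lambda>a i. free_start a (x (1, i))) * ?ind 1"
      unfolding wall_start_def free_start_def by (rule sdet_mult_columns) simp
    moreover have "sdet {1..N} (\<lambda>a b. wall_kernel j (x (j, a)) (x (Suc j, b))) = sdet {1..N} (\<lambda>a b. free_kernel j (x (j, a)) (x (Suc j, b))) * ?ind (Suc j)" for j
      unfolding wall_kernel_def free_kernel_def by (rule sdet_mult_columns) simp
    ultimately show ?thesis
      unfolding chain_weight_def by (simp only: prod.distrib mult_ac)
  qed
  then show ?thesis unfolding ind using free_weight[of x] by (simp add: mult_ac)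
qed

lemma evolve_wall: "evolve wall_kernel wall_start j a = killed m step (wall_start a) j"
  by (induction j) (simp_all add: wall_kernel_def)

lemma integrable_start: "integrable lborel (free_start a)" "integrable lborel (wall_start a)"
proof -
  show "integrable lborel (free_start a)"
    unfolding free_start_def using d by (intro integrable_gamma_fun) auto
  show "integrable lborel (wall_start a)"
    unfolding wall_start_def using d by (intro integrable_gamma_fun_mult[where W = 1]) (auto simp: indicator_def)
qed

lemma evolve_free: "evolve free_kernel free_start (Suc j) a y = gamma_heat d (real (Suc j) * step) (a - 1) y"
proof (induction j arbitrary: y)
  case 0
  show ?case by (simp add: free_kernel_def free_start_def gamma_heat_def)
next
  case (Suc j)
  have "evolve free_kernel free_start (Suc (Suc j)) a y = (LINT x|lborel. gamma_heat d (real (Suc j) * step) (a - 1) x * heat_kernel step x y)"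
    by (subst evolve.simps(2)) (simp only: Suc.IH free_kernel_def)
  also have "\<dots> = gamma_heat d (real (Suc j) * step + step) (a - 1) y"
    unfolding gamma_heat_def using d step_pos by (intro heat_kernel_convolve integrable_gamma_fun) auto
  finally show ?case by (simp add: algebra_simps)
qed

definition "wall_matrix a b = (LINT x|lborel. killed m step (wall_start a) n x * gamma_fun d (b - 1) x)"

lemma kernel_props:
  "case_prod (free_kernel j) \<in> borel_measurable (lborel \<Otimes>\<^sub>M lborel)"
  "0 \<le> free_kernel j x y" "free_kernel j x y \<le> 1 / sqrt (2 * pi * step)"
  "integrable lborel (free_kernel j x)" "(LINT y|lborel. free_kernel j x y) \<le> 1"
  "case_prod (wall_kernel j) \<in> borel_measurable (lborel \<Otimes>\<^sub>M lborel)"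
  "0 \<le> wall_kernel j x y" "wall_kernel j x y \<le> 1 / sqrt (2 * pi * step)"
  "integrable lborel (wall_kernel j x)" "(LINT y|lborel. wall_kernel j x y) \<le> 1"
proof -
  note s = step_pos
  show "case_prod (free_kernel j) \<in> borel_measurable (lborel \<Otimes>\<^sub>M lborel)"
    "case_prod (wall_kernel j) \<in> borel_measurable (lborel \<Otimes>\<^sub>M lborel)"
    unfolding free_kernel_def wall_kernel_def by measurable
  show "0 \<le> free_kernel j x y" "0 \<le> wall_kernel j x y"
    using s by (auto simp: free_kernel_def wall_kernel_def)
  show 1: "free_kernel j x y \<le> 1 / sqrt (2 * pi * step)"
    unfolding free_kernel_def by (rule heat_kernel_le[OF s])
  show "wall_kernel j x y \<le> 1 / sqrt (2 * pi * step)"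
    using 1 s by (auto simp: free_kernel_def wall_kernel_def indicator_def)
  show i: "integrable lborel (free_kernel j x)"
    unfolding free_kernel_def by (rule integrable_heat_kernel[OF s])
  show w: "(LINT y|lborel. free_kernel j x y) \<le> 1"
    unfolding free_kernel_def by (simp add: integral_heat_kernel[OF s])
  have "integrable lborel (\<lambda>y. indicator {..m} y *\<^sub>R free_kernel j x y)"
    by (intro integrable_mult_indicator i) auto
  then show i': "integrable lborel (wall_kernel j x)"
    by (simp add: free_kernel_def wall_kernel_def[abs_def] mult.commute)
  have "(LINT y|lborel. wall_kernel j x y) \<le> (LINT y|lborel. free_kernel j x y)"
    by (intro integral_mono i i') (use s in \<open>auto simp: free_kernel_def wall_kernel_def indicator_def\<close>)
  with w show "(LINT y|lborel. wall_kernel j x y) \<le> 1" by simp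
qed

text \<open>Total mass and mass of the event are both chain integrals, so the unknown normalisation
  \<open>c\<close> cancels from their ratio; without the wall the pairing matrix is
  diagonal.\<close>

lemma grid_probability:
  assumes B: "nonintersecting_bridges M N B" and N: "N \<ge> 1"
  shows "measure M {\<omega> \<in> space M. \<forall>j\<in>{1..Suc n}. B N (time j) \<omega> \<le> m}
    = sdet {1..N} wall_matrix / (\<Prod>a\<in>{1..N}. 1 / fact (a - 1) / sqrt (2 * pi))"
proof -
  let ?I = "{1..Suc n} \<times> {1..N}"
  let ?P = "Pi\<^sub>M ?I (\<lambda>_. lborel :: real measure)"
  let ?X = "\<lambda>\<omega>. \<lambda>(j, i)\<in>?I. B i (time j) \<omega>"
  let ?w = "bridges_weight N (Suc n) time"
  interpret M: prob_space M using B by (simp add: nonintersecting_bridges_def)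
  from B have "\<forall>k t. 1 \<le> k \<and> strict_mono_on {1..k} t \<and> t ` {1..k} \<subseteq> {0<..<1} \<longrightarrow>
        (\<exists>c>0. distributed M (\<Pi>\<^sub>M p\<in>{1..k} \<times> {1..N}. lborel)
           (\<lambda>\<omega>. \<lambda>(j, i)\<in>{1..k} \<times> {1..N}. B i (t j) \<omega>)
           (\<lambda>x. ennreal (c * bridges_weight N k t x)))"
    unfolding nonintersecting_bridges_def by (elim conjE)
  from this[THEN spec, THEN spec, of "Suc n" time] time_mono time_range
  obtain c where c: "c > 0" and dist: "distributed M ?P ?X (\<lambda>x. ennreal (c * ?w x))"
    by auto
  have w0: "0 \<le> c * ?w x" for x using c bridges_weight_nonneg[OF time_mono le_add1[of 1 n, unfolded plus_1_eq_Suc]] by simp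
  have X: "?X \<in> M \<rightarrow>\<^sub>M ?P" using dist by (rule distributed_measurable)
  have int_w: "integrable ?P (\<lambda>x. c * ?w x)"
    using distributed_integrable[OF dist, of "\<lambda>_. 1"] w0 by simp
  have one: "(LINT x|?P. c * ?w x) = 1"
    using distributed_integral[OF dist, of "\<lambda>_. 1"] w0 by (simp add: M.prob_space)
  \<comment> \<open>Integrability of the weight is read off from its being a multiple of a
    probability density.\<close>
  have int_w': "integrable ?P (\<lambda>x. norm_const * ?w x)"
    using int_w c by simp
  define A where "A = {x \<in> space ?P. \<forall>p\<in>?I. x p \<le> m}"
  have A: "A \<in> sets ?P"
    unfolding A_def by (intro sets.sets_Collect_finite_All) auto
  have ind_A: "indicator A x = (of_bool (\<forall>p\<in>?I. x p \<le> m) :: real)" if "x \<in> space ?P" for x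
    using that by (simp add: A_def indicator_def)
  have int_A: "integrable ?P (\<lambda>x. of_bool (\<forall>p\<in>?I. x p \<le> m) * (norm_const * ?w x))"
  proof -
    have "integrable ?P (\<lambda>x. indicator A x *\<^sub>R (norm_const * ?w x))"
      by (intro integrable_mult_indicator A int_w')
    then show ?thesis
      by (rule Bochner_Integration.integrable_cong[THEN iffD1, OF refl, rotated]) (simp add: ind_A)
  qed
  have \<psi>m: "gamma_fun d (b - 1) \<in> borel_measurable borel" for b by simp
  obtain C' where C': "\<And>b x. b \<in> {1..N} \<Longrightarrow> \<bar>gamma_fun d (b - 1) x\<bar> \<le> C'"
  proof -
    have "\<exists>C. \<forall>x. \<bar>gamma_fun d b x\<bar> \<le> C" for b using gamma_fun_bounded d by simp
    then obtain C where C: "\<And>b x. \<bar>gamma_fun d b x\<bar> \<le> C b" by metis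
    have "\<bar>gamma_fun d (b - 1) x\<bar> \<le> (\<Sum>b\<in>{1..N}. \<bar>C (b - 1)\<bar>)" if "b \<in> {1..N}" for b x
      using C[of "b - 1" x] member_le_sum[OF that, of "\<lambda>b. \<bar>C (b - 1)\<bar>"] by force
    then show thesis by (rule that)
  qed
  have free: "(LINT x|?P. norm_const * ?w x) = (\<Prod>a\<in>{1..N}. 1 / fact (a - 1) / sqrt (2 * pi))"
  proof -
    have "(LINT x|?P. chain_weight N (Suc n) free_start free_kernel x * sdet {1..N} (\<lambda>b i. gamma_fun d (b - 1) (x (Suc n, i))))
      = sdet {1..N} (\<lambda>a b. LINT x|lborel. evolve free_kernel free_start n a x * gamma_fun d (b - 1) x)"
    proof (rule integral_chain_weight[where C = "\<lambda>_. 1 / sqrt (2 * pi * step)" and C' = C'])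
      show "integrable ?P (\<lambda>x. chain_weight N (Suc n) free_start free_kernel x * sdet {1..N} (\<lambda>b i. gamma_fun d (b - 1) (x (Suc n, i))))"
        unfolding free_weight by (rule int_w')
    qed ((rule integrable_start kernel_props \<psi>m) | (rule C', assumption))+
    also have "\<dots> = sdet {1..N} (\<lambda>a b. if a = b then 1 / fact (a - 1) / sqrt (2 * pi) else 0)"
    proof (rule sdet_cong)
      fix a b assume ab: "a \<in> {1..N}" "b \<in> {1..N}"
      obtain n' where n': "n = Suc n'" using n by (cases n) auto
      have "evolve free_kernel free_start n a = gamma_heat d (1 - 2 * d) (a - 1)"
        using evolve_free[of n' a] step_total unfolding n' by (auto simp: fun_eq_iff)
      then show "(LINT x|lborel. evolve free_kernel free_start n a x * gamma_fun d (b - 1) x) = (if a = b then 1 / fact (a - 1) / sqrt (2 * pi) else 0)"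
        using gamma_pair_diagonal[of d "1 - 2 * d" "b - 1" "a - 1"] ab d by (auto simp: mult.commute)
    qed
    finally show ?thesis unfolding free_weight sdet_diagonal[OF finite_atLeastAtMost] .
  qed
  have wall: "(LINT x|?P. of_bool (\<forall>p\<in>?I. x p \<le> m) * (norm_const * ?w x)) = sdet {1..N} wall_matrix"
  proof -
    have "(LINT x|?P. chain_weight N (Suc n) wall_start wall_kernel x * sdet {1..N} (\<lambda>b i. gamma_fun d (b - 1) (x (Suc n, i))))
      = sdet {1..N} (\<lambda>a b. LINT x|lborel. evolve wall_kernel wall_start n a x * gamma_fun d (b - 1) x)"
    proof (rule integral_chain_weight[where C = "\<lambda>_. 1 / sqrt (2 * pi * step)" and C' = C'])
      show "integrable ?P (\<lambda>x. chain_weight N (Suc n) wall_start wall_kernel x * sdet {1..N} (\<lambda>b i. gamma_fun d (b - 1) (x (Suc n, i))))"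
        unfolding wall_weight by (rule int_A)
    qed ((rule integrable_start kernel_props \<psi>m) | (rule C', assumption))+
    then show ?thesis unfolding wall_weight evolve_wall wall_matrix_def[abs_def] .
  qed
  \<comment> \<open>Almost surely the paths are ordered, so the top path stays below
    \<open>m\<close> exactly if all paths do, which is the event in product form.\<close>
  have "measure M {\<omega> \<in> space M. \<forall>j\<in>{1..Suc n}. B N (time j) \<omega> \<le> m} = measure M {\<omega> \<in> space M. ?X \<omega> \<in> A}"
  proof (rule M.finite_measure_eq_AE)
    have "AE \<omega> in M. \<forall>t\<in>{0<..<1}. strict_mono_on {1..N} (\<lambda>i. B i t \<omega>)"
      using B by (simp add: nonintersecting_bridges_def weyl_chamber_def)
    then show "AE \<omega> in M. \<omega> \<in> {\<omega> \<in> space M. \<forall>j\<in>{1..Suc n}. B N (time j) \<omega> \<le> m} \<longleftrightarrow> \<omega> \<in> {\<omega> \<in> space M. ?X \<omega> \<in> A}"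
    proof eventually_elim
      case (elim \<omega>)
      have "B i (time j) \<omega> \<le> B N (time j) \<omega>" if "j \<in> {1..Suc n}" "i \<in> {1..N}" for i j
      proof -
        have "time j \<in> {0<..<1}" using time_range that(1) by blast
        then have "strict_mono_on {1..N} (\<lambda>i. B i (time j) \<omega>)" using elim by blast
        from strict_mono_on_leD[OF this, of i N] that(2) show ?thesis by auto
      qed
      note le = this
      have "(\<forall>j\<in>{1..Suc n}. B N (time j) \<omega> \<le> m) \<longleftrightarrow> (\<forall>p\<in>?I. ?X \<omega> p \<le> m)"
      proof
        assume H: "\<forall>j\<in>{1..Suc n}. B N (time j) \<omega> \<le> m"
        show "\<forall>p\<in>?I. ?X \<omega> p \<le> m"
        proof
          fix p assume p: "p \<in> ?I"
          then have "B (snd p) (time (fst p)) \<omega> \<le> m"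
            using order_trans[OF le bspec[OF H]] by (simp only: mem_Times_iff)
          then show "?X \<omega> p \<le> m" using p by (simp add: case_prod_unfold)
        qed
      next
        assume H: "\<forall>p\<in>?I. ?X \<omega> p \<le> m"
        show "\<forall>j\<in>{1..Suc n}. B N (time j) \<omega> \<le> m"
        proof
          fix j assume j: "j \<in> {1..Suc n}"
          then have "?X \<omega> (j, N) \<le> m" using H N by (meson SigmaI atLeastAtMost_iff order_refl)
          then show "B N (time j) \<omega> \<le> m" using j N by simp
        qed
      qed
      moreover have "?X \<omega> \<in> space ?P" by (simp add: space_PiM)
      ultimately show ?case by (simp add: A_def)
    qed
    show "{\<omega> \<in> space M. ?X \<omega> \<in> A} \<in> sets M" using measurable_sets[OF X A] by (simp add: vimage_def Int_def conj_commute)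
    have "(\<lambda>\<omega>. B N (time j) \<omega>) \<in> borel_measurable M" if "j \<in> {1..Suc n}" for j
    proof -
      have "(\<lambda>\<omega>. ?X \<omega> (j, N)) \<in> borel_measurable M"
        using measurable_compose[OF X measurable_component_singleton[of "(j, N)"]] that N by simp
      then show ?thesis using that N by simp
    qed
    then show "{\<omega> \<in> space M. \<forall>j\<in>{1..Suc n}. B N (time j) \<omega> \<le> m} \<in> sets M"
      by (intro sets.sets_Collect_finite_All) auto
  qed
  also have "\<dots> = (LINT \<omega>|M. indicator A (?X \<omega>))"
  proof -
    have "{\<omega> \<in> space M. ?X \<omega> \<in> A} \<in> sets M" using measurable_sets[OF X A] by (simp add: vimage_def Int_def conj_commute)
    then have "measure M {\<omega> \<in> space M. ?X \<omega> \<in> A} = (LINT \<omega>|M. indicator {\<omega> \<in> space M. ?X \<omega> \<in> A} \<omega>)"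
      by (simp add: M.emeasure_eq_measure Int_absorb2 sets.sets_into_space)
    also have "\<dots> = (LINT \<omega>|M. indicator A (?X \<omega>))"
      by (intro Bochner_Integration.integral_cong refl) (auto simp: indicator_def)
    finally show ?thesis .
  qed
  also have "\<dots> = (LINT x|?P. c * ?w x * indicator A x)"
    by (rule distributed_integral[OF dist, symmetric]) (use A w0 in auto)
  also have "\<dots> = (LINT x|?P. (c / norm_const) * (of_bool (\<forall>p\<in>?I. x p \<le> m) * (norm_const * ?w x)))"
    using norm_const_pos by (intro Bochner_Integration.integral_cong refl) (simp add: ind_A)
  also have "\<dots> = (c / norm_const) * sdet {1..N} wall_matrix"
    by (simp only: integral_mult_right_zero wall)
  \<comment> \<open>The integral of the weight is \<open>1 / c\<close>, and the free chain integral
    evaluates it a second time.\<close>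
  also have "c / norm_const = 1 / (\<Prod>a\<in>{1..N}. 1 / fact (a - 1) / sqrt (2 * pi))"
  proof -
    have "(LINT x|?P. c * ?w x) = c * (LINT x|?P. ?w x)" "(LINT x|?P. norm_const * ?w x) = norm_const * (LINT x|?P. ?w x)" by simp_all
    then have "c * (LINT x|?P. ?w x) = 1" "norm_const * (LINT x|?P. ?w x) = (\<Prod>a\<in>{1..N}. 1 / fact (a - 1) / sqrt (2 * pi))"
      using one free by auto
    moreover have "(LINT x|?P. ?w x) \<noteq> 0" using calculation(1) by auto
    ultimately show ?thesis
      by (metis (no_types) nonzero_mult_divide_mult_cancel_right)
  qed
  finally show ?thesis by simp
qed

end

section \<open>Refinement of the grid\<close>

lemma grid_probability_explicit:
  assumes "0 < d" "d < 1 / 2" "n \<ge> 1" "nonintersecting_bridges M N B" "N \<ge> 1"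
  shows "measure M {\<omega> \<in> space M. \<forall>j\<in>{1..Suc n}. B N (d + (real j - 1) * ((1 - 2 * d) / real n)) \<omega> \<le> m} =
    sdet {1..N} (\<lambda>a b. LINT x|lborel. killed m ((1 - 2 * d) / real n) (\<lambda>x. gamma_fun d (a - 1) x * indicator {..m} x) n x * gamma_fun d (b - 1) x) /
    (\<Prod>a\<in>{1..N}. 1 / fact (a - 1) / sqrt (2 * pi))"
proof -
  interpret bridge_grid d m N n using assms by unfold_locales auto
  show ?thesis
    using grid_probability[OF assms(4,5)]
    unfolding time_def step_def wall_matrix_def[abs_def] wall_start_def[abs_def] .
qed

text \<open>Continuity in the wall position from above, which removes the raised wall of the upper
  comparison.\<close>

lemma absorbed_wall_limit:
  assumes T: "T > 0" and \<phi>: "integrable lborel \<phi>"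
  shows "(\<lambda>k. absorbed (m + 1 / real (Suc k)) \<phi> T y) \<longlonglongrightarrow> absorbed m \<phi> T y"
  unfolding absorbed_def
proof (rule integral_dominated_convergence[where w = "\<lambda>x. \<bar>\<phi> x\<bar> * (1 / sqrt (2 * pi * T))"])
  have [measurable]: "\<phi> \<in> borel_measurable borel" using \<phi> by auto
  show "(\<lambda>x. \<phi> x * (heat_kernel T x y - heat_kernel T x (2 * m - y))) \<in> borel_measurable lborel" by measurable
  show "(\<lambda>x. \<phi> x * (heat_kernel T x y - heat_kernel T x (2 * (m + 1 / real (Suc k)) - y))) \<in> borel_measurable lborel" for k by measurable
  show "integrable lborel (\<lambda>x. \<bar>\<phi> x\<bar> * (1 / sqrt (2 * pi * T)))" using \<phi> by (intro integrable_mult_left integrable_abs)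
  have "(\<lambda>k. heat_kernel T x (2 * (m + 1 / real (Suc k)) - y)) \<longlonglongrightarrow> heat_kernel T x (2 * (m + 0) - y)" for x
    unfolding heat_kernel_def using T LIMSEQ_inverse_real_of_nat by (intro tendsto_intros) (auto simp: inverse_eq_divide)
  then show "AE x in lborel. (\<lambda>k. \<phi> x * (heat_kernel T x y - heat_kernel T x (2 * (m + 1 / real (Suc k)) - y)))
      \<longlonglongrightarrow> \<phi> x * (heat_kernel T x y - heat_kernel T x (2 * m - y))"
    by (auto intro!: tendsto_intros)
  show "AE x in lborel. norm (\<phi> x * (heat_kernel T x y - heat_kernel T x (2 * (m + 1 / real (Suc k)) - y))) \<le> \<bar>\<phi> x\<bar> * (1 / sqrt (2 * pi * T))" for k
  proof (rule AE_I2)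
    fix x
    have "\<bar>heat_kernel T x y - heat_kernel T x (2 * (m + 1 / real (Suc k)) - y)\<bar> \<le> 1 / sqrt (2 * pi * T)"
      using heat_kernel_le[OF T, of x y] heat_kernel_le[OF T, of x "2 * (m + 1 / real (Suc k)) - y"]
        heat_kernel_nonneg[OF T, of x y] heat_kernel_nonneg[OF T, of x "2 * (m + 1 / real (Suc k)) - y"] by linarith
    then show "norm (\<phi> x * (heat_kernel T x y - heat_kernel T x (2 * (m + 1 / real (Suc k)) - y))) \<le> \<bar>\<phi> x\<bar> * (1 / sqrt (2 * pi * T))"
      unfolding real_norm_def abs_mult by (intro mult_left_mono) auto
  qed
qed

text \<open>The lower comparison is immediate. For the upper one the wall is raised by a fixed small
  amount first; the accumulated error then vanishes as the mesh shrinks.\<close>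

lemma killed_tendsto_absorbed:
  assumes T: "T > 0" and \<phi>: "integrable lborel \<phi>" "\<And>x. \<phi> x \<ge> 0" "\<And>x. \<phi> x \<le> C" "\<And>x. x > m \<Longrightarrow> \<phi> x = 0"
    and y: "y \<le> m"
  shows "(\<lambda>n. killed m (T / real (Suc n)) \<phi> (Suc n) y) \<longlonglongrightarrow> absorbed m \<phi> T y"
proof (rule order_tendstoI)
  have h: "T / real (Suc n) > 0" for n using T by simp
  have hT: "real (Suc n) * (T / real (Suc n)) = T" for n by simp
  fix a
  {
    assume "a < absorbed m \<phi> T y"
    then show "\<forall>\<^sub>F n in sequentially. a < killed m (T / real (Suc n)) \<phi> (Suc n) y"
    proof (intro always_eventually allI)
      fix n
      assume "a < absorbed m \<phi> T y"
      then show "a < killed m (T / real (Suc n)) \<phi> (Suc n) y"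
        using killed_ge_absorbed[OF h[of n] \<phi>(1) \<phi>(2) \<phi>(3) \<phi>(4) y, of n] unfolding hT by linarith
    qed
  next
    assume a: "absorbed m \<phi> T y < a"
    then have "\<forall>\<^sub>F k in sequentially. absorbed (m + 1 / real (Suc k)) \<phi> T y < a"
      using order_tendstoD(2)[OF absorbed_wall_limit[OF T \<phi>(1), of m y]] by blast
    then obtain k where k: "absorbed (m + 1 / real (Suc k)) \<phi> T y < a"
      using eventually_happens'[OF sequentially_bot] by blast
    define \<epsilon> where "\<epsilon> = 1 / real (Suc k)"
    \<comment> \<open>The rate at step \<open>T / Suc n\<close>: the error of \<open>Suc n\<close>
      steps is a multiple of \<open>Suc n * exp (- c * Suc n)\<close>.\<close>
    define c where "c = \<epsilon>\<^sup>2 / (4 * T)"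
    have c: "c > 0" using T by (simp add: c_def \<epsilon>_def)
    have "(\<lambda>n. real (Suc n) * exp (- c * real (Suc n))) \<longlonglongrightarrow> 0" using c by real_asymp
    then have "(\<lambda>n. absorbed (m + \<epsilon>) \<phi> T y + C * sqrt 2 * (real (Suc n) * exp (- c * real (Suc n)))) \<longlonglongrightarrow> absorbed (m + \<epsilon>) \<phi> T y + C * sqrt 2 * 0"
      by (intro tendsto_intros)
    then have "\<forall>\<^sub>F n in sequentially. absorbed (m + \<epsilon>) \<phi> T y + C * sqrt 2 * (real (Suc n) * exp (- c * real (Suc n))) < a"
      using k unfolding \<epsilon>_def by (intro order_tendstoD(2)) auto
    then show "\<forall>\<^sub>F n in sequentially. killed m (T / real (Suc n)) \<phi> (Suc n) y < a"
    proof eventually_elim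
      case (elim n)
      have "\<epsilon> \<ge> 0" by (simp add: \<epsilon>_def)
      from killed_le_absorbed[OF h[of n] \<phi>(1) \<phi>(2) \<phi>(3) \<phi>(4) this y, of n]
      have "killed m (T / real (Suc n)) \<phi> (Suc n) y \<le> absorbed (m + \<epsilon>) \<phi> T y + real (Suc n) * (C * (sqrt 2 * exp (- \<epsilon>\<^sup>2 / (4 * (T / real (Suc n))))))"
        unfolding hT .
      moreover have "- \<epsilon>\<^sup>2 / (4 * (T / real (Suc n))) = - c * real (Suc n)" by (simp add: c_def)
      ultimately show ?case using elim by (simp only: mult_ac)
    qed
  }
qed

lemma killed_diff:
  assumes h: "h > 0"
    and f: "integrable lborel f" "\<And>x. f x \<ge> 0" "\<And>x. f x \<le> C" "\<And>x. x > m \<Longrightarrow> f x = 0"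
    and g: "integrable lborel g" "\<And>x. g x \<ge> 0" "\<And>x. g x \<le> C" "\<And>x. x > m \<Longrightarrow> g x = 0"
  shows "killed m h (\<lambda>x. f x - g x) n y = killed m h f n y - killed m h g n y"
proof (induction n arbitrary: y)
  case (Suc n)
  have "integrable lborel (\<lambda>x. killed m h f n x * heat_kernel h x y)" "integrable lborel (\<lambda>x. killed m h g n x * heat_kernel h x y)"
    using killed_bounds[OF h f] killed_bounds[OF h g] by (auto intro!: integrable_mult_heat_kernel h)
  then show ?case
    unfolding killed_Suc Suc.IH left_diff_distrib by (simp add: right_diff_distrib)
qed simp

lemma absorbed_diff:
  assumes T: "T > 0" and f: "integrable lborel f" and g: "integrable lborel g"
  shows "absorbed m (\<lambda>x. f x - g x) T y = absorbed m f T y - absorbed m g T y"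
proof -
  have "integrable lborel (\<lambda>x. f x * (heat_kernel T x y - heat_kernel T x (2 * m - y)))" if "integrable lborel f" for f
    unfolding right_diff_distrib using that by (intro Bochner_Integration.integrable_diff integrable_mult_heat_kernel T)
  then show ?thesis unfolding absorbed_def using f g by (simp add: left_diff_distrib)
qed

lemma killed_integral_tendsto:
  assumes T: "T > 0" and \<phi>: "integrable lborel \<phi>" "\<And>x. \<bar>\<phi> x\<bar> \<le> C" "\<And>x. x > m \<Longrightarrow> \<phi> x = 0"
    and \<psi>: "integrable lborel \<psi>"
  shows "(\<lambda>n. LINT y|lborel. killed m (T / real (Suc n)) \<phi> (Suc n) y * \<psi> y) \<longlonglongrightarrow>
    (LINT y|lborel. (indicator {..m} y * absorbed m \<phi> T y) * \<psi> y)"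
proof -
  \<comment> \<open>The comparison of densities needs nonnegative starting functions, while
    Hermite-type functions change sign.\<close>
  define p q where "p x = max (\<phi> x) 0" and "q x = max (- \<phi> x) 0" for x
  have \<phi>_eq: "\<phi> = (\<lambda>x. p x - q x)" by (auto simp: p_def q_def fun_eq_iff)
  have p: "integrable lborel p" "\<And>x. p x \<ge> 0" "\<And>x. p x \<le> C" "\<And>x. x > m \<Longrightarrow> p x = 0"
    and q: "integrable lborel q" "\<And>x. q x \<ge> 0" "\<And>x. q x \<le> C" "\<And>x. x > m \<Longrightarrow> q x = 0"
    using \<phi>(1) \<phi>(2) \<phi>(3) abs_le_D1[OF \<phi>(2)] abs_le_D2[OF \<phi>(2)] order_trans[OF abs_ge_zero \<phi>(2)]
    unfolding p_def q_def by (auto intro!: integrable_max)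
  have [measurable]: "\<psi> \<in> borel_measurable borel" using \<psi> by auto
  have h: "T / real (Suc n) > 0" for n using T by simp
  have eq: "killed m (T / real (Suc n)) \<phi> k y = killed m (T / real (Suc n)) p k y - killed m (T / real (Suc n)) q k y" for n k y
    unfolding \<phi>_eq by (rule killed_diff[OF h p q])
  have eqa: "absorbed m \<phi> T y = absorbed m p T y - absorbed m q T y" for y
    unfolding \<phi>_eq by (rule absorbed_diff[OF T p(1) q(1)])
  have bnd: "\<bar>killed m (T / real (Suc n)) \<phi> k y\<bar> \<le> C" for n k y
    using killed_bounds[where m = m and n = k, OF h[of n] p] killed_bounds[where m = m and n = k, OF h[of n] q] unfolding eq by (smt (verit))
  have vanish: "killed m (T / real (Suc n)) \<phi> k y = 0" if "y > m" for n k y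
    using killed_bounds[where m = m and n = k, OF h[of n] p] killed_bounds[where m = m and n = k, OF h[of n] q] that unfolding eq by auto
  have "integrable lborel (killed m (T / real (Suc n)) \<phi> k)" for n k
    using killed_bounds[where m = m and n = k, OF h[of n] p] killed_bounds[where m = m and n = k, OF h[of n] q] unfolding eq[abs_def] by auto
  from borel_measurable_integrable[OF this]
  have m1 [measurable]: "killed m (T / real (Suc n)) \<phi> k \<in> borel_measurable borel" for n k
    by (simp del: killed.simps)
  have [measurable]: "\<phi> \<in> borel_measurable borel" using \<phi>(1) by auto
  have m2 [measurable]: "absorbed m \<phi> T \<in> borel_measurable borel"
    unfolding absorbed_def by measurable
  show ?thesis
  proof (rule integral_dominated_convergence[where w = "\<lambda>y. C * \<bar>\<psi> y\<bar>"])
    show "integrable lborel (\<lambda>y. C * \<bar>\<psi> y\<bar>)" using \<psi> by simp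
    show "(\<lambda>y. killed m (T / real (Suc n)) \<phi> (Suc n) y * \<psi> y) \<in> borel_measurable lborel" for n
      using m1[of n "Suc n"] by (simp del: killed.simps)
    show "(\<lambda>y. indicator {..m} y * absorbed m \<phi> T y * \<psi> y) \<in> borel_measurable lborel" by measurable
    show "AE y in lborel. (\<lambda>n. killed m (T / real (Suc n)) \<phi> (Suc n) y * \<psi> y) \<longlonglongrightarrow> indicator {..m} y * absorbed m \<phi> T y * \<psi> y"
    proof (intro AE_I2 tendsto_mult tendsto_const)
      fix y
      show "(\<lambda>n. killed m (T / real (Suc n)) \<phi> (Suc n) y) \<longlonglongrightarrow> indicator {..m} y * absorbed m \<phi> T y"
      proof (cases "y \<le> m")
        case True
        show ?thesis
          unfolding eq eqa using True tendsto_diff[OF killed_tendsto_absorbed[OF T p True] killed_tendsto_absorbed[OF T q True]]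
          by (simp del: killed.simps)
      qed (use vanish in \<open>simp del: killed.simps\<close>)
    qed
    show "AE y in lborel. norm (killed m (T / real (Suc n)) \<phi> (Suc n) y * \<psi> y) \<le> C * \<bar>\<psi> y\<bar>" for n
      using bnd by (auto simp: abs_mult simp del: killed.simps intro!: AE_I2 mult_right_mono)
  qed
qed

lemma gamma_dom_tail:
  assumes d: "0 < d" and k: "0 < \<kappa>" "\<kappa> < m"
  shows "(LINT x|lborel. indicator {m..} x * gamma_dom d \<kappa> x) \<le> exp (\<kappa>\<^sup>2 / d) * (2 * (sqrt 2 * exp (- (m - \<kappa>)\<^sup>2 / (4 * d))))"
proof -
  have i: "integrable lborel (\<lambda>x. indicator {m..} x * heat_kernel d z x)" for z
    using integrable_mult_indicator[OF _ integrable_heat_kernel[OF d], of "{m..}" z] by simp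
  have "(LINT x|lborel. indicator {m..} x * gamma_dom d \<kappa> x)
      = (LINT x|lborel. exp (\<kappa>\<^sup>2 / d) * (indicator {m..} x * heat_kernel d \<kappa> x + indicator {m..} x * heat_kernel d (- \<kappa>) x))"
    by (simp add: gamma_dom_def algebra_simps)
  also have "\<dots> = exp (\<kappa>\<^sup>2 / d) * ((LINT x|lborel. indicator {m..} x * heat_kernel d \<kappa> x) + (LINT x|lborel. indicator {m..} x * heat_kernel d (- \<kappa>) x))"
    by (simp add: i)
  also have "\<dots> \<le> exp (\<kappa>\<^sup>2 / d) * (sqrt 2 * exp (- (m - \<kappa>)\<^sup>2 / (4 * d)) + sqrt 2 * exp (- (m - \<kappa>)\<^sup>2 / (4 * d)))"
    using k d by (intro mult_left_mono add_mono heat_kernel_tail) auto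
  finally show ?thesis by simp
qed

text \<open>The cut at \<open>m\<close> is missing from the exact pairing at the first and at the
  last time. Each cut costs the tail of one end function times the total mass of the other, hence
  the factor 2. The assumption \<open>d \<le> 1 / 4\<close> gives \<open>T \<ge> 1 / 2\<close>,
  which keeps the difference of heat kernels at most 1.\<close>

lemma restricted_pairing_error:
  assumes d: "0 < d" "d \<le> 1 / 4" and k: "0 < \<kappa>" "\<kappa> < m"
  defines "T \<equiv> 1 - 2 * d"
  shows "\<bar>(LINT x|lborel. (indicator {..m} x * absorbed m (\<lambda>x. gamma_fun d a x * indicator {..m} x) T x) * gamma_fun d b x)
      - ((LINT x|lborel. gamma_fun d b x * gamma_heat d T a x) - (LINT x|lborel. gamma_fun d b x * gamma_heat d T a (2 * m - x)))\<bar>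
    \<le> 2 * (2 * exp (\<kappa>\<^sup>2 / d) * (exp (\<kappa>\<^sup>2 / d) * (2 * (sqrt 2 * exp (- (m - \<kappa>)\<^sup>2 / (4 * d)))))) / (\<kappa> ^ a * \<kappa> ^ b)"
proof -
  have d1: "d < 1" and T: "T > 0" "T \<ge> 1 / 2" using d by (auto simp: T_def)
  define K where "K x y = heat_kernel T x y - heat_kernel T x (2 * m - y)" for x y
  have Km [measurable]: "(\<lambda>x. K x y) \<in> borel_measurable borel" for y unfolding K_def by measurable
  have K1: "\<bar>K x y\<bar> \<le> 1" for x y
  proof -
    have "1 \<le> 2 * pi * T" using T pi_gt3 mult_mono[of 2 pi "1/2" T] by auto
    then have "1 \<le> sqrt (2 * pi * T)" by (rule real_sqrt_ge_one)
    then have "1 / sqrt (2 * pi * T) \<le> 1" using divide_le_eq_1_pos[of "sqrt (2 * pi * T)" 1] by linarith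
    then show ?thesis
      using heat_kernel_le[OF T(1), of x y] heat_kernel_le[OF T(1), of x "2 * m - y"]
        heat_kernel_nonneg[OF T(1), of x y] heat_kernel_nonneg[OF T(1), of x "2 * m - y"] by (simp add: K_def)
  qed
  \<comment> \<open>\<open>S\<close> bounds the total mass and \<open>L\<close> the mass beyond
    \<open>m\<close>, both before division by a power of the Cauchy radius.\<close>
  define S where "S = 2 * exp (\<kappa>\<^sup>2 / d)"
  define L where "L = exp (\<kappa>\<^sup>2 / d) * (2 * (sqrt 2 * exp (- (m - \<kappa>)\<^sup>2 / (4 * d))))"
  note gi = integrable_gamma_fun[OF d(1) d1] and gd = integrable_gamma_dom[OF d(1) d1]
  have tail_i: "integrable lborel (\<lambda>x. indicator {m..} x * gamma_dom d \<kappa> x)"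
    using integrable_mult_indicator[OF _ gd, of "{m..}" \<kappa>] by simp
  have dom0: "gamma_dom d \<kappa> x \<ge> 0" for x using d by (simp add: gamma_dom_def)
  have gle: "\<bar>gamma_fun d c x\<bar> \<le> gamma_dom d \<kappa> x / \<kappa> ^ c" for c x by (rule gamma_fun_le[OF d(1) d1 k(1)])
  have S_int: "(LINT x|lborel. \<bar>gamma_fun d c x\<bar>) \<le> S / \<kappa> ^ c" for c
  proof -
    have "(LINT x|lborel. \<bar>gamma_fun d c x\<bar>) \<le> (LINT x|lborel. gamma_dom d \<kappa> x / \<kappa> ^ c)"
      using gle gd gi by (intro integral_mono integrable_abs) auto
    then show ?thesis by (simp add: S_def integral_gamma_dom[OF d(1) d1])
  qed
  have L_int: "(LINT x|lborel. indicator {m<..} x * \<bar>gamma_fun d c x\<bar>) \<le> L / \<kappa> ^ c" for c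
  proof -
    have "integrable lborel (\<lambda>x. indicator {m<..} x *\<^sub>R \<bar>gamma_fun d c x\<bar>)"
      by (intro integrable_mult_indicator integrable_abs gi) auto
    then have "(LINT x|lborel. indicator {m<..} x * \<bar>gamma_fun d c x\<bar>) \<le> (LINT x|lborel. indicator {m..} x * gamma_dom d \<kappa> x / \<kappa> ^ c)"
      using gle tail_i dom0 k by (intro integral_mono) (auto simp: indicator_def)
    also have "\<dots> \<le> L / \<kappa> ^ c"
      using gamma_dom_tail[OF d(1) k] k by (simp add: L_def divide_right_mono)
    finally show ?thesis .
  qed
  define V where "V y = (LINT x|lborel. gamma_fun d a x * K x y)" for y
  define Vm where "Vm y = absorbed m (\<lambda>x. gamma_fun d a x * indicator {..m} x) T y" for y
  have iK: "integrable lborel (\<lambda>x. gamma_fun d a x * K x y)" for y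
    by (rule integrable_gamma_fun_mult[OF d(1) d1 Km K1])
  have iKm: "integrable lborel (\<lambda>x. (gamma_fun d a x * indicator {..m} x) * K x y)" for y
    using integrable_mult_indicator[OF _ iK, of "{..m}" y] by (simp add: mult_ac)
  have V_alt: "V y = gamma_heat d T a y - gamma_heat d T a (2 * m - y)" for y
    unfolding V_def K_def gamma_heat_def right_diff_distrib
    by (intro Bochner_Integration.integral_diff integrable_mult_heat_kernel T gi)
  have V_bound: "\<bar>V y\<bar> \<le> S / \<kappa> ^ a" for y
  proof -
    have "\<bar>V y\<bar> \<le> (LINT x|lborel. \<bar>gamma_fun d a x * K x y\<bar>)" unfolding V_def by (rule integral_abs_bound)
    also have "\<dots> \<le> (LINT x|lborel. \<bar>gamma_fun d a x\<bar>)"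
      using K1 by (intro integral_mono integrable_abs iK gi) (simp add: abs_mult mult_left_le)
    finally show ?thesis using S_int[of a] by linarith
  qed
  have VVm: "\<bar>V y - Vm y\<bar> \<le> L / \<kappa> ^ a" for y
  proof -
    have "V y - Vm y = (LINT x|lborel. gamma_fun d a x * K x y - (gamma_fun d a x * indicator {..m} x) * K x y)"
      unfolding V_def Vm_def absorbed_def K_def[symmetric] by (rule Bochner_Integration.integral_diff[OF iK iKm, symmetric])
    then have "\<bar>V y - Vm y\<bar> \<le> (LINT x|lborel. \<bar>gamma_fun d a x * K x y - (gamma_fun d a x * indicator {..m} x) * K x y\<bar>)"
      using integral_abs_bound[of lborel "\<lambda>x. gamma_fun d a x * K x y - (gamma_fun d a x * indicator {..m} x) * K x y"] by (simp only:)
    also have "\<dots> \<le> (LINT x|lborel. indicator {m<..} x * \<bar>gamma_fun d a x\<bar>)"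
    proof (intro integral_mono integrable_abs Bochner_Integration.integrable_diff iK iKm)
      show "integrable lborel (\<lambda>x. indicator {m<..} x * \<bar>gamma_fun d a x\<bar>)"
        using integrable_mult_indicator[OF _ integrable_abs[OF gi], of "{m<..}" a] by simp
      show "\<bar>gamma_fun d a x * K x y - gamma_fun d a x * indicator {..m} x * K x y\<bar> \<le> indicator {m<..} x * \<bar>gamma_fun d a x\<bar>" for x
        using K1[of x y] by (auto simp: indicator_def abs_mult mult_left_le)
    qed
    finally show ?thesis using L_int[of a] by linarith
  qed
  have [measurable]: "V \<in> borel_measurable borel" unfolding V_alt[abs_def] by measurable
  have [measurable]: "Vm \<in> borel_measurable borel" unfolding Vm_def absorbed_def by measurable
  have iV: "integrable lborel (\<lambda>x. V x * gamma_fun d b x)"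
    using integrable_gamma_fun_mult[OF d(1) d1 _ V_bound] by (simp add: mult.commute)
  \<comment> \<open>Below the wall only the cut at the first time is felt; beyond it the discrepancy
    is all of \<open>V\<close>, which accounts for the cut at the last time.\<close>
  have err: "\<bar>indicator {..m} x * Vm x - V x\<bar> \<le> L / \<kappa> ^ a + indicator {m<..} x * (S / \<kappa> ^ a)" for x
    using VVm[of x] V_bound[of x] order_trans[OF abs_ge_zero VVm[of x]] by (auto simp: indicator_def abs_minus_commute)
  have iD: "integrable lborel (\<lambda>x. (indicator {..m} x * Vm x - V x) * gamma_fun d b x)"
  proof -
    have "\<bar>indicator {..m} x * Vm x - V x\<bar> \<le> L / \<kappa> ^ a + S / \<kappa> ^ a" for x
      using err[of x] order_trans[OF abs_ge_zero V_bound[of x]] by (auto simp: indicator_def split: if_splits)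
    then show ?thesis
      using integrable_gamma_fun_mult[OF d(1) d1, of "\<lambda>x. indicator {..m} x * Vm x - V x" "L / \<kappa> ^ a + S / \<kappa> ^ a" b]
      by (simp add: mult.commute)
  qed
  have iVm: "integrable lborel (\<lambda>x. (indicator {..m} x * Vm x) * gamma_fun d b x)"
    using Bochner_Integration.integrable_add[OF iD iV] by (simp add: left_diff_distrib)
  have full: "(LINT x|lborel. gamma_fun d b x * gamma_heat d T a x) - (LINT x|lborel. gamma_fun d b x * gamma_heat d T a (2 * m - x)) = (LINT x|lborel. V x * gamma_fun d b x)"
  proof -
    obtain C where C: "\<And>z. \<bar>gamma_heat d T a z\<bar> \<le> C" using gamma_heat_bounded[OF d(1) d1 T(1)] by blast
    have "integrable lborel (\<lambda>x. gamma_fun d b x * gamma_heat d T a x)" "integrable lborel (\<lambda>x. gamma_fun d b x * gamma_heat d T a (2 * m - x))"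
      using C by (auto intro!: integrable_gamma_fun_mult[OF d(1) d1])
    then show ?thesis by (simp add: V_alt left_diff_distrib mult.commute[of _ "gamma_fun d b _"] right_diff_distrib)
  qed
  have "(LINT x|lborel. (indicator {..m} x * Vm x) * gamma_fun d b x) - (LINT x|lborel. V x * gamma_fun d b x)
     = (LINT x|lborel. (indicator {..m} x * Vm x - V x) * gamma_fun d b x)"
    using Bochner_Integration.integral_diff[OF iVm iV] by (simp add: left_diff_distrib)
  then have "\<bar>(LINT x|lborel. (indicator {..m} x * Vm x) * gamma_fun d b x) - (LINT x|lborel. V x * gamma_fun d b x)\<bar>
     \<le> (LINT x|lborel. \<bar>(indicator {..m} x * Vm x - V x) * gamma_fun d b x\<bar>)"
    using integral_abs_bound[of lborel "\<lambda>x. (indicator {..m} x * Vm x - V x) * gamma_fun d b x"] by (simp only:)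
  also have "\<dots> \<le> (LINT x|lborel. L / \<kappa> ^ a * \<bar>gamma_fun d b x\<bar> + S / \<kappa> ^ a * (indicator {m<..} x * \<bar>gamma_fun d b x\<bar>))"
  proof (intro integral_mono integrable_abs iD Bochner_Integration.integrable_add integrable_mult_right gi)
    show "integrable lborel (\<lambda>x. indicator {m<..} x * \<bar>gamma_fun d b x\<bar>)"
      using integrable_mult_indicator[OF _ integrable_abs[OF gi], of "{m<..}" b] by simp
    show "\<bar>(indicator {..m} x * Vm x - V x) * gamma_fun d b x\<bar> \<le> L / \<kappa> ^ a * \<bar>gamma_fun d b x\<bar> + S / \<kappa> ^ a * (indicator {m<..} x * \<bar>gamma_fun d b x\<bar>)" for x
      using mult_right_mono[OF err[of x] abs_ge_zero[of "gamma_fun d b x"]] by (simp only: abs_mult distrib_left mult_ac)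
  qed
  also have "\<dots> = L / \<kappa> ^ a * (LINT x|lborel. \<bar>gamma_fun d b x\<bar>) + S / \<kappa> ^ a * (LINT x|lborel. indicator {m<..} x * \<bar>gamma_fun d b x\<bar>)"
    using gi[of b] integrable_mult_indicator[OF _ integrable_abs[OF gi], of "{m<..}" b] by simp
  also have "\<dots> \<le> L / \<kappa> ^ a * (S / \<kappa> ^ b) + S / \<kappa> ^ a * (L / \<kappa> ^ b)"
    using k by (intro add_mono mult_left_mono S_int L_int) (auto simp: S_def L_def)
  also have "\<dots> = 2 * (S * L) / (\<kappa> ^ a * \<kappa> ^ b)" using k by (simp add: field_simps)
  finally show ?thesis unfolding full Vm_def S_def L_def .
qed

text \<open>The exact pairing is the same for every \<open>l\<close>, so the limit only has to
  absorb the tail error. The choice of \<open>d\<close> respects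
  \<open>d l \<le> 1 / 4\<close>.\<close>

lemma restricted_pairing_limit:
  assumes m: "m > 0"
    and H: "\<And>z::real. (\<lambda>b. H b * z ^ b) sums (exp (2 * m * z - 2 * m\<^sup>2) * (2 * m - z) ^ a)"
  defines "d \<equiv> \<lambda>l. 1 / (real l + 4)"
  shows "(\<lambda>l. LINT x|lborel. (indicator {..m} x * absorbed m (\<lambda>x. gamma_fun (d l) a x * indicator {..m} x) (1 - 2 * d l) x) * gamma_fun (d l) b x)
    \<longlonglongrightarrow> (1 / fact a / sqrt (2 * pi)) * ((if a = b then 1 else 0) - H b)"
proof -
  \<comment> \<open>Small enough for the tail \<open>(m - \<kappa>)\<^sup>2 / 4\<close> to beat the
    growth \<open>2 * \<kappa>\<^sup>2\<close> of the Cauchy estimates.\<close>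
  define \<kappa> where "\<kappa> = m / 10"
  have k: "0 < \<kappa>" "\<kappa> < m" using m by (auto simp: \<kappa>_def)
  have d: "0 < d l" "d l \<le> 1 / 4" for l by (auto simp: d_def field_simps)
  have full: "(LINT x|lborel. gamma_fun (d l) b x * gamma_heat (d l) (1 - 2 * d l) a x) - (LINT x|lborel. gamma_fun (d l) b x * gamma_heat (d l) (1 - 2 * d l) a (2 * m - x))
     = (1 / fact a / sqrt (2 * pi)) * ((if a = b then 1 else 0) - H b)" for l
  proof -
    have t: "1 - 2 * d l + 2 * d l = 1" "1 - 2 * d l > 0" "d l < 1" using d[of l] by auto
    have "(LINT x|lborel. gamma_fun (d l) b x * gamma_heat (d l) (1 - 2 * d l) a (2 * m - x)) = (1 / fact a / sqrt (2 * pi)) * H b"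
    proof (rule real_power_series_unique[where a = "\<lambda>b. LINT x|lborel. gamma_fun (d l) b x * gamma_heat (d l) (1 - 2 * d l) a (2 * m - x)"
        and b = "\<lambda>b. (1 / fact a / sqrt (2 * pi)) * H b" and f = "\<lambda>z. exp (2 * m * z - 2 * m\<^sup>2) * (2 * m - z) ^ a / fact a / sqrt (2 * pi)"])
      fix z
      show "(\<lambda>b. (LINT x|lborel. gamma_fun (d l) b x * gamma_heat (d l) (1 - 2 * d l) a (2 * m - x)) * z ^ b) sums (exp (2 * m * z - 2 * m\<^sup>2) * (2 * m - z) ^ a / fact a / sqrt (2 * pi))"
        by (rule gamma_pair_reflected_sums[OF d(1) t(3) t(1,2)])
      show "(\<lambda>b. (1 / fact a / sqrt (2 * pi)) * H b * z ^ b) sums (exp (2 * m * z - 2 * m\<^sup>2) * (2 * m - z) ^ a / fact a / sqrt (2 * pi))"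
        using sums_mult[OF H[of z], of "1 / fact a / sqrt (2 * pi)"] by (simp add: mult.assoc)
    qed
    then show ?thesis using gamma_pair_diagonal[OF d(1) t(3) t(1,2), of b a] by (simp add: right_diff_distrib)
  qed
  let ?E = "\<lambda>l. 2 * (2 * exp (\<kappa>\<^sup>2 / d l) * (exp (\<kappa>\<^sup>2 / d l) * (2 * (sqrt 2 * exp (- (m - \<kappa>)\<^sup>2 / (4 * d l)))))) / (\<kappa> ^ a * \<kappa> ^ b)"
  have "(\<lambda>l. (LINT x|lborel. (indicator {..m} x * absorbed m (\<lambda>x. gamma_fun (d l) a x * indicator {..m} x) (1 - 2 * d l) x) * gamma_fun (d l) b x)
     - (1 / fact a / sqrt (2 * pi)) * ((if a = b then 1 else 0) - H b)) \<longlonglongrightarrow> 0"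
  proof (rule Lim_null_comparison)
    show "\<forall>\<^sub>F l in sequentially. norm ((LINT x|lborel. (indicator {..m} x * absorbed m (\<lambda>x. gamma_fun (d l) a x * indicator {..m} x) (1 - 2 * d l) x) * gamma_fun (d l) b x)
     - (1 / fact a / sqrt (2 * pi)) * ((if a = b then 1 else 0) - H b)) \<le> ?E l"
    proof (intro always_eventually allI)
      fix l
      show "norm ((LINT x|lborel. (indicator {..m} x * absorbed m (\<lambda>x. gamma_fun (d l) a x * indicator {..m} x) (1 - 2 * d l) x) * gamma_fun (d l) b x)
     - (1 / fact a / sqrt (2 * pi)) * ((if a = b then 1 else 0) - H b)) \<le> ?E l"
        using restricted_pairing_error[OF d(1)[of l] d(2)[of l] k, of a b] unfolding full real_norm_def .
    qed
    \<comment> \<open>The net rate at this radius: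
      \<open>81 / 400 - 2 / 100 = 73 / 400\<close>.\<close>
    define c where "c = (73 / 400) * m\<^sup>2"
    have c: "c > 0" using m by (simp add: c_def)
    have E: "?E l = 8 * sqrt 2 / (\<kappa> ^ a * \<kappa> ^ b) * exp (- c * (real l + 4))" for l
    proof -
      have "\<kappa>\<^sup>2 / d l + (\<kappa>\<^sup>2 / d l + - (m - \<kappa>)\<^sup>2 / (4 * d l)) = - c * (real l + 4)"
        by (simp add: \<kappa>_def c_def d_def power2_eq_square field_simps)
      then have "exp (\<kappa>\<^sup>2 / d l) * (exp (\<kappa>\<^sup>2 / d l) * exp (- (m - \<kappa>)\<^sup>2 / (4 * d l))) = exp (- c * (real l + 4))"
        by (simp flip: exp_add)
      then show ?thesis by (simp add: algebra_simps)
    qed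
    have "(\<lambda>l. exp (- c * (real l + 4))) \<longlonglongrightarrow> 0" using c by real_asymp
    then show "?E \<longlonglongrightarrow> 0" unfolding E by (rule tendsto_mult_right_zero)
  qed
  then show ?thesis by (rule LIM_zero_cancel)
qed

text \<open>By continuity the excess persists near \<open>t\<close>, and a fine grid has a point
  there.\<close>

lemma grid_detects_excess:
  fixes f :: "real \<Rightarrow> real"
  assumes cont: "continuous_on {0..1} f" and d: "0 < d" "d < 1 / 2"
    and t: "t \<in> {d..1 - d}" "f t > m"
  shows "\<forall>\<^sub>F n in sequentially. \<exists>j\<in>{1..Suc n}. f (d + (real j - 1) * ((1 - 2 * d) / real n)) > m"
proof -
  have "t \<in> {0..1}" using t d by auto
  from cont[unfolded continuous_on_iff, THEN bspec, OF this, THEN spec, of "f t - m"] t(2)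
  obtain \<eta> where \<eta>: "\<eta> > 0" "\<And>s. s \<in> {0..1} \<Longrightarrow> dist s t < \<eta> \<Longrightarrow> dist (f s) (f t) < f t - m"
    by auto
  have "(\<lambda>n. (1 - 2 * d) / real n) \<longlonglongrightarrow> 0" by (rule lim_const_over_n)
  then have "\<forall>\<^sub>F n in sequentially. (1 - 2 * d) / real n < \<eta>" using \<eta>(1) by (rule order_tendstoD)
  then show ?thesis
    using eventually_gt_at_top[of 0]
  proof eventually_elim
    case (elim n)
    define h where "h = (1 - 2 * d) / real n"
    have h: "h > 0" "h < \<eta>" "real n * h = 1 - 2 * d" using elim d by (auto simp: h_def)
    \<comment> \<open>The number of steps to the last grid time not after \<open>t\<close>;
      numbering from 1 makes the witness \<open>Suc j\<close>.\<close>
    define j where "j = nat \<lfloor>(t - d) / h\<rfloor>"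
    have q0: "0 \<le> (t - d) / h" using t h by simp
    have j: "real j \<le> (t - d) / h" "(t - d) / h < real j + 1"
      using q0 by (auto simp: j_def of_nat_nat intro: of_int_floor_le)
    have "real j * h \<le> t - d" "t - d < real j * h + h" using j h by (auto simp: field_simps)
    then have s: "d + real j * h \<le> t" "t < d + real j * h + h" by auto
    have "real j * h \<le> real n * h" using s t h(3) by simp
    then have "j \<le> n" using h(1) by simp
    moreover have "f (d + real j * h) > m"
    proof -
      have "d + real j * h \<in> {0..1}" using s t d h by auto
      moreover have "dist (d + real j * h) t < \<eta>" using s h by (simp add: dist_real_def)
      ultimately show ?thesis using \<eta>(2) by (force simp: dist_real_def)
    qed
    ultimately show ?case unfolding h_def by (intro bexI[of _ "Suc j"]) auto
  qed
qed

text \<open>The mesh limit gives the supremum over \<open>[d l, 1 - d l]\<close>, and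
  \<open>d l\<close> to 0 gives all of \<open>[0, 1]\<close>; at the pinned ends the bound holds
  because \<open>m > 0\<close>. \<open>H\<close> may be any family with this generating
  function.\<close>

lemma max_probability:
  assumes B: "nonintersecting_bridges M N B" and N: "N \<ge> 1" and m: "m > 0"
    and H: "\<And>a z::real. (\<lambda>b. H a b * z ^ b) sums (exp (2 * m * z - 2 * m\<^sup>2) * (2 * m - z) ^ a)"
  shows "measure M {\<omega> \<in> space M. (SUP t\<in>{0..1}. B N t \<omega>) \<le> m} = sdet {..<N} (\<lambda>a b. (if a = b then 1 else 0) - H a b)"
proof -
  interpret M: prob_space M using B by (simp add: nonintersecting_bridges_def)
  have cont: "continuous_on {0..1} (\<lambda>t. B N t \<omega>)" and ends: "B N 0 \<omega> = 0" "B N 1 \<omega> = 0" if "\<omega> \<in> space M" for \<omega>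
    using B N that by (auto simp: nonintersecting_bridges_def)
  define d where "d l = 1 / (real l + 4)" for l :: nat
  have d: "0 < d l" "d l < 1 / 2" for l by (auto simp: d_def field_simps)
  define T where "T l n j = d l + (real j - 1) * ((1 - 2 * d l) / real n)" for l n j
  define E where "E l n = {\<omega> \<in> space M. \<forall>j\<in>{1..Suc (Suc n)}. B N (T l (Suc n) j) \<omega> \<le> m}" for l n
  define E' where "E' l = {\<omega> \<in> space M. \<forall>t\<in>{d l..1 - d l}. B N t \<omega> \<le> m}" for l
  define F where "F = {\<omega> \<in> space M. (SUP t\<in>{0..1}. B N t \<omega>) \<le> m}"
  have T_range: "T l (Suc n) j \<in> {d l..1 - d l}" if "j \<in> {1..Suc (Suc n)}" for l n j
  proof -
    let ?h = "(1 - 2 * d l) / real (Suc n)"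
    have h: "?h > 0" "real (Suc n) * ?h = 1 - 2 * d l" using d[of l] by auto
    have "0 \<le> (real j - 1) * ?h" using h that by (intro mult_nonneg_nonneg) auto
    moreover have "(real j - 1) * ?h \<le> real (Suc n) * ?h" using h that by (intro mult_right_mono) auto
    ultimately show ?thesis unfolding T_def h(2) by auto
  qed
  have Bm: "(\<lambda>\<omega>. B N t \<omega>) \<in> borel_measurable M" if t: "t \<in> {0<..<1}" for t
  proof -
    have "\<forall>k t. 1 \<le> k \<and> strict_mono_on {1..k} t \<and> t ` {1..k} \<subseteq> {0<..<1} \<longrightarrow>
        (\<exists>c>0. distributed M (\<Pi>\<^sub>M p\<in>{1..k} \<times> {1..N}. lborel)
           (\<lambda>\<omega>. \<lambda>(j, i)\<in>{1..k} \<times> {1..N}. B i (t j) \<omega>)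
           (\<lambda>x. ennreal (c * bridges_weight N k t x)))"
      using B unfolding nonintersecting_bridges_def by (elim conjE)
    from this[THEN spec, THEN spec, of 1 "\<lambda>_. t"] t
    have "(\<lambda>\<omega>. \<lambda>(j, i)\<in>{1..1} \<times> {1..N}. B i t \<omega>) \<in> M \<rightarrow>\<^sub>M (\<Pi>\<^sub>M p\<in>{1::nat..1} \<times> {1..N}. lborel)"
      by (auto simp: strict_mono_on_def dest!: distributed_measurable)
    from measurable_compose[OF this measurable_component_singleton[of "(1, N)"]] N show ?thesis by simp
  qed
  have E_sets: "E l n \<in> sets M" for l n
  proof -
    have "(\<lambda>\<omega>. B N (T l (Suc n) j) \<omega>) \<in> borel_measurable M" if "j \<in> {1..Suc (Suc n)}" for j
      using T_range[OF that, of l] d[of l] by (intro Bm) auto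
    then show ?thesis unfolding E_def by (intro sets.sets_Collect_finite_All) auto
  qed
  have E'_sub: "E' l \<subseteq> E l n" for l n
    using T_range by (auto simp: E'_def E_def)
  have E_detect: "\<forall>\<^sub>F n in sequentially. \<omega> \<notin> E l n" if \<omega>: "\<omega> \<in> space M" "\<omega> \<notin> E' l" for \<omega> l
  proof -
    obtain t where t: "t \<in> {d l..1 - d l}" "B N t \<omega> > m" using \<omega> by (auto simp: E'_def not_le)
    have "\<forall>\<^sub>F n in sequentially. \<exists>j\<in>{1..Suc n}. B N (T l n j) \<omega> > m"
      unfolding T_def by (rule grid_detects_excess[OF cont[OF \<omega>(1)] d t])
    then have "\<forall>\<^sub>F n in sequentially. \<exists>j\<in>{1..Suc (Suc n)}. B N (T l (Suc n) j) \<omega> > m"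
      by (rule eventually_sequentially_Suc[THEN iffD2])
    then show ?thesis by eventually_elim (auto simp: E_def not_le)
  qed
  have E'_eq: "E' l = (\<Inter>n. E l n)" for l
  proof (intro equalityI subsetI)
    fix \<omega> assume "\<omega> \<in> (\<Inter>n. E l n)"
    then have *: "\<omega> \<in> E l n" for n by auto
    show "\<omega> \<in> E' l"
    proof (rule ccontr)
      assume "\<omega> \<notin> E' l"
      moreover have "\<omega> \<in> space M" using *[of 0] by (simp add: E_def)
      ultimately show False using E_detect[of \<omega> l] * eventually_happens'[OF sequentially_bot] by blast
    qed
  qed (use E'_sub in auto)
  have E'_sets: "E' l \<in> sets M" for l
    unfolding E'_eq by (intro sets.countable_INT) (use E_sets in auto)
  have lim_n: "(\<lambda>n. measure M (E l n)) \<longlonglongrightarrow> measure M (E' l)" for l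
  proof -
    \<comment> \<open>The grids are not nested, so the events need not decrease in \<open>n\<close>;
      their indicators still converge at every point.\<close>
    have "(\<lambda>n. LINT \<omega>|M. indicator (E l n) \<omega>) \<longlonglongrightarrow> (LINT \<omega>|M. indicator (E' l) \<omega> :: real)"
    proof (rule integral_dominated_convergence[where w = "\<lambda>_. 1"])
      show "AE \<omega> in M. (\<lambda>n. indicator (E l n) \<omega> :: real) \<longlonglongrightarrow> indicator (E' l) \<omega>"
      proof (rule AE_I2)
        fix \<omega> assume \<omega>: "\<omega> \<in> space M"
        have "\<forall>\<^sub>F n in sequentially. indicator (E l n) \<omega> = (indicator (E' l) \<omega> :: real)"
        proof (cases "\<omega> \<in> E' l")
          case True
          then show ?thesis using E'_sub[of l] by (intro always_eventually) (auto simp: indicator_def)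
        next
          case False
          from E_detect[OF \<omega> False] show ?thesis by eventually_elim (simp add: False)
        qed
        then show "(\<lambda>n. indicator (E l n) \<omega> :: real) \<longlonglongrightarrow> indicator (E' l) \<omega>" by (rule tendsto_eventually)
      qed
    qed (use E_sets E'_sets in \<open>auto simp: indicator_def\<close>)
    then show ?thesis
      using E_sets E'_sets by (simp add: Int_absorb2 sets.sets_into_space)
  qed
  have F_eq: "F = (\<Inter>l. E' l)"
  proof -
    have iff: "(SUP t\<in>{0..1}. B N t \<omega>) \<le> m \<longleftrightarrow> (\<forall>t\<in>{0..1}. B N t \<omega> \<le> m)" if "\<omega> \<in> space M" for \<omega>
    proof (rule cSUP_le_iff)
      show "bdd_above ((\<lambda>t. B N t \<omega>) ` {0..1})"
        by (intro bounded_imp_bdd_above compact_imp_bounded compact_continuous_image cont[OF that]) auto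
    qed simp
    have iff2: "(\<forall>t\<in>{0..1}. B N t \<omega> \<le> m) \<longleftrightarrow> (\<forall>l. \<forall>t\<in>{d l..1 - d l}. B N t \<omega> \<le> m)" if "\<omega> \<in> space M" for \<omega>
    proof (intro iffI allI ballI)
      fix l t assume "\<forall>t\<in>{0..1}. B N t \<omega> \<le> m" "t \<in> {d l..1 - d l}"
      then show "B N t \<omega> \<le> m" using d[of l] by auto
    next
      fix t :: real assume *: "\<forall>l. \<forall>t\<in>{d l..1 - d l}. B N t \<omega> \<le> m" and t: "t \<in> {0..1}"
      show "B N t \<omega> \<le> m"
      proof (cases "t = 0 \<or> t = 1")
        case True then show ?thesis using ends[OF that] m by auto
      next
        case False
        then have "0 < min t (1 - t)" using t by auto
        moreover have "d \<longlonglongrightarrow> 0" unfolding d_def by real_asymp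
        ultimately have "\<forall>\<^sub>F l in sequentially. d l < min t (1 - t)" by (intro order_tendstoD(2)) auto
        then obtain l where "d l < min t (1 - t)" using eventually_happens'[OF sequentially_bot] by blast
        then have "t \<in> {d l..1 - d l}" by auto
        then show ?thesis using * by blast
      qed
    qed
    show ?thesis
      unfolding F_def E'_def using iff iff2 by auto
  qed
  have lim_l: "(\<lambda>l. measure M (E' l)) \<longlonglongrightarrow> measure M F"
    unfolding F_eq
  proof (rule M.finite_Lim_measure_decseq)
    show "range E' \<subseteq> sets M" using E'_sets by auto
    have dec: "d l' \<le> d l" if "l \<le> l'" for l l' using that by (auto simp: d_def intro!: divide_left_mono)
    show "decseq E'"
    proof (rule antimonoI)
      fix l l' :: nat assume "l \<le> l'"
      then show "E' l' \<subseteq> E' l" using dec[of l l'] by (auto simp: E'_def)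
    qed
  qed
  define c where "c a = 1 / fact (a - 1) / sqrt (2 * pi)" for a :: nat
  have c_pos: "c a > 0" for a by (simp add: c_def)
  define \<phi> where "\<phi> l a x = gamma_fun (d l) (a - 1) x * indicator {..m} x" for l a x
  define W where "W l n a b = (LINT x|lborel. killed m ((1 - 2 * d l) / real (Suc n)) (\<phi> l a) (Suc n) x * gamma_fun (d l) (b - 1) x)" for l n a b
  define W' where "W' l a b = (LINT x|lborel. (indicator {..m} x * absorbed m (\<phi> l a) (1 - 2 * d l) x) * gamma_fun (d l) (b - 1) x)" for l a b
  have E_prob: "measure M (E l n) = sdet {1..N} (W l n) / (\<Prod>a\<in>{1..N}. c a)" for l n
    using grid_probability_explicit[OF d, of "Suc n" M N B l m] B N
    unfolding E_def T_def W_def[abs_def] \<phi>_def[abs_def] c_def[abs_def] by simp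
  have sdet_lim: "(\<lambda>n. sdet {1..N} (A n)) \<longlonglongrightarrow> sdet {1..N} A'" if "\<And>a b. (\<lambda>n. A n a b) \<longlonglongrightarrow> A' a b" for A :: "nat \<Rightarrow> nat \<Rightarrow> nat \<Rightarrow> real" and A'
    unfolding sdet_def by (intro tendsto_intros that)
  have W_lim: "(\<lambda>n. W l n a b) \<longlonglongrightarrow> W' l a b" for l a b
  proof -
    have dl: "d l < 1" "1 - 2 * d l > 0" using d[of l] by auto
    obtain C where C: "\<And>x. \<bar>gamma_fun (d l) (a - 1) x\<bar> \<le> C" using gamma_fun_bounded[OF d(1) dl(1)] by blast
    show ?thesis
      unfolding W_def W'_def
    proof (rule killed_integral_tendsto[OF dl(2)])
      show "integrable lborel (\<phi> l a)"
        unfolding \<phi>_def by (intro integrable_gamma_fun_mult[OF d(1) dl(1), where W = 1]) (auto simp: indicator_def)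
      show "\<bar>\<phi> l a x\<bar> \<le> C" for x using C[of x] order_trans[OF abs_ge_zero C[of x]] by (auto simp: \<phi>_def indicator_def)
      show "\<phi> l a x = 0" if "x > m" for x using that by (simp add: \<phi>_def)
      show "integrable lborel (gamma_fun (d l) (b - 1))" by (rule integrable_gamma_fun[OF d(1) dl(1)])
    qed
  qed
  have E'_prob: "measure M (E' l) = sdet {1..N} (W' l) / (\<Prod>a\<in>{1..N}. c a)" for l
  proof (rule LIMSEQ_unique[OF lim_n])
    have "(\<Prod>a\<in>{1..N}. c a) \<noteq> 0" using c_pos by (simp add: less_imp_neq[symmetric])
    then show "(\<lambda>n. measure M (E l n)) \<longlonglongrightarrow> sdet {1..N} (W' l) / (\<Prod>a\<in>{1..N}. c a)"
      unfolding E_prob by (intro tendsto_divide sdet_lim W_lim tendsto_const)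
  qed
  \<comment> \<open>The condition is \<open>a - 1 = b - 1\<close> because the claim covers all
    naturals, where truncated subtraction identifies 0 and 1; on \<open>{1..N}\<close> it means
    \<open>a = b\<close>.\<close>
  have W'_lim: "(\<lambda>l. W' l a b) \<longlonglongrightarrow> c a * ((if a - 1 = b - 1 then 1 else 0) - H (a - 1) (b - 1))" for a b
    unfolding W'_def \<phi>_def c_def d_def by (rule restricted_pairing_limit[OF m H])
  have "measure M F = sdet {1..N} (\<lambda>a b. c a * ((if a - 1 = b - 1 then 1 else 0) - H (a - 1) (b - 1))) / (\<Prod>a\<in>{1..N}. c a)"
  proof (rule LIMSEQ_unique[OF lim_l])
    have "(\<Prod>a\<in>{1..N}. c a) \<noteq> 0" using c_pos by (simp add: less_imp_neq[symmetric])
    then show "(\<lambda>l. measure M (E' l)) \<longlonglongrightarrow> sdet {1..N} (\<lambda>a b. c a * ((if a - 1 = b - 1 then 1 else 0) - H (a - 1) (b - 1))) / (\<Prod>a\<in>{1..N}. c a)"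
      unfolding E'_prob by (intro tendsto_divide sdet_lim W'_lim tendsto_const)
  qed
  also have "\<dots> = sdet {1..N} (\<lambda>a b. (if a - 1 = b - 1 then 1 else 0) - H (a - 1) (b - 1))"
    using c_pos by (simp add: sdet_mult_rows less_imp_neq[symmetric])
  also have "\<dots> = sdet {..<N} (\<lambda>a b. (if a = b then 1 else 0) - H a b)"
    using sdet_reindex[OF bij_Suc_lessThan, of N "\<lambda>a b. (if a - 1 = b - 1 then 1 else 0) - H (a - 1) (b - 1)"] by simp
  finally show ?thesis unfolding F_def .
qed

section \<open>The Airy function as a contour integral\<close>

text \<open>Exponent of the contour representation of the Airy function. On a vertical line with
  positive real part \<open>c\<close> its real part contains \<open>- c * s\<^sup>2\<close>, so the
  integral converges absolutely, unlike on the imaginary axis.\<close>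

definition airy_exponent :: "real \<Rightarrow> complex \<Rightarrow> complex" where
  "airy_exponent x z = z ^ 3 / 3 - of_real x * z"

lemma Re_airy_exponent: "Re (airy_exponent x (Complex c s)) = (c ^ 3 / 3 - x * c) - c * s\<^sup>2"
  by (simp add: airy_exponent_def power3_eq_cube power2_eq_square field_simps)

lemma norm_exp_airy_exponent:
  "norm (exp (airy_exponent x (Complex c s))) = exp (c ^ 3 / 3 - x * c) * exp (- (c * s\<^sup>2))"
  by (simp add: Re_airy_exponent flip: exp_add)

lemma continuous_exp_airy_exponent:
  "continuous_on A (\<lambda>s. exp (airy_exponent x (Complex c s)))"
  unfolding airy_exponent_def Complex_eq by (intro continuous_intros) auto

lemma integrable_exp_neg_square:
  assumes "a > 0" shows "integrable lborel (\<lambda>s::real. exp (- (a * s\<^sup>2)))"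
proof -
  have "integrable lborel (\<lambda>s::real. sqrt (2 * pi * (1 / (2 * a))) * normal_density 0 (sqrt (1 / (2 * a))) s)"
    using assms by (intro integrable_mult_right integrable_normal_density) auto
  then show ?thesis
    using assms by (simp add: normal_density_def field_simps)
qed

lemma integrable_exp_airy_exponent:
  assumes "c > 0" shows "integrable lborel (\<lambda>s. exp (airy_exponent x (Complex c s)))"
proof (rule Bochner_Integration.integrable_bound)
  show "integrable lborel (\<lambda>s. exp (c ^ 3 / 3 - x * c) * exp (- (c * s\<^sup>2)))"
    by (intro integrable_mult_right integrable_exp_neg_square assms)
  show "(\<lambda>s. exp (airy_exponent x (Complex c s))) \<in> borel_measurable lborel"
    using borel_measurable_continuous_onI[OF continuous_exp_airy_exponent] by simp
qed (auto simp: norm_exp_airy_exponent simp del: norm_exp_eq_Re)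

text \<open>Cauchy's theorem on the rectangle with corners \<open>\<plusminus>\<i>R\<close> and \<open>c \<plusminus> \<i>R\<close>, phrased through a primitive.\<close>

lemma airy_rectangle:
  assumes "R \<ge> 0" "c \<ge> 0"
  shows "norm (integral {-R..R} (\<lambda>s. exp (airy_exponent x (Complex c s)))
      - integral {-R..R} (\<lambda>s. exp (airy_exponent x (Complex 0 s))))
    \<le> 2 * (exp (c ^ 3 / 3 + \<bar>x\<bar> * c) * integral {0..c} (\<lambda>t. exp (- (t * R\<^sup>2))))"
proof -
  let ?f = "\<lambda>z. exp (airy_exponent x z)"
  have "?f holomorphic_on UNIV"
    unfolding airy_exponent_def by (intro holomorphic_intros) auto
  then obtain F where F: "\<And>z. (F has_field_derivative ?f z) (at z)"
    using holomorphic_convex_primitive'[of UNIV ?f] by auto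
  have vert: "((\<lambda>s. \<i> * ?f (Complex a s)) has_integral (F (Complex a R) - F (Complex a (-R)))) {-R..R}" for a
  proof (rule fundamental_theorem_of_calculus)
    fix s assume "s \<in> {-R..R}"
    have "((\<lambda>s. F (Complex a s)) has_vector_derivative (\<i> * ?f (Complex a s))) (at s)"
      unfolding Complex_eq
      by (rule field_vector_diff_chain_at[where f = "\<lambda>s. of_real a + \<i> * of_real s" and g = F, unfolded o_def, OF _ F])
         (auto intro!: derivative_eq_intros)
    then show "((\<lambda>s. F (Complex a s)) has_vector_derivative (\<i> * ?f (Complex a s))) (at s within {-R..R})"
      by (rule has_vector_derivative_at_within)
  qed (use assms in auto)
  have horiz: "((\<lambda>t. ?f (Complex t b)) has_integral (F (Complex c b) - F (Complex 0 b))) {0..c}" for b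
  proof (rule fundamental_theorem_of_calculus)
    fix t assume "t \<in> {0..c}"
    have "((\<lambda>t. F (Complex t b)) has_vector_derivative (1 * ?f (Complex t b))) (at t)"
      unfolding Complex_eq
      by (rule field_vector_diff_chain_at[where f = "\<lambda>t. of_real t + \<i> * of_real b" and g = F, unfolded o_def, OF _ F])
         (auto intro!: derivative_eq_intros)
    then show "((\<lambda>t. F (Complex t b)) has_vector_derivative ?f (Complex t b)) (at t within {0..c})"
      by (simp add: has_vector_derivative_at_within)
  qed (use assms in auto)
  have bound: "norm (F (Complex c b) - F (Complex 0 b)) \<le> exp (c ^ 3 / 3 + \<bar>x\<bar> * c) * integral {0..c} (\<lambda>t. exp (- (t * b\<^sup>2)))" for b
  proof -
    have "norm (integral {0..c} (\<lambda>t. ?f (Complex t b))) \<le> integral {0..c} (\<lambda>t. exp (c ^ 3 / 3 + \<bar>x\<bar> * c) * exp (- (t * b\<^sup>2)))"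
    proof (rule integral_norm_bound_integral)
      show "(\<lambda>t. ?f (Complex t b)) integrable_on {0..c}" using horiz by blast
      show "(\<lambda>t. exp (c ^ 3 / 3 + \<bar>x\<bar> * c) * exp (- (t * b\<^sup>2))) integrable_on {0..c}"
        by (intro integrable_continuous_interval continuous_intros)
      fix t assume t: "t \<in> {0..c}"
      have "t ^ 3 \<le> c ^ 3" using t by (intro power_mono) auto
      moreover have "- (x * t) \<le> \<bar>x\<bar> * c"
        using t mult_mono[of "\<bar>x\<bar>" "\<bar>x\<bar>" t c] abs_ge_minus_self[of "x * t"] by (auto simp: abs_mult)
      ultimately have "t ^ 3 / 3 - x * t \<le> c ^ 3 / 3 + \<bar>x\<bar> * c" by linarith
      then show "norm (?f (Complex t b)) \<le> exp (c ^ 3 / 3 + \<bar>x\<bar> * c) * exp (- (t * b\<^sup>2))"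
        unfolding norm_exp_airy_exponent by (intro mult_right_mono) auto
    qed
    then show ?thesis
      using integral_unique[OF horiz[of b]] by (simp add: integral_mult_right)
  qed
  have "\<i> * (integral {-R..R} (\<lambda>s. ?f (Complex c s)) - integral {-R..R} (\<lambda>s. ?f (Complex 0 s)))
     = (F (Complex c R) - F (Complex 0 R)) - (F (Complex c (-R)) - F (Complex 0 (-R)))"
    using integral_unique[OF vert[of c]] integral_unique[OF vert[of 0]]
    by (simp add: integral_mult_right algebra_simps)
  then have "norm (integral {-R..R} (\<lambda>s. ?f (Complex c s)) - integral {-R..R} (\<lambda>s. ?f (Complex 0 s)))
     = norm ((F (Complex c R) - F (Complex 0 R)) - (F (Complex c (-R)) - F (Complex 0 (-R))))"
    by (metis mult_1 norm_ii norm_mult)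
  also have "\<dots> \<le> norm (F (Complex c R) - F (Complex 0 R)) + norm (F (Complex c (-R)) - F (Complex 0 (-R)))"
    by (rule norm_triangle_ineq4)
  finally show ?thesis
    using bound[of R] bound[of "-R"] by simp
qed

text \<open>With \<open>a = R\<^sup>2\<close> it makes the horizontal sides of the rectangle vanish
  like \<open>1 / R\<^sup>2\<close>.\<close>

lemma integral_exp_linear_le:
  fixes a :: real assumes "a > 0" "c \<ge> 0"
  shows "integral {0..c} (\<lambda>t. exp (- (t * a))) \<le> 1 / a"
proof -
  have "((\<lambda>t. exp (- (t * a))) has_integral ((- exp (- (c * a)) / a) - (- exp (- (0 * a)) / a))) {0..c}"
  proof (rule fundamental_theorem_of_calculus)
    fix t assume "t \<in> {0..c}"
    show "((\<lambda>t. - exp (- (t * a)) / a) has_vector_derivative exp (- (t * a))) (at t within {0..c})"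
      using assms by (auto intro!: derivative_eq_intros simp flip: has_real_derivative_iff_has_vector_derivative)
  qed (use assms in auto)
  then have "integral {0..c} (\<lambda>t. exp (- (t * a))) = (1 - exp (- (c * a))) / a"
    by (simp add: integral_unique diff_divide_distrib)
  then show ?thesis using assms by (simp add: divide_right_mono)
qed

lemma integral_imaginary_axis:
  assumes "R \<ge> 0"
  shows "Re (integral {-R..R} (\<lambda>s. exp (airy_exponent x (Complex 0 s)))) = 2 * integral {0..R} (\<lambda>s. cos (s ^ 3 / 3 + x * s))"
proof -
  let ?g = "\<lambda>s. cos (s ^ 3 / 3 + x * s)"
  have "Re (exp (airy_exponent x (Complex 0 s))) = ?g s" for s
  proof -
    have "airy_exponent x (Complex 0 s) = \<i> * of_real (- (s ^ 3 / 3 + x * s))"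
      by (simp add: airy_exponent_def Complex_eq power3_eq_cube field_simps)
    then have "exp (airy_exponent x (Complex 0 s)) = cis (- (s ^ 3 / 3 + x * s))"
      by (simp only: cis_conv_exp)
    then show ?thesis by (simp only: cis.sel cos_minus)
  qed
  moreover have "Re (integral {-R..R} (\<lambda>s. exp (airy_exponent x (Complex 0 s)))) = integral {-R..R} (\<lambda>s. Re (exp (airy_exponent x (Complex 0 s))))"
    using integral_linear[OF integrable_continuous_interval[OF continuous_exp_airy_exponent] bounded_linear_Re]
    by (simp add: o_def)
  ultimately have "Re (integral {-R..R} (\<lambda>s. exp (airy_exponent x (Complex 0 s)))) = integral {-R..R} ?g" by simp
  also have "\<dots> = integral {-R..0} ?g + integral {0..R} ?g"
    using assms by (intro Henstock_Kurzweil_Integration.integral_combine[symmetric] integrable_continuous_interval continuous_intros) auto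
  also have "integral {-R..0} ?g = integral {0..R} (\<lambda>s. ?g (- s))"
    using Henstock_Kurzweil_Integration.integral_reflect_real[where f = "\<lambda>s. ?g (- s)" and a = 0 and b = R] by simp
  also have "(\<lambda>s. ?g (- s)) = ?g"
    using cos_minus[of "_ ^ 3 / 3 + x * _"] by (auto simp: fun_eq_iff)
  finally show ?thesis by simp
qed

text \<open>Shifting the line costs a vanishing amount, and the shifted integral converges
  absolutely. This also proves that the limit in \<open>airy\<close> exists, without which
  \<open>Lim\<close> would carry no information.\<close>

lemma airy_eq_contour_integral:
  assumes "c > 0"
  shows "airy x = Re (LINT s|lborel. exp (airy_exponent x (Complex c s))) / (2 * pi)"
proof -
  let ?h = "\<lambda>s. exp (airy_exponent x (Complex c s))"
  let ?I = "LINT s|lborel. ?h s"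
  have "((\<lambda>R. LINT s:{-R..R}|lborel. ?h s) \<longlongrightarrow> ?I) at_top"
  proof -
    have "((\<lambda>R. LINT s|lborel. indicator {-R..R} s *\<^sub>R ?h s) \<longlongrightarrow> ?I) at_top"
    proof (rule integral_dominated_convergence_at_top[where w = "\<lambda>s. norm (?h s)"])
      show "integrable lborel (\<lambda>s. norm (?h s))"
        using integrable_exp_airy_exponent[OF assms] by (rule integrable_norm)
      show "AE s in lborel. ((\<lambda>R. indicator {-R..R} s *\<^sub>R ?h s) \<longlongrightarrow> ?h s) at_top"
      proof (rule AE_I2)
        fix s :: real
        have "\<forall>\<^sub>F R in at_top. indicator {-R..R} s *\<^sub>R ?h s = ?h s"
          using eventually_ge_at_top[of "\<bar>s\<bar>"] by eventually_elim (auto simp: indicator_def)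
        then show "((\<lambda>R. indicator {-R..R} s *\<^sub>R ?h s) \<longlongrightarrow> ?h s) at_top"
          by (rule tendsto_eventually)
      qed
    qed (use integrable_exp_airy_exponent[OF assms, of x] in \<open>auto simp: indicator_def\<close>)
    then show ?thesis by (simp add: set_lebesgue_integral_def)
  qed
  moreover have "(LINT s:{-R..R}|lborel. ?h s) = integral {-R..R} ?h" for R
    by (intro set_borel_integral_eq_integral(2) borel_integrable_atLeastAtMost')
       (use continuous_exp_airy_exponent in auto)
  ultimately have lim1: "((\<lambda>R. integral {-R..R} ?h) \<longlongrightarrow> ?I) at_top" by simp
  have lim2: "((\<lambda>R. integral {-R..R} ?h - integral {-R..R} (\<lambda>s. exp (airy_exponent x (Complex 0 s)))) \<longlongrightarrow> 0) at_top"
  proof (rule Lim_null_comparison)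
    show "\<forall>\<^sub>F R in at_top. norm (integral {-R..R} ?h - integral {-R..R} (\<lambda>s. exp (airy_exponent x (Complex 0 s))))
      \<le> 2 * (exp (c ^ 3 / 3 + \<bar>x\<bar> * c) * (1 / R\<^sup>2))"
      using eventually_gt_at_top[of 0]
    proof eventually_elim
      case (elim R)
      have "2 * (exp (c ^ 3 / 3 + \<bar>x\<bar> * c) * integral {0..c} (\<lambda>t. exp (- (t * R\<^sup>2))))
         \<le> 2 * (exp (c ^ 3 / 3 + \<bar>x\<bar> * c) * (1 / R\<^sup>2))"
        using integral_exp_linear_le[of "R\<^sup>2" c] elim assms by (intro mult_left_mono) auto
      then show ?case using airy_rectangle[of R c x] elim assms by linarith
    qed
    show "((\<lambda>R. 2 * (exp (c ^ 3 / 3 + \<bar>x\<bar> * c) * (1 / R\<^sup>2))) \<longlongrightarrow> 0) at_top"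
      by (auto intro!: tendsto_mult_right_zero real_tendsto_divide_at_top filterlim_pow_at_top filterlim_ident)
  qed
  have "((\<lambda>R. integral {-R..R} (\<lambda>s. exp (airy_exponent x (Complex 0 s)))) \<longlongrightarrow> ?I - 0) at_top"
    using tendsto_diff[OF lim1 lim2] by simp
  then have "((\<lambda>R. Re (integral {-R..R} (\<lambda>s. exp (airy_exponent x (Complex 0 s)))) / 2) \<longlongrightarrow> Re ?I / 2) at_top"
    by (intro tendsto_intros) auto
  then have "((\<lambda>R. integral {0..R} (\<lambda>s. cos (s ^ 3 / 3 + x * s))) \<longlongrightarrow> Re ?I / 2) at_top"
    by (rule Lim_transform_eventually)
       (use eventually_ge_at_top[of 0] in \<open>eventually_elim, simp add: integral_imaginary_axis\<close>)
  then have lim: "Lim at_top (\<lambda>R. integral {0..R} (\<lambda>s. cos (s ^ 3 / 3 + x * s))) = Re ?I / 2"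
    by (intro tendsto_Lim) auto
  show ?thesis unfolding airy_def lim by simp
qed

section \<open>Steepest descent at the edge\<close>

text \<open>The remainder vanishes at 0 and has derivative \<open>- w ^ 3 / (1 + w)\<close>, whose
  denominator is at least \<open>1 / 2\<close> in modulus.\<close>

lemma Ln_cubic_approx:
  fixes z :: complex
  assumes z: "norm z \<le> 1 / 2"
  shows "norm (Ln (1 + z) - z + z\<^sup>2 / 2 - z ^ 3 / 3) \<le> 2 * norm z ^ 4"
proof -
  let ?S = "cball (0::complex) (norm z)"
  define g where "g w = Ln (1 + w) - w + w\<^sup>2 / 2 - w ^ 3 / 3" for w :: complex
  have "norm (g z - g 0) \<le> 2 * norm z ^ 3 * norm (z - 0)"
  proof (rule field_differentiable_bound[of ?S])
    fix w assume w: "w \<in> ?S"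
    then have w2: "norm w \<le> 1 / 2" using z by simp
    have pos: "0 < Re (1 + w)" using abs_Re_le_cmod[of w] w2 by simp
    then have nr: "1 + w \<notin> \<real>\<^sub>\<le>\<^sub>0" by (auto simp: complex_nonpos_Reals_iff)
    have nz: "1 + w \<noteq> 0" using pos by (metis less_irrefl zero_complex.simps(1))
    have "((\<lambda>w. Ln (1 + w)) has_field_derivative inverse (1 + w)) (at w within ?S)"
      using nr by (auto intro!: derivative_eq_intros)
    moreover have "((\<lambda>w. w\<^sup>2 / 2) has_field_derivative w) (at w within ?S)"
      by (auto intro!: derivative_eq_intros)
    moreover have "((\<lambda>w. w ^ 3 / 3) has_field_derivative w\<^sup>2) (at w within ?S)"
      by (auto intro!: derivative_eq_intros)
    ultimately have "(g has_field_derivative (inverse (1 + w) - 1 + w - w\<^sup>2)) (at w within ?S)"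
      unfolding g_def by (intro DERIV_diff DERIV_add DERIV_ident)
    moreover have "inverse (1 + w) - 1 + w - w\<^sup>2 = - (w ^ 3) / (1 + w)"
      using nz by (simp add: field_simps power2_eq_square power3_eq_cube)
    ultimately show "(g has_field_derivative (- (w ^ 3) / (1 + w))) (at w within ?S)" by simp
    have "1 / 2 \<le> norm (1 + w)" using norm_triangle_ineq2[of 1 "- w"] w2 by simp
    moreover have "norm w ^ 3 \<le> norm z ^ 3" using w by (intro power_mono) auto
    ultimately have "norm w ^ 3 / norm (1 + w) \<le> norm z ^ 3 / (1 / 2)" by (intro frac_le) auto
    then show "norm (- (w ^ 3) / (1 + w)) \<le> 2 * norm z ^ 3" by (simp add: norm_divide norm_power)
  qed auto
  then show ?thesis by (simp add: g_def power_eq_if[of _ 4] mult_ac numeral_eq_Suc)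
qed

text \<open>Maclaurin expansion to order 4 together with \<open>x\<^sup>2 \<le> 10\<close>: the
  constant is \<open>1 / 2 - 10 / 24 = 1 / 12\<close>.\<close>

lemma one_minus_cos_ge:
  assumes "\<bar>x\<bar> \<le> pi"
  shows "x\<^sup>2 / 12 \<le> 1 - cos x"
proof -
  obtain t where t: "cos x = (\<Sum>m<4. cos_coeff m * x ^ m) + cos (t + 1 / 2 * real 4 * pi) / fact 4 * x ^ 4"
    using Maclaurin_cos_expansion[of x 4] by blast
  have "(\<Sum>m<4. cos_coeff m * x ^ m) = 1 - x\<^sup>2 / 2"
  proof -
    have "{..<4::nat} = {0, 1, 2, 3}" by auto
    then show ?thesis by (simp add: cos_coeff_def)
  qed
  moreover have "cos (t + 1 / 2 * real 4 * pi) / fact 4 * x ^ 4 \<le> 1 / 24 * x ^ 4"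
    by (intro mult_right_mono) (auto simp: fact_numeral)
  ultimately have "cos x \<le> 1 - x\<^sup>2 / 2 + x ^ 4 / 24" using t by simp
  moreover have "x ^ 4 \<le> 10 * x\<^sup>2"
  proof -
    have "x\<^sup>2 \<le> pi\<^sup>2" using assms by (simp add: abs_le_square_iff[symmetric])
    also have "pi\<^sup>2 \<le> (3.15 :: real)\<^sup>2" using pi_approx by (intro power_mono) auto
    also have "\<dots> \<le> 10" by (simp add: power2_eq_square)
    finally have "x\<^sup>2 * x\<^sup>2 \<le> 10 * x\<^sup>2" by (intro mult_right_mono) auto
    then show ?thesis by (simp add: numeral_eq_Suc)
  qed
  ultimately show ?thesis by simp
qed

text \<open>At the double saddle \<open>u = 1\<close> the function
  \<open>2 * u + ln (2 - u) - ln u\<close> has vanishing first and second derivative and third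
  derivative -4. With \<open>N = kap N ^ 3 / 2\<close> and \<open>u = 1 + L / kap N\<close> the
  large exponent becomes \<open>- L ^ 3 / 3\<close>, as in the Airy integral.\<close>

definition kap :: "nat \<Rightarrow> real" where "kap N = (2 * real N) powr (1 / 3)"

lemma kap_cube: "kap N ^ 3 = 2 * real N"
proof (cases "N = 0")
  case False
  then show ?thesis unfolding kap_def by (subst powr_realpow[symmetric]) (auto simp: powr_powr)
qed (simp add: kap_def)

lemma kap_at_top: "filterlim kap at_top sequentially"
  unfolding kap_def by real_asymp

lemma kap_gt: "\<forall>\<^sub>F N in sequentially. c < kap N"
  using kap_at_top by (simp add: filterlim_at_top_dense)

lemma inverse_kap_tendsto: "(\<lambda>N. 1 / kap N) \<longlonglongrightarrow> 0"
  using tendsto_inverse_0_at_top[OF kap_at_top] by (simp add: inverse_eq_divide)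

lemma scaled_imp_null:
  assumes "(\<lambda>N. of_real (kap N) * \<xi> N) \<longlonglongrightarrow> (l :: complex)"
  shows "\<xi> \<longlonglongrightarrow> 0"
proof -
  have "(\<lambda>N. of_real (1 / kap N) * (of_real (kap N) * \<xi> N)) \<longlonglongrightarrow> of_real 0 * l"
    by (intro tendsto_mult tendsto_of_real inverse_kap_tendsto assms)
  moreover have "\<forall>\<^sub>F N in sequentially. of_real (1 / kap N) * (of_real (kap N) * \<xi> N) = \<xi> N"
    using kap_gt[of 0] by eventually_elim simp
  ultimately show ?thesis using tendsto_cong by fastforce
qed

text \<open>Of order \<open>kap N\<close> factors, each at distance of order
  \<open>1 / kap N\<close> from 1, leave only the linear term of the logarithm.\<close>

lemma power_scaled_limit:
  assumes \<xi>: "(\<lambda>N. of_real (kap N) * \<xi> N) \<longlonglongrightarrow> (l :: complex)"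
    and i: "(\<lambda>N. real (i N) / kap N) \<longlonglongrightarrow> \<beta>"
  shows "(\<lambda>N. (1 + \<xi> N) ^ i N) \<longlonglongrightarrow> exp (of_real \<beta> * l)"
proof -
  have \<xi>0: "\<xi> \<longlonglongrightarrow> 0" by (rule scaled_imp_null[OF \<xi>])
  then have n0: "(\<lambda>N. norm (\<xi> N)) \<longlonglongrightarrow> 0" by (simp add: tendsto_norm_zero_iff)
  have small: "\<forall>\<^sub>F N in sequentially. norm (\<xi> N) < 1 / 2"
    using n0 by (rule order_tendstoD) simp
  have err: "(\<lambda>N. of_real (kap N) * (Ln (1 + \<xi> N) - \<xi> N)) \<longlonglongrightarrow> 0"
  proof (rule Lim_null_comparison)
    show "(\<lambda>N. norm (of_real (kap N) * \<xi> N) * norm (\<xi> N) * 2) \<longlonglongrightarrow> 0"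
      using tendsto_mult[OF tendsto_mult[OF tendsto_norm[OF \<xi>] n0] tendsto_const[of "2::real"]] by simp
    show "\<forall>\<^sub>F N in sequentially. norm (of_real (kap N) * (Ln (1 + \<xi> N) - \<xi> N)) \<le> norm (of_real (kap N) * \<xi> N) * norm (\<xi> N) * 2"
      using small
    proof eventually_elim
      case (elim N)
      have "norm (Ln (1 + \<xi> N) - \<xi> N) \<le> norm (\<xi> N) ^ 2 / (1 - norm (\<xi> N))"
        using elim by (intro Ln_approx_linear) auto
      also have "\<dots> \<le> norm (\<xi> N) ^ 2 / (1 / 2)" using elim by (intro divide_left_mono) auto
      finally have "norm (Ln (1 + \<xi> N) - \<xi> N) \<le> norm (\<xi> N) * norm (\<xi> N) * 2" by (simp add: power2_eq_square)
      from mult_left_mono[OF this abs_ge_zero[of "kap N"]] show ?case by (simp add: norm_mult mult_ac)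
    qed
  qed
  have "(\<lambda>N. of_real (kap N) * (Ln (1 + \<xi> N) - \<xi> N) + of_real (kap N) * \<xi> N) \<longlonglongrightarrow> 0 + l"
    by (intro tendsto_add err \<xi>)
  then have "(\<lambda>N. of_real (kap N) * Ln (1 + \<xi> N)) \<longlonglongrightarrow> l" by (simp add: algebra_simps)
  then have "(\<lambda>N. exp (of_real (real (i N) / kap N) * (of_real (kap N) * Ln (1 + \<xi> N)))) \<longlonglongrightarrow> exp (of_real \<beta> * l)"
    by (intro tendsto_exp tendsto_mult tendsto_of_real i)
  moreover have "\<forall>\<^sub>F N in sequentially. exp (of_real (real (i N) / kap N) * (of_real (kap N) * Ln (1 + \<xi> N))) = (1 + \<xi> N) ^ i N"
    using small kap_gt[of 0]
  proof eventually_elim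
    case (elim N)
    have "1 + \<xi> N \<noteq> 0" using elim(1) norm_triangle_ineq2[of 1 "- \<xi> N"] by (metis add_eq_0_iff norm_minus_cancel norm_one less_divide_eq_1_pos not_less_iff_gr_or_eq zero_less_numeral one_less_numeral_iff semiring_norm(76) order_less_asym)
    moreover have "of_real (real (i N) / kap N) * (of_real (kap N) * Ln (1 + \<xi> N)) = of_nat (i N) * Ln (1 + \<xi> N)"
      using elim(2) by simp
    ultimately show ?case by (simp add: exp_of_nat_mult)
  qed
  ultimately show ?thesis by (rule Lim_transform_eventually)
qed

text \<open>With \<open>N = kap N ^ 3 / 2\<close> factors the linear and quadratic terms of the
  logarithm need not stay bounded; the exponential removes them, and
  \<open>N * \<xi> ^ 3 / 3\<close> tends to \<open>l ^ 3 / 6\<close>.\<close>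

lemma power_cubic_limit:
  assumes \<xi>: "(\<lambda>N. of_real (kap N) * \<xi> N) \<longlonglongrightarrow> (l :: complex)"
  shows "(\<lambda>N. (1 + \<xi> N) ^ N * exp (of_nat N * (- \<xi> N + (\<xi> N)\<^sup>2 / 2))) \<longlonglongrightarrow> exp (l ^ 3 / 6)"
proof -
  have \<xi>0: "\<xi> \<longlonglongrightarrow> 0" by (rule scaled_imp_null[OF \<xi>])
  then have n0: "(\<lambda>N. norm (\<xi> N)) \<longlonglongrightarrow> 0" by (simp add: tendsto_norm_zero_iff)
  have small: "\<forall>\<^sub>F N in sequentially. norm (\<xi> N) < 1 / 2"
    using n0 by (rule order_tendstoD) simp
  have N_eq: "of_nat N = (of_real (kap N) ^ 3 / 2 :: complex)" for N
    using kap_cube[of N] by (metis (mono_tags, lifting) nonzero_mult_div_cancel_left of_real_divide of_real_numeral of_real_of_nat_eq of_real_power zero_neq_numeral)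
  have err: "(\<lambda>N. of_nat N * (Ln (1 + \<xi> N) - \<xi> N + (\<xi> N)\<^sup>2 / 2 - \<xi> N ^ 3 / 3)) \<longlonglongrightarrow> 0"
  proof (rule Lim_null_comparison)
    show "(\<lambda>N. norm (of_real (kap N) * \<xi> N) ^ 3 * norm (\<xi> N)) \<longlonglongrightarrow> 0"
      using tendsto_mult[OF tendsto_power[OF tendsto_norm[OF \<xi>], of 3] n0] by simp
    show "\<forall>\<^sub>F N in sequentially. norm (of_nat N * (Ln (1 + \<xi> N) - \<xi> N + (\<xi> N)\<^sup>2 / 2 - \<xi> N ^ 3 / 3)) \<le> norm (of_real (kap N) * \<xi> N) ^ 3 * norm (\<xi> N)"
      using small kap_gt[of 0]
    proof eventually_elim
      case (elim N)
      have "norm (of_nat N * (Ln (1 + \<xi> N) - \<xi> N + (\<xi> N)\<^sup>2 / 2 - \<xi> N ^ 3 / 3)) \<le> real N * (2 * norm (\<xi> N) ^ 4)"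
        unfolding norm_mult using Ln_cubic_approx[of "\<xi> N"] elim by (intro mult_mono) auto
      also have "\<dots> = (kap N) ^ 3 * norm (\<xi> N) ^ 4" by (simp add: kap_cube)
      also have "\<dots> = norm (of_real (kap N) * \<xi> N) ^ 3 * norm (\<xi> N)"
        using elim by (simp add: norm_mult power_mult_distrib power_eq_if[of _ 4] power3_eq_cube)
      finally show ?case .
    qed
  qed
  have "(\<lambda>N. of_nat N * (Ln (1 + \<xi> N) - \<xi> N + (\<xi> N)\<^sup>2 / 2 - \<xi> N ^ 3 / 3) + (of_real (kap N) * \<xi> N) ^ 3 / 6) \<longlonglongrightarrow> 0 + l ^ 3 / 6"
    by (intro tendsto_intros err \<xi>) auto
  moreover have "of_nat N * (Ln (1 + \<xi> N) - \<xi> N + (\<xi> N)\<^sup>2 / 2 - \<xi> N ^ 3 / 3) + (of_real (kap N) * \<xi> N) ^ 3 / 6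
     = of_nat N * (Ln (1 + \<xi> N) + (- \<xi> N + (\<xi> N)\<^sup>2 / 2))" for N
    unfolding N_eq by (simp add: field_simps)
  ultimately have "(\<lambda>N. exp (of_nat N * (Ln (1 + \<xi> N) + (- \<xi> N + (\<xi> N)\<^sup>2 / 2)))) \<longlonglongrightarrow> exp (l ^ 3 / 6)"
    by (intro tendsto_exp) simp
  moreover have "\<forall>\<^sub>F N in sequentially. exp (of_nat N * (Ln (1 + \<xi> N) + (- \<xi> N + (\<xi> N)\<^sup>2 / 2))) = (1 + \<xi> N) ^ N * exp (of_nat N * (- \<xi> N + (\<xi> N)\<^sup>2 / 2))"
    using small
  proof eventually_elim
    case (elim N)
    have "1 + \<xi> N \<noteq> 0" using elim by (metis add_eq_0_iff norm_minus_cancel norm_one less_divide_eq_1_pos not_less_iff_gr_or_eq zero_less_numeral one_less_numeral_iff semiring_norm(76) order_less_asym)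
    then show ?case by (simp add: distrib_left exp_add exp_of_nat_mult)
  qed
  ultimately show ?thesis by (rule Lim_transform_eventually)
qed

text \<open>Displacement of the contour from the saddle at 1, in units of \<open>1 / kap N\<close>;
  the real part -1 comes from the radius of the circle.\<close>

definition ell :: "real \<Rightarrow> complex" where "ell s = \<i> * of_real s - 1"

text \<open>The Taylor variable in units of \<open>sqrt N\<close>, on a circle of radius slightly
  below the saddle. Being inside makes powers of \<open>upt_pt\<close> and of the inverse of
  \<open>vpt\<close> decay geometrically in the indices.\<close>

definition upt_pt :: "nat \<Rightarrow> real \<Rightarrow> complex" where
  "upt_pt N s = of_real (1 - 1 / kap N) * exp (\<i> * of_real (s / kap N))"

text \<open>The quantity \<open>2 * m\<close> in units of \<open>sqrt N\<close> at the edge scaling;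
  accordingly \<open>vpt\<close> is the reflected variable \<open>2 * m - z\<close> in these
  units.\<close>

definition qpt :: "real \<Rightarrow> nat \<Rightarrow> real" where
  "qpt R N = 2 + R / (kap N)\<^sup>2"

definition vpt :: "real \<Rightarrow> nat \<Rightarrow> real \<Rightarrow> complex" where
  "vpt R N s = of_real (qpt R N) - upt_pt N s"

text \<open>The Taylor integrand with both indices replaced by \<open>N\<close>:
  \<open>exp (2 * m * z - 2 * m\<^sup>2) * ((2 * m - z) / z) ^ N\<close>, where the powers of
  \<open>sqrt N\<close> cancel.\<close>

definition phase :: "real \<Rightarrow> nat \<Rightarrow> real \<Rightarrow> complex" where
  "phase R N s = exp (of_nat N * (of_real (qpt R N) * upt_pt N s - of_real ((qpt R N)\<^sup>2 / 2))) * (vpt R N s / upt_pt N s) ^ N"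

lemma upt_scaled: "(\<lambda>N. of_real (kap N) * (upt_pt N s - 1)) \<longlonglongrightarrow> ell s"
proof -
  let ?w = "\<i> * of_real s :: complex"
  have "((\<lambda>h. (exp (h * ?w) - exp (0 * ?w)) / (h - 0)) \<longlongrightarrow> ?w) (at 0)"
  proof -
    have "((\<lambda>h. exp (h * ?w)) has_field_derivative ?w) (at 0)" by (auto intro!: derivative_eq_intros)
    then show ?thesis by (simp only: has_field_derivative_iff)
  qed
  moreover have "filterlim (\<lambda>N. of_real (1 / kap N) :: complex) (at 0) sequentially"
  proof (rule filterlim_atI)
    show "(\<lambda>N. of_real (1 / kap N) :: complex) \<longlonglongrightarrow> 0"
      using tendsto_of_real[OF inverse_kap_tendsto, where 'a = complex] by simp
    show "\<forall>\<^sub>F N in sequentially. of_real (1 / kap N) \<noteq> (0 :: complex)"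
      using kap_gt[of 0] by eventually_elim simp
  qed
  ultimately have "(\<lambda>N. (exp (of_real (1 / kap N) * ?w) - exp (0 * ?w)) / (of_real (1 / kap N) - 0)) \<longlonglongrightarrow> ?w"
    by (rule filterlim_compose)
  then have A: "(\<lambda>N. of_real (kap N) * (exp (of_real (1 / kap N) * ?w) - 1)) \<longlonglongrightarrow> ?w"
    by (simp add: mult.commute)
  have "(\<lambda>N. exp (of_real (1 / kap N) * ?w)) \<longlonglongrightarrow> exp (of_real 0 * ?w)"
    by (intro tendsto_intros inverse_kap_tendsto)
  from tendsto_diff[OF A this]
  have "(\<lambda>N. of_real (kap N) * (exp (of_real (1 / kap N) * ?w) - 1) - exp (of_real (1 / kap N) * ?w)) \<longlonglongrightarrow> ?w - 1" by simp
  moreover have "\<forall>\<^sub>F N in sequentially. of_real (kap N) * (exp (of_real (1 / kap N) * ?w) - 1) - exp (of_real (1 / kap N) * ?w) = of_real (kap N) * (upt_pt N s - 1)"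
    using kap_gt[of 0] by eventually_elim (simp add: upt_pt_def field_simps)
  ultimately show ?thesis
    unfolding ell_def by (rule Lim_transform_eventually)
qed

lemma vpt_scaled: "(\<lambda>N. of_real (kap N) * (vpt R N s - 1)) \<longlonglongrightarrow> - ell s"
proof -
  have "(\<lambda>N. - (of_real (kap N) * (upt_pt N s - 1)) + of_real (R * (1 / kap N))) \<longlonglongrightarrow> - ell s + of_real (R * 0)"
    by (intro tendsto_intros upt_scaled inverse_kap_tendsto)
  moreover have "\<forall>\<^sub>F N in sequentially. - (of_real (kap N) * (upt_pt N s - 1)) + of_real (R * (1 / kap N)) = of_real (kap N) * (vpt R N s - 1)"
    using kap_gt[of 0] by eventually_elim (simp add: vpt_def qpt_def field_simps power2_eq_square)
  ultimately show ?thesis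
    using Lim_transform_eventually by fastforce
qed

text \<open>Put \<open>u = 1 + \<eta>\<close> and \<open>v = 1 + \<xi>\<close>. Since
  \<open>u + v\<close> is \<open>qpt R N\<close>, the exponential splits into the compensators of
  \<open>v ^ N\<close> and \<open>u ^ N\<close> and the rest
  \<open>N * (\<eta>\<^sup>2 - \<xi>\<^sup>2)\<close>. The powers give
  \<open>(- L) ^ 3 / 6 - L ^ 3 / 6\<close>, and the rest tends to \<open>R * L\<close> because
  \<open>\<eta> + \<xi> = R / (kap N)\<^sup>2\<close>.\<close>

lemma phase_tendsto:
  "(\<lambda>N. phase R N s) \<longlonglongrightarrow> exp (- (ell s ^ 3) / 3 + of_real R * ell s)"
proof -
  define L where "L = ell s"
  define \<eta> \<xi> where "\<eta> N = upt_pt N s - 1" and "\<xi> N = vpt R N s - 1" for N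
  have \<eta>: "(\<lambda>N. of_real (kap N) * \<eta> N) \<longlonglongrightarrow> L" unfolding \<eta>_def L_def by (rule upt_scaled)
  have \<xi>: "(\<lambda>N. of_real (kap N) * \<xi> N) \<longlonglongrightarrow> - L" unfolding \<xi>_def L_def by (rule vpt_scaled)
  have "(\<lambda>N. of_real R * (of_real (kap N) * \<eta> N) - of_real (R\<^sup>2 / 2 * (1 / kap N))) \<longlonglongrightarrow> of_real R * L - of_real (R\<^sup>2 / 2 * 0)"
    by (intro tendsto_intros \<eta> inverse_kap_tendsto)
  then have lim3: "(\<lambda>N. exp (of_real R * (of_real (kap N) * \<eta> N) - of_real (R\<^sup>2 / 2 * (1 / kap N)))) \<longlonglongrightarrow> exp (of_real R * L)"
    by (intro tendsto_exp) simp
  have "(\<lambda>N. ((1 + \<xi> N) ^ N * exp (of_nat N * (- \<xi> N + (\<xi> N)\<^sup>2 / 2))) / ((1 + \<eta> N) ^ N * exp (of_nat N * (- \<eta> N + (\<eta> N)\<^sup>2 / 2)))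
       * exp (of_real R * (of_real (kap N) * \<eta> N) - of_real (R\<^sup>2 / 2 * (1 / kap N))))
    \<longlonglongrightarrow> exp ((- L) ^ 3 / 6) / exp (L ^ 3 / 6) * exp (of_real R * L)"
    by (intro tendsto_mult tendsto_divide power_cubic_limit \<xi> \<eta> lim3) auto
  also have "exp ((- L) ^ 3 / 6) / exp (L ^ 3 / 6) * exp (of_real R * L) = exp (- (L ^ 3) / 3 + of_real R * L)"
    by (simp add: exp_diff[symmetric] exp_add[symmetric] power3_eq_cube mult.assoc)
  finally have main: "(\<lambda>N. ((1 + \<xi> N) ^ N * exp (of_nat N * (- \<xi> N + (\<xi> N)\<^sup>2 / 2))) / ((1 + \<eta> N) ^ N * exp (of_nat N * (- \<eta> N + (\<eta> N)\<^sup>2 / 2)))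
       * exp (of_real R * (of_real (kap N) * \<eta> N) - of_real (R\<^sup>2 / 2 * (1 / kap N))))
    \<longlonglongrightarrow> exp (- (L ^ 3) / 3 + of_real R * L)" .
  have "\<forall>\<^sub>F N in sequentially. ((1 + \<xi> N) ^ N * exp (of_nat N * (- \<xi> N + (\<xi> N)\<^sup>2 / 2))) / ((1 + \<eta> N) ^ N * exp (of_nat N * (- \<eta> N + (\<eta> N)\<^sup>2 / 2)))
       * exp (of_real R * (of_real (kap N) * \<eta> N) - of_real (R\<^sup>2 / 2 * (1 / kap N))) = phase R N s"
    using kap_gt[of 0]
  proof eventually_elim
    case (elim N)
    define k where "k = (of_real (kap N) :: complex)"
    have k0: "k \<noteq> 0" using elim by (simp add: k_def)
    have N_eq: "of_nat N = k ^ 3 / 2"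
      unfolding k_def using kap_cube[of N] by (metis (mono_tags, lifting) nonzero_mult_div_cancel_left of_real_divide of_real_numeral of_real_of_nat_eq of_real_power zero_neq_numeral)
    have q: "of_real (qpt R N) = 2 + of_real R / k\<^sup>2" by (simp add: qpt_def k_def)
    have xi: "\<xi> N = of_real R / k\<^sup>2 - \<eta> N" by (simp add: \<xi>_def \<eta>_def vpt_def q)
    have u: "upt_pt N s = 1 + \<eta> N" and v: "vpt R N s = 1 + \<xi> N" by (simp_all add: \<eta>_def \<xi>_def)
    have e3: "of_real R * (of_real (kap N) * \<eta> N) - of_real (R\<^sup>2 / 2 * (1 / kap N)) = of_nat N * ((\<eta> N)\<^sup>2 - (\<xi> N)\<^sup>2)"
      unfolding N_eq xi using k0 by (simp add: k_def[symmetric] field_simps power2_eq_square power3_eq_cube)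
    have "of_nat N * (of_real (qpt R N) * upt_pt N s - of_real ((qpt R N)\<^sup>2 / 2))
       = of_nat N * (- \<xi> N + (\<xi> N)\<^sup>2 / 2) - of_nat N * (- \<eta> N + (\<eta> N)\<^sup>2 / 2) + of_nat N * ((\<eta> N)\<^sup>2 - (\<xi> N)\<^sup>2)"
    proof -
      have "of_real (qpt R N) = (1 + \<eta> N) + (1 + \<xi> N)" by (simp add: xi q)
      then have "of_real (qpt R N) * upt_pt N s - of_real ((qpt R N)\<^sup>2 / 2) = ((1 + \<eta> N) + (1 + \<xi> N)) * (1 + \<eta> N) - ((1 + \<eta> N) + (1 + \<xi> N))\<^sup>2 / 2"
        by (simp add: u)
      also have "\<dots> = (- \<xi> N + (\<xi> N)\<^sup>2 / 2) - (- \<eta> N + (\<eta> N)\<^sup>2 / 2) + ((\<eta> N)\<^sup>2 - (\<xi> N)\<^sup>2)"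
        by (simp add: power2_eq_square field_simps)
      finally have eq: "of_real (qpt R N) * upt_pt N s - of_real ((qpt R N)\<^sup>2 / 2) =
        (- \<xi> N + (\<xi> N)\<^sup>2 / 2) - (- \<eta> N + (\<eta> N)\<^sup>2 / 2) + ((\<eta> N)\<^sup>2 - (\<xi> N)\<^sup>2)" .
      show ?thesis unfolding eq by (simp only: distrib_left right_diff_distrib)
    qed
    then show ?case
      unfolding phase_def e3 by (simp add: exp_add exp_diff u v power_divide mult_ac)
  qed
  from Lim_transform_eventually[OF main this] show ?thesis by (simp add: L_def)
qed

text \<open>On the circle the modulus of \<open>upt_pt\<close> is constant. Away from angle 0 the
  exponential decreases at rate \<open>N * q * \<rho> * (1 - c)\<close>, while the power of
  \<open>vpt\<close> grows at most at that rate divided by \<open>D\<close>. The surplus factor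
  \<open>1 - 1 / D\<close> is bounded below only by order \<open>1 / k\<close>, since the saddles
  merge.\<close>

lemma phase_bound:
  obtains C where "C > 0" "\<forall>\<^sub>F N in sequentially. \<forall>s. \<bar>s\<bar> \<le> pi * kap N \<longrightarrow> norm (phase R N s) \<le> C * exp (- (s\<^sup>2 / 72))"
proof -
  define C where "C = norm (exp (- (ell 0 ^ 3) / 3 + of_real R * ell 0)) + 1"
  have "(\<lambda>N. norm (phase R N 0)) \<longlonglongrightarrow> norm (exp (- (ell 0 ^ 3) / 3 + of_real R * ell 0))"
    by (intro tendsto_norm phase_tendsto)
  then have "\<forall>\<^sub>F N in sequentially. norm (phase R N 0) < C"
    by (rule order_tendstoD) (simp add: C_def)
  moreover have "\<forall>\<^sub>F N in sequentially. kap N > max 3 (4 * \<bar>R\<bar>)" by (rule kap_gt)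
  ultimately have "\<forall>\<^sub>F N in sequentially. \<forall>s. \<bar>s\<bar> \<le> pi * kap N \<longrightarrow> norm (phase R N s) \<le> C * exp (- (s\<^sup>2 / 72))"
  proof eventually_elim
    case (elim N)
    define k \<rho> q where "k = kap N" and "\<rho> = 1 - 1 / k" and "q = qpt R N"
    have k: "k > 3" "k > 4 * \<bar>R\<bar>" using elim by (auto simp: k_def)
    have \<rho>: "\<rho> \<ge> 2 / 3" "\<rho> < 1" using k by (auto simp: \<rho>_def field_simps)
    have Rk: "\<bar>R / k\<^sup>2\<bar> \<le> 1 / (4 * k)"
    proof -
      have "\<bar>R\<bar> / k\<^sup>2 \<le> (k / 4) / k\<^sup>2" using k by (intro divide_right_mono) auto
      then show ?thesis using k by (simp add: abs_divide power2_eq_square)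
    qed
    have k12: "1 / (4 * k) \<le> 1 / 12" using k by (simp add: field_simps)
    have q: "q \<ge> 3 / 2" using abs_le_D2[OF Rk] k12 unfolding q_def qpt_def k_def[symmetric] by linarith
    define D where "D = (q - \<rho>)\<^sup>2"
    have q\<rho>: "q - \<rho> \<ge> 1 + 1 / (2 * k)"
    proof -
      have "q - \<rho> = 1 + 1 / k + R / k\<^sup>2" by (simp add: q_def qpt_def \<rho>_def k_def)
      moreover have "1 / k = 1 / (2 * k) + 1 / (4 * k) + 1 / (4 * k)" using k by (simp add: field_simps)
      moreover have "1 / (4 * k) \<ge> 0" using k by simp
      ultimately show ?thesis using abs_le_D2[OF Rk] by linarith
    qed
    have k2: "1 / (2 * k) > 0" using k by simp
    have D: "D \<ge> 1 + 1 / (2 * k)"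
    proof -
      have "1 * (1 + 1 / (2 * k)) \<le> (q - \<rho>) * (q - \<rho>)"
        by (rule mult_mono) (use q\<rho> k2 in linarith)+
      then show ?thesis by (simp only: D_def power2_eq_square mult_1)
    qed
    have "D > 0" using D k2 by linarith
    have Dinv: "1 - 1 / D \<ge> 1 / (3 * k)"
    proof -
      from \<open>D > 0\<close> have "1 / D \<le> 1 / (1 + 1 / (2 * k))" using D k2 by (intro divide_left_mono mult_pos_pos) linarith+
      also have "1 / (1 + 1 / (2 * k)) = 1 - 1 / (2 * k + 1)" using k by (simp add: field_simps)
      also have "\<dots> \<le> 1 - 1 / (3 * k)" using k by (simp add: frac_le)
      finally show ?thesis by simp
    qed
    show ?case
    proof (intro allI impI)
      fix s assume s: "\<bar>s\<bar> \<le> pi * kap N"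
      define c where "c = cos (s / k)"
      have up: "upt_pt N s = of_real \<rho> * cis (s / k)"
        by (simp add: upt_pt_def \<rho>_def k_def cis_conv_exp)
      have u_re: "Re (upt_pt N s) = \<rho> * c" and u_norm: "norm (upt_pt N s) = \<rho>"
        using \<rho> by (simp_all add: up c_def norm_mult)
      have v2: "(norm (vpt R N s))\<^sup>2 = D + 2 * q * \<rho> * (1 - c)"
      proof -
        have "(norm (vpt R N s))\<^sup>2 = (q - \<rho> * c)\<^sup>2 + (\<rho> * sin (s / k))\<^sup>2"
          by (simp add: cmod_power2 vpt_def q_def up c_def)
        also have "\<dots> = q\<^sup>2 - 2 * q * \<rho> * c + \<rho>\<^sup>2 * (c\<^sup>2 + (sin (s / k))\<^sup>2)"
          by (simp add: power2_eq_square algebra_simps)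
        also have "c\<^sup>2 + (sin (s / k))\<^sup>2 = 1" by (simp add: c_def)
        finally show ?thesis by (simp add: D_def power2_eq_square algebra_simps)
      qed
      have v0: "norm (vpt R N 0) = q - \<rho>"
      proof -
        have "vpt R N 0 = of_real (q - \<rho>)" by (simp add: vpt_def upt_pt_def q_def \<rho>_def k_def)
        moreover have "q - \<rho> \<ge> 0" using q\<rho> k2 by linarith
        ultimately show ?thesis by (simp del: of_real_diff)
      qed
      \<comment> \<open>The squared modulus is affine in \<open>1 - c\<close>, and
        \<open>1 + x \<le> exp x\<close> makes it multiplicative, ready for the power
        \<open>N\<close>.\<close>
      have "norm (vpt R N s) \<le> (q - \<rho>) * exp (q * \<rho> * (1 - c) / D)"
      proof (rule power2_le_imp_le)
        have "1 + 2 * (q * \<rho> * (1 - c) / D) \<le> exp (2 * (q * \<rho> * (1 - c) / D))" by (rule exp_ge_add_one_self)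
        then have "D * (1 + 2 * (q * \<rho> * (1 - c) / D)) \<le> D * exp (2 * (q * \<rho> * (1 - c) / D))"
          by (intro mult_left_mono) (auto simp: D_def)
        moreover have "D * (1 + 2 * (X / D)) = D + 2 * X" for X
          using \<open>D > 0\<close> by (simp add: distrib_left)
        then have "D * (1 + 2 * (q * \<rho> * (1 - c) / D)) = D + 2 * q * \<rho> * (1 - c)" by simp
        ultimately show "(norm (vpt R N s))\<^sup>2 \<le> ((q - \<rho>) * exp (q * \<rho> * (1 - c) / D))\<^sup>2"
          unfolding v2 power_mult_distrib D_def[symmetric] by (simp add: exp_double[symmetric])
        have "0 \<le> q - \<rho>" using q\<rho> k2 by linarith
        then show "0 \<le> (q - \<rho>) * exp (q * \<rho> * (1 - c) / D)" by simp
      qed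
      then have vN: "norm (vpt R N s) ^ N \<le> (q - \<rho>) ^ N * exp (real N * (q * \<rho> * (1 - c) / D))"
        using power_mono[of "norm (vpt R N s)" "(q - \<rho>) * exp (q * \<rho> * (1 - c) / D)" N]
        by (simp only: power_mult_distrib exp_of_nat_mult norm_ge_zero)
      have "norm (phase R N s) = exp (real N * (q * (\<rho> * c) - q\<^sup>2 / 2)) * (norm (vpt R N s) ^ N / \<rho> ^ N)"
        by (simp add: phase_def norm_mult norm_power norm_divide power_divide u_re u_norm q_def)
      also have "\<dots> \<le> exp (real N * (q * (\<rho> * c) - q\<^sup>2 / 2)) * ((q - \<rho>) ^ N * exp (real N * (q * \<rho> * (1 - c) / D)) / \<rho> ^ N)"
        using vN \<rho> by (intro mult_left_mono divide_right_mono) auto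
      also have "\<dots> = (exp (real N * (q * \<rho> - q\<^sup>2 / 2)) * ((q - \<rho>) ^ N / \<rho> ^ N)) * exp (- (real N * (q * \<rho> * (1 - c)) * (1 - 1 / D)))"
      proof -
        have "real N * (q * (\<rho> * c) - q\<^sup>2 / 2) + real N * (q * \<rho> * (1 - c) / D)
          = real N * (q * \<rho> - q\<^sup>2 / 2) + - (real N * (q * \<rho> * (1 - c)) * (1 - 1 / D))"
          by (simp add: algebra_simps diff_divide_distrib)
        then have "exp (real N * (q * (\<rho> * c) - q\<^sup>2 / 2)) * exp (real N * (q * \<rho> * (1 - c) / D))
          = exp (real N * (q * \<rho> - q\<^sup>2 / 2)) * exp (- (real N * (q * \<rho> * (1 - c)) * (1 - 1 / D)))"
          by (simp only: exp_add[symmetric])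
        then show ?thesis by (simp add: mult_ac)
      qed
      also have "exp (real N * (q * \<rho> - q\<^sup>2 / 2)) * ((q - \<rho>) ^ N / \<rho> ^ N) = norm (phase R N 0)"
      proof -
        have "upt_pt N 0 = of_real \<rho>" by (simp add: upt_pt_def \<rho>_def k_def)
        then have "norm (upt_pt N 0) = \<rho>" "Re (upt_pt N 0) = \<rho>" using \<rho> by auto
        then show ?thesis
          using v0 by (simp add: phase_def norm_mult norm_power norm_divide power_divide q_def)
      qed
      also have "norm (phase R N 0) * exp (- (real N * (q * \<rho> * (1 - c)) * (1 - 1 / D))) \<le> C * exp (- (s\<^sup>2 / 72))"
      proof (rule mult_mono)
        \<comment> \<open>The rate \<open>1 / 72\<close> is the product of \<open>1 / 2\<close> from
          \<open>N = k ^ 3 / 2\<close>, \<open>1 / 12\<close> from the cosine and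
          \<open>1 / 3\<close> from \<open>1 - 1 / D\<close>; the factor \<open>q * \<rho>\<close>
          is at least \<open>3 / 2 * (2 / 3)\<close>.\<close>
        have "1 * ((s / k)\<^sup>2 / 12) \<le> (q * \<rho>) * (1 - c)"
        proof (intro mult_mono)
          have "\<bar>s / k\<bar> \<le> pi" using s k by (simp add: k_def[symmetric] abs_divide divide_le_eq)
          then show "(s / k)\<^sup>2 / 12 \<le> 1 - c" unfolding c_def by (rule one_minus_cos_ge)
          have "3 / 2 * (2 / 3) \<le> q * \<rho>" using q \<rho> by (intro mult_mono) auto
          then show "1 \<le> q * \<rho>" by simp
        qed (use q \<rho> in auto)
        moreover have "0 \<le> (q * \<rho>) * (1 - c)"
          using q \<rho> by (intro mult_nonneg_nonneg) (auto simp: c_def)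
        ultimately have ineq: "(k ^ 3 / 2) * ((s / k)\<^sup>2 / 12) * (1 / (3 * k)) \<le> (k ^ 3 / 2) * ((q * \<rho>) * (1 - c)) * (1 - 1 / D)"
          using k Dinv by (intro mult_mono) auto
        have lhs: "(k ^ 3 / 2) * ((s / k)\<^sup>2 / 12) * (1 / (3 * k)) = s\<^sup>2 / 72"
          using k by (simp add: field_simps power2_eq_square power3_eq_cube)
        have N: "k ^ 3 / 2 = real N" by (simp add: k_def kap_cube)
        have "s\<^sup>2 / 72 \<le> real N * ((q * \<rho>) * (1 - c)) * (1 - 1 / D)"
          using ineq unfolding lhs unfolding N .
        then show "exp (- (real N * (q * \<rho> * (1 - c)) * (1 - 1 / D))) \<le> exp (- (s\<^sup>2 / 72))" by simp
      qed (use elim C_def in auto)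
      finally show "norm (phase R N s) \<le> C * exp (- (s\<^sup>2 / 72))" .
    qed
  qed
  moreover have "C > 0" by (simp add: C_def add_nonneg_pos)
  ultimately show thesis using that by blast
qed

text \<open>Matrix indices are \<open>N - 1 - i\<close> and \<open>N - 1 - j\<close>, so relative to
  the power \<open>N\<close> in \<open>phase\<close> the exponents are off by \<open>Suc i\<close>
  and \<open>Suc j\<close>.\<close>

definition integrand :: "real \<Rightarrow> nat \<Rightarrow> nat \<Rightarrow> nat \<Rightarrow> real \<Rightarrow> complex" where
  "integrand R N i j s = phase R N s * inverse (vpt R N s) ^ Suc i * upt_pt N s ^ Suc j"

text \<open>\<open>kap N\<close> times the entry of \<open>H\<close> after conjugation: the angle is
  stretched by \<open>kap N\<close>, so the full circle has length
  \<open>2 * pi * kap N\<close>.\<close>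

definition scaled_entry :: "real \<Rightarrow> nat \<Rightarrow> nat \<Rightarrow> nat \<Rightarrow> real" where
  "scaled_entry R N i j = Re (LINT s|lborel. indicator {- (pi * kap N)..pi * kap N} s *\<^sub>R integrand R N i j s) / (2 * pi)"

lemma norm_upt: "kap N > 1 \<Longrightarrow> norm (upt_pt N s) = 1 - 1 / kap N"
  by (auto simp: upt_pt_def norm_mult cis_conv_exp[symmetric] simp del: of_real_diff)

lemma norm_vpt_ge:
  assumes "kap N > 1" "kap N > 4 * \<bar>R\<bar>"
  shows "norm (vpt R N s) \<ge> 1 + 1 / (2 * kap N)"
proof -
  define k where "k = kap N"
  have k: "k > 1" "k > 4 * \<bar>R\<bar>" using assms by (auto simp: k_def)
  have "\<bar>R\<bar> / k\<^sup>2 \<le> (k / 4) / k\<^sup>2" using k by (intro divide_right_mono) auto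
  then have Rk: "\<bar>R / k\<^sup>2\<bar> \<le> 1 / (4 * k)" using k by (simp add: abs_divide power2_eq_square)
  have "1 / k = 1 / (2 * k) + 1 / (4 * k) + 1 / (4 * k)" "1 / (4 * k) \<ge> 0" using k by (simp_all add: field_simps)
  moreover have "qpt R N - (1 - 1 / k) = 1 + 1 / k + R / k\<^sup>2" by (simp add: qpt_def k_def)
  ultimately have "1 + 1 / (2 * k) \<le> qpt R N - (1 - 1 / k)" using abs_le_D2[OF Rk] by linarith
  also have "\<dots> \<le> norm (of_real (qpt R N) :: complex) - norm (upt_pt N s)"
    using norm_upt[OF assms(1), of s] by (simp add: k_def)
  also have "\<dots> \<le> norm (vpt R N s)" unfolding vpt_def by (rule norm_triangle_ineq2)
  finally show ?thesis by (simp add: k_def)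
qed

lemma exp_half_le: "0 \<le> t \<Longrightarrow> t \<le> 1 \<Longrightarrow> exp (t / 2) \<le> 1 + (t :: real)"
proof -
  assume t: "0 \<le> t" "t \<le> 1"
  have "exp (t / 2) \<le> 1 + t / 2 + (t / 2)\<^sup>2" using t by (intro exp_bound) auto
  also have "(t / 2)\<^sup>2 \<le> t / 2" using t mult_left_mono[of t 1 t] by (simp add: power2_eq_square)
  finally show ?thesis by simp
qed

text \<open>The moduli of the inverse of \<open>vpt\<close> and of \<open>upt_pt\<close> are both at
  most \<open>exp (- (1 / (4 * kap N)))\<close>; the extra power in each \<open>Suc\<close> is
  dropped.\<close>

lemma norm_integrand_le:
  assumes k: "kap N > 1" "kap N > 4 * \<bar>R\<bar>"
  shows "norm (integrand R N i j s) \<le> norm (phase R N s) * (exp (- (real i / (4 * kap N))) * exp (- (real j / (4 * kap N))))"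
proof -
  define k where "k = kap N"
  have k1: "k > 1" using k by (simp add: k_def)
  have "norm (inverse (vpt R N s)) \<le> exp (- (1 / (4 * k)))"
  proof -
    have "exp (1 / (4 * k)) \<le> 1 + 1 / (2 * k)" using exp_half_le[of "1 / (2 * k)"] k1 by simp
    also have "\<dots> \<le> norm (vpt R N s)" using norm_vpt_ge[OF k] by (simp add: k_def)
    finally have "inverse (norm (vpt R N s)) \<le> inverse (exp (1 / (4 * k)))" by (intro le_imp_inverse_le) auto
    then show ?thesis by (simp add: norm_inverse exp_minus)
  qed
  then have "norm (inverse (vpt R N s)) ^ Suc i \<le> exp (- (1 / (4 * k))) ^ Suc i" by (intro power_mono) auto
  also have "\<dots> \<le> exp (- (1 / (4 * k))) ^ i" using k1 by (intro power_decreasing) auto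
  finally have A: "norm (inverse (vpt R N s)) ^ Suc i \<le> exp (- (real i / (4 * k)))" by (simp add: exp_of_nat_mult[symmetric])
  have "norm (upt_pt N s) \<le> exp (- (1 / (4 * k)))"
  proof -
    have "norm (upt_pt N s) \<le> exp (- (1 / k))" using norm_upt[OF k(1), of s] exp_ge_add_one_self[of "- (1 / k)"] by (simp add: k_def)
    also have "\<dots> \<le> exp (- (1 / (4 * k)))" using k1 by (simp add: frac_le)
    finally show ?thesis .
  qed
  then have "norm (upt_pt N s) ^ Suc j \<le> exp (- (1 / (4 * k))) ^ Suc j" by (intro power_mono) auto
  also have "\<dots> \<le> exp (- (1 / (4 * k))) ^ j" using k1 by (intro power_decreasing) auto
  finally have B: "norm (upt_pt N s) ^ Suc j \<le> exp (- (real j / (4 * k)))" by (simp add: exp_of_nat_mult[symmetric])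
  have "norm (integrand R N i j s) = norm (phase R N s) * (norm (inverse (vpt R N s)) ^ Suc i * norm (upt_pt N s) ^ Suc j)"
    unfolding integrand_def norm_mult norm_power by (simp only: mult.assoc)
  also have "\<dots> \<le> norm (phase R N s) * (exp (- (real i / (4 * k))) * exp (- (real j / (4 * k))))"
    by (intro mult_left_mono mult_mono A B) auto
  finally show ?thesis by (simp add: k_def)
qed

section \<open>Bounds and limits of the scaled matrix entries\<close>

lemma measurable_integrand [measurable]: "integrand R N i j \<in> borel_measurable borel"
  unfolding integrand_def phase_def vpt_def upt_pt_def by measurable

lemma gauss_integrable: "integrable lborel (\<lambda>s::real. exp (- (s\<^sup>2 / 72)))"
  using integrable_exp_neg_square[of "1 / 72"] by simp

text \<open>The Gaussian bound is integrated over \<open>s\<close>. Uniformity in \<open>i\<close>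
  and \<open>j\<close> is essential, since it later dominates whole determinants.\<close>

lemma scaled_entry_bound:
  obtains C where "C > 0" "\<forall>\<^sub>F N in sequentially. \<forall>i j. \<bar>scaled_entry R N i j\<bar> \<le> C * (exp (- (real i / (4 * kap N))) * exp (- (real j / (4 * kap N))))"
proof -
  obtain C where C: "C > 0" and bnd: "\<forall>\<^sub>F N in sequentially. \<forall>s. \<bar>s\<bar> \<le> pi * kap N \<longrightarrow> norm (phase R N s) \<le> C * exp (- (s\<^sup>2 / 72))"
    using phase_bound by blast
  define G :: real where "G = (LINT s::real|lborel. exp (- (s\<^sup>2 / 72)))"
  have G0: "G \<ge> 0" unfolding G_def by (intro Bochner_Integration.integral_nonneg) auto
  have "\<forall>\<^sub>F N in sequentially. \<forall>i j. \<bar>scaled_entry R N i j\<bar> \<le> (C * (G + 1)) * (exp (- (real i / (4 * kap N))) * exp (- (real j / (4 * kap N))))"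
    using bnd kap_gt[of 1] kap_gt[of "4 * \<bar>R\<bar>"]
  proof eventually_elim
    case (elim N)
    show ?case
    proof (intro allI)
      fix i j
      let ?e = "exp (- (real i / (4 * kap N))) * exp (- (real j / (4 * kap N)))"
      let ?I = "LINT s|lborel. indicator {- (pi * kap N)..pi * kap N} s *\<^sub>R integrand R N i j s"
      have "norm ?I \<le> (LINT s|lborel. (C * ?e) * exp (- (s\<^sup>2 / 72)))"
      proof (rule order_trans[OF integral_norm_bound integral_mono'])
        fix s :: real
        show "norm (indicator {- (pi * kap N)..pi * kap N} s *\<^sub>R integrand R N i j s) \<le> (C * ?e) * exp (- (s\<^sup>2 / 72))"
        proof (cases "\<bar>s\<bar> \<le> pi * kap N")
          case True
          have "norm (integrand R N i j s) \<le> norm (phase R N s) * ?e" by (rule norm_integrand_le[OF elim(2,3)])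
          also have "\<dots> \<le> (C * exp (- (s\<^sup>2 / 72))) * ?e" using elim(1) True by (intro mult_right_mono) auto
          finally have "norm (integrand R N i j s) \<le> (C * exp (- (s\<^sup>2 / 72))) * ?e" .
          moreover have "s \<in> {- (pi * kap N)..pi * kap N}" using True by auto
          ultimately show ?thesis by (simp add: mult_ac)
        qed (use C in \<open>auto simp: indicator_def\<close>)
      qed (use gauss_integrable C in \<open>auto intro!: mult_nonneg_nonneg\<close>)
      also have "\<dots> = C * ?e * G" by (simp add: G_def)
      finally have "norm ?I \<le> C * ?e * G" .
      moreover have "\<bar>scaled_entry R N i j\<bar> \<le> norm ?I"
      proof -
        have "\<bar>scaled_entry R N i j\<bar> = \<bar>Re ?I\<bar> / (2 * pi)" by (simp add: scaled_entry_def abs_divide)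
        also have "\<dots> \<le> \<bar>Re ?I\<bar> / 1" using pi_gt3 by (intro divide_left_mono) auto
        finally show ?thesis using abs_Re_le_cmod[of ?I] by simp
      qed
      moreover have "C * ?e * G \<le> C * (G + 1) * ?e" using C G0 by (simp add: algebra_simps)
      ultimately show "\<bar>scaled_entry R N i j\<bar> \<le> (C * (G + 1)) * ?e" by linarith
    qed
  qed
  moreover have "C * (G + 1) > 0" using C G0 by simp
  ultimately show thesis using that by blast
qed

text \<open>The index powers turn into exponentials that are linear in \<open>ell s\<close> and
  merely shift the parameter of the Airy exponent; the limiting contour \<open>- ell s\<close> is
  the vertical line with real part 1.\<close>

lemma integrand_tendsto:
  assumes i: "(\<lambda>N. real (i N) / kap N) \<longlonglongrightarrow> x" and j: "(\<lambda>N. real (j N) / kap N) \<longlonglongrightarrow> y"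
  shows "(\<lambda>N. integrand R N (i N) (j N) s) \<longlonglongrightarrow> exp (airy_exponent (R + x + y) (- ell s))"
proof -
  have S: "(\<lambda>N. real (Suc (f N)) / kap N) \<longlonglongrightarrow> z" if "(\<lambda>N. real (f N) / kap N) \<longlonglongrightarrow> z" for f z
    using tendsto_add[OF that inverse_kap_tendsto] by (simp add: add_divide_distrib add.commute)
  have v: "(\<lambda>N. (1 + (vpt R N s - 1)) ^ Suc (i N)) \<longlonglongrightarrow> exp (of_real x * (- ell s))"
    by (rule power_scaled_limit[OF vpt_scaled S[OF i]])
  have u: "(\<lambda>N. (1 + (upt_pt N s - 1)) ^ Suc (j N)) \<longlonglongrightarrow> exp (of_real y * ell s)"
    by (rule power_scaled_limit[OF upt_scaled S[OF j]])
  have "(\<lambda>N. phase R N s * inverse ((1 + (vpt R N s - 1)) ^ Suc (i N)) * (1 + (upt_pt N s - 1)) ^ Suc (j N))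
    \<longlonglongrightarrow> exp (- (ell s ^ 3) / 3 + of_real R * ell s) * inverse (exp (of_real x * (- ell s))) * exp (of_real y * ell s)"
    by (intro tendsto_mult tendsto_inverse phase_tendsto v u) auto
  moreover have "exp (- (ell s ^ 3) / 3 + of_real R * ell s) * inverse (exp (of_real x * (- ell s))) * exp (of_real y * ell s)
     = exp (airy_exponent (R + x + y) (- ell s))"
  proof -
    have "- (ell s ^ 3) / 3 + of_real R * ell s + - (of_real x * (- ell s)) + of_real y * ell s = airy_exponent (R + x + y) (- ell s)"
      by (simp add: airy_exponent_def algebra_simps)
    then show ?thesis by (simp only: exp_minus[symmetric] exp_add[symmetric])
  qed
  ultimately show ?thesis by (simp add: integrand_def power_inverse)
qed

lemma scaled_entry_tendsto:
  assumes i: "(\<lambda>N. real (i N) / kap N) \<longlonglongrightarrow> x" and j: "(\<lambda>N. real (j N) / kap N) \<longlonglongrightarrow> y" and x: "x \<ge> 0" "y \<ge> 0"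
  shows "(\<lambda>N. scaled_entry R N (i N) (j N)) \<longlonglongrightarrow> airy (R + x + y)"
proof -
  obtain C where C: "C > 0" and bnd: "\<forall>\<^sub>F N in sequentially. \<forall>s. \<bar>s\<bar> \<le> pi * kap N \<longrightarrow> norm (phase R N s) \<le> C * exp (- (s\<^sup>2 / 72))"
    using phase_bound by blast
  have "\<forall>\<^sub>F N in sequentially. (\<forall>s. \<bar>s\<bar> \<le> pi * kap N \<longrightarrow> norm (phase R N s) \<le> C * exp (- (s\<^sup>2 / 72))) \<and> kap N > 1 \<and> kap N > 4 * \<bar>R\<bar>"
    using bnd kap_gt[of 1] kap_gt[of "4 * \<bar>R\<bar>"] by eventually_elim auto
  then obtain N0 where N0: "\<And>N. N \<ge> N0 \<Longrightarrow> (\<forall>s. \<bar>s\<bar> \<le> pi * kap N \<longrightarrow> norm (phase R N s) \<le> C * exp (- (s\<^sup>2 / 72))) \<and> kap N > 1 \<and> kap N > 4 * \<bar>R\<bar>"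
    unfolding eventually_sequentially by blast
  let ?f = "\<lambda>N s. indicator {- (pi * kap N)..pi * kap N} s *\<^sub>R integrand R N (i N) (j N) s"
  \<comment> \<open>The Gaussian domination holds only from \<open>N0\<close> on, hence the shifted
    sequence.\<close>
  have "(\<lambda>N. LINT s|lborel. ?f (N + N0) s) \<longlonglongrightarrow> (LINT s|lborel. exp (airy_exponent (R + x + y) (- ell s)))"
  proof (rule integral_dominated_convergence[where w = "\<lambda>s. C * exp (- (s\<^sup>2 / 72))"])
    show "integrable lborel (\<lambda>s. C * exp (- (s\<^sup>2 / 72)))" by (intro integrable_mult_right gauss_integrable)
    show "(\<lambda>s. exp (airy_exponent (R + x + y) (- ell s))) \<in> borel_measurable lborel"
      unfolding airy_exponent_def ell_def by measurable
    show "?f (N + N0) \<in> borel_measurable lborel" for N by measurable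
    show "AE s in lborel. (\<lambda>N. ?f (N + N0) s) \<longlonglongrightarrow> exp (airy_exponent (R + x + y) (- ell s))"
    proof (rule AE_I2)
      fix s :: real
      have "\<forall>\<^sub>F N in sequentially. integrand R N (i N) (j N) s = ?f N s"
        using kap_gt[of "\<bar>s\<bar>"] kap_gt[of 0]
      proof eventually_elim
        case (elim N)
        have "1 * kap N \<le> pi * kap N" by (rule mult_right_mono) (use elim pi_gt3 in linarith)+
        then have "s \<in> {- (pi * kap N)..pi * kap N}"
          using elim(1) unfolding atLeastAtMost_iff abs_less_iff mult_1 by linarith
        then show ?case by simp
      qed
      from Lim_transform_eventually[OF integrand_tendsto[OF i j] this]
      show "(\<lambda>N. ?f (N + N0) s) \<longlonglongrightarrow> exp (airy_exponent (R + x + y) (- ell s))"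
        by (rule LIMSEQ_ignore_initial_segment)
    qed
    show "AE s in lborel. norm (?f (N + N0) s) \<le> C * exp (- (s\<^sup>2 / 72))" for N
    proof (rule AE_I2)
      fix s :: real
      note N = N0[of "N + N0", OF le_add2]
      have "norm (integrand R (N + N0) (i (N + N0)) (j (N + N0)) s) \<le> C * exp (- (s\<^sup>2 / 72))" if "\<bar>s\<bar> \<le> pi * kap (N + N0)"
      proof -
        have e: "exp (- (real k / (4 * kap (N + N0)))) \<le> 1" for k using N by simp
        have "norm (integrand R (N + N0) (i (N + N0)) (j (N + N0)) s) \<le> norm (phase R (N + N0) s) * (exp (- (real (i (N + N0)) / (4 * kap (N + N0)))) * exp (- (real (j (N + N0)) / (4 * kap (N + N0)))))"
          using N by (intro norm_integrand_le) auto
        also have "\<dots> \<le> norm (phase R (N + N0) s) * (1 * 1)" using e by (intro mult_left_mono mult_mono) auto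
        finally show ?thesis using N that by force
      qed
      then show "norm (?f (N + N0) s) \<le> C * exp (- (s\<^sup>2 / 72))" using C by (auto simp: indicator_def)
    qed
  qed
  then have lim: "(\<lambda>N. LINT s|lborel. ?f N s) \<longlonglongrightarrow> (LINT s|lborel. exp (airy_exponent (R + x + y) (- ell s)))"
    by (rule LIMSEQ_offset)
  \<comment> \<open>Replacing \<open>s\<close> by \<open>- s\<close> reverses the line to its
    standard direction.\<close>
  have "(LINT s|lborel. exp (airy_exponent (R + x + y) (- ell s))) = (LINT s|lborel. exp (airy_exponent (R + x + y) (Complex 1 s)))"
    using lborel_integral_real_affine[of "-1" "\<lambda>s. exp (airy_exponent (R + x + y) (- ell s))" 0]
    by (simp add: ell_def Complex_eq)
  then have "airy (R + x + y) = Re (LINT s|lborel. exp (airy_exponent (R + x + y) (- ell s))) / (2 * pi)"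
    using airy_eq_contour_integral[of 1 "R + x + y"] by simp
  then show ?thesis
    unfolding scaled_entry_def using lim by (auto intro!: tendsto_intros)
qed

text \<open>Taylor coefficients as circle integrals; the angle runs over \<open>{-\<pi>..\<pi>}\<close>, so that the saddle point
  at angle \<open>0\<close> is an interior point.\<close>

definition circle_pt :: "real \<Rightarrow> real \<Rightarrow> complex" where
  "circle_pt s t = of_real s * exp (\<i> * of_real (2 * pi * t - pi))"

lemma taylor_circle_sums:
  assumes f: "f holomorphic_on UNIV" and s: "s > 0"
  shows "(\<lambda>b. integral {0..1} (\<lambda>t. f (circle_pt s t) / circle_pt s t ^ b) * z ^ b) sums f z"
proof -
  \<comment> \<open>The library circle starts at angle 0. Shifting the angle by \<open>pi\<close>
    negates the point, so \<open>f\<close> is composed with negation and the resulting signs cancel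
    at the end.\<close>
  define g where "g w = f (- w)" for w
  have g: "g holomorphic_on A" for A
    unfolding g_def by (rule holomorphic_on_compose_gen[of uminus _ f UNIV, unfolded o_def]) (auto intro!: holomorphic_intros f)
  have coeff: "(deriv ^^ b) g 0 / fact b = integral {0..1} (\<lambda>t. f (circle_pt s t) / circle_pt s t ^ b) * (- 1) ^ b" for b
  proof -
    let ?\<gamma> = "\<lambda>t::real. of_real s * exp (2 * of_real pi * \<i> * of_real t) :: complex"
    have cp: "circle_pt s t = - ?\<gamma> t" for t
      by (simp add: circle_pt_def right_diff_distrib exp_diff mult_ac)
    have "((\<lambda>u. g u / (u - 0) ^ Suc b) has_contour_integral (2 * pi * \<i> / fact b) * (deriv ^^ b) g 0) (circlepath 0 s)"
      using g s by (intro Cauchy_has_contour_integral_higher_derivative_circlepath holomorphic_on_imp_continuous_on) auto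
    then have "((\<lambda>t. g (circlepath 0 s t) / (circlepath 0 s t - 0) ^ Suc b * vector_derivative (circlepath 0 s) (at t within {0..1})) has_integral
       (2 * pi * \<i> / fact b) * (deriv ^^ b) g 0) {0..1}"
      by (simp only: has_contour_integral_def)
    then have "((\<lambda>t. (2 * pi * \<i>) * (g (?\<gamma> t) / ?\<gamma> t ^ b)) has_integral (2 * pi * \<i> / fact b) * (deriv ^^ b) g 0) {0..1}"
    proof (rule has_integral_eq[rotated])
      fix t :: real assume t: "t \<in> {0..1}"
      have w: "circlepath 0 s t = ?\<gamma> t" by (simp add: circlepath mult_ac)
      have "vector_derivative (circlepath 0 s) (at t within {0..1}) = (2 * pi * \<i>) * ?\<gamma> t"
        using vector_derivative_circlepath01[of t 0 s] t by (simp add: mult_ac)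
      moreover have "?\<gamma> t \<noteq> 0" using s by simp
      moreover have "G / (w - 0) ^ Suc b * (P * w) = P * (G / w ^ b)" if "w \<noteq> 0" for G P w :: complex
        using that by (simp add: field_simps)
      ultimately show "g (circlepath 0 s t) / (circlepath 0 s t - 0) ^ Suc b * vector_derivative (circlepath 0 s) (at t within {0..1}) = (2 * pi * \<i>) * (g (?\<gamma> t) / ?\<gamma> t ^ b)"
        unfolding w by metis
    qed
    from integral_unique[OF this]
    have "(2 * pi * \<i>) * integral {0..1} (\<lambda>t. g (?\<gamma> t) / ?\<gamma> t ^ b) = (2 * pi * \<i> / fact b) * (deriv ^^ b) g 0"
      by (simp only: Henstock_Kurzweil_Integration.integral_mult_right)
    then have "(deriv ^^ b) g 0 / fact b = integral {0..1} (\<lambda>t. g (?\<gamma> t) / ?\<gamma> t ^ b)"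
      by (simp add: field_simps)
    also have "(\<lambda>t. g (?\<gamma> t) / ?\<gamma> t ^ b) = (\<lambda>t. (f (circle_pt s t) / circle_pt s t ^ b) * (- 1) ^ b)"
    proof -
      have "X / w ^ b = X / (- w) ^ b * (- 1) ^ b" for X w :: complex by (cases "even b") simp_all
      then show ?thesis unfolding g_def cp by (intro ext)
    qed
    finally show ?thesis by (simp only: Henstock_Kurzweil_Integration.integral_mult_left)
  qed
  have S: "(\<lambda>b. (deriv ^^ b) g 0 / fact b * (- z - 0) ^ b) sums g (- z)"
    using g by (intro holomorphic_power_series[of g 0 "norm z + 1"]) auto
  have eqn: "X * (- 1) ^ b * (- z - 0) ^ b = X * z ^ b" for X :: complex and b
  proof -
    have "(- 1) ^ b * (- z - 0) ^ b = z ^ b" by (simp flip: power_mult_distrib)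
    then show ?thesis by (simp only: mult.assoc)
  qed
  show ?thesis using S unfolding coeff g_def eqn minus_minus .
qed

text \<open>Each coefficient is a circle integral. In units of \<open>sqrt N\<close> its integrand
  is \<open>integrand\<close> times a quotient of powers of \<open>sqrt N\<close>, one depending on
  the row and one on the column.\<close>

lemma wall_taylor_coefficients:
  fixes m :: real
  assumes N: "N \<ge> 1" and k: "kap N > 1" "kap N > 4 * \<bar>R\<bar>" and m: "2 * m = sqrt (real N) * qpt R N"
  obtains H where "\<And>a z::real. (\<lambda>b. H a b * z ^ b) sums (exp (2 * m * z - 2 * m\<^sup>2) * (2 * m - z) ^ a)"
    and "\<And>i j. i < N \<Longrightarrow> j < N \<Longrightarrow>
      H (N - 1 - i) (N - 1 - j) = sqrt (real N) ^ (N - 1 - i) / sqrt (real N) ^ (N - 1 - j) * (scaled_entry R N i j / kap N)"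
proof -
  define F where "F a z = exp (2 * of_real m * z - 2 * of_real m ^ 2) * (2 * of_real m - z) ^ a" for a and z :: complex
  \<comment> \<open>The radius puts the circle at \<open>sqrt N * upt_pt\<close>, just inside the
    saddle \<open>sqrt N\<close>.\<close>
  define s where "s = sqrt (real N) * (1 - 1 / kap N)"
  have s: "s > 0" using N k by (simp add: s_def)
  define c where "c a b = integral {0..1} (\<lambda>t. F a (circle_pt s t) / circle_pt s t ^ b)" for a b
  have c_sums: "(\<lambda>b. c a b * z ^ b) sums F a z" for a z
    unfolding c_def by (rule taylor_circle_sums[OF _ s]) (auto simp: F_def intro!: holomorphic_intros)
  \<comment> \<open>The generating function is real at real arguments, so real parts of the
    coefficients have the same sum there.\<close>
  define H where "H a b = Re (c a b)" for a b
  have "(\<lambda>b. H a b * z ^ b) sums (exp (2 * m * z - 2 * m\<^sup>2) * (2 * m - z) ^ a)" for a and z :: real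
  proof -
    have "F a (of_real z) = of_real (exp (2 * m * z - 2 * m\<^sup>2) * (2 * m - z) ^ a)"
      by (simp add: F_def exp_of_real[symmetric] del: exp_of_real)
    then show ?thesis using sums_Re[OF c_sums[of a "of_real z"]] by (simp add: H_def flip: of_real_power)
  qed
  moreover have "H (N - 1 - i) (N - 1 - j) = sqrt (real N) ^ (N - 1 - i) / sqrt (real N) ^ (N - 1 - j) * (scaled_entry R N i j / kap N)"
    if ij: "i < N" "j < N" for i j
  proof -
    let ?a = "N - 1 - i" and ?b = "N - 1 - j" and ?r = "of_real (sqrt (real N)) :: complex"
    let ?\<sigma> = "\<lambda>t. kap N * (2 * pi * t - pi)"
    have r2: "?r * ?r = of_nat N" by (simp flip: of_real_mult)
    have r0: "?r \<noteq> 0" using N by simp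
    have pt: "circle_pt s t = ?r * upt_pt N (?\<sigma> t)" for t
      using k by (simp add: circle_pt_def upt_pt_def s_def)
    have u0: "upt_pt N t \<noteq> 0" and v0: "vpt R N t \<noteq> 0" for t
    proof -
      show "upt_pt N t \<noteq> 0" using norm_upt[OF k(1), of t] k by (auto simp: field_simps)
      have "1 / (2 * kap N) > 0" using k by simp
      then have "norm (vpt R N t) > 0" using norm_vpt_ge[OF k, of t] by linarith
      then show "vpt R N t \<noteq> 0" by auto
    qed
    have m': "2 * of_real m = ?r * of_real (qpt R N)" using m by (metis of_real_mult of_real_numeral)
    have m2: "2 * of_real m ^ 2 = (of_nat N * of_real ((qpt R N)\<^sup>2 / 2) :: complex)"
    proof -
      have "2 * of_real m ^ 2 = (2 * of_real m) * (2 * of_real m) / (2 :: complex)" by (simp add: power2_eq_square)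
      also have "\<dots> = (?r * ?r) * of_real ((qpt R N)\<^sup>2 / 2)" unfolding m' by (simp add: power2_eq_square)
      finally show ?thesis unfolding r2 .
    qed
    have val: "F ?a (circle_pt s t) / circle_pt s t ^ ?b = ?r ^ ?a / ?r ^ ?b * integrand R N i j (?\<sigma> t)" for t
    proof -
      let ?u = "upt_pt N (?\<sigma> t)" and ?v = "vpt R N (?\<sigma> t)"
      have e: "2 * of_real m * (?r * ?u) - 2 * of_real m ^ 2 = of_nat N * (of_real (qpt R N) * ?u - of_real ((qpt R N)\<^sup>2 / 2))"
        unfolding m2 m' using r2 by (simp add: algebra_simps)
      have v: "2 * of_real m - ?r * ?u = ?r * ?v" unfolding m' by (simp add: vpt_def algebra_simps)
      have "?v ^ ?a = ?v ^ N * inverse ?v ^ Suc i"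
      proof -
        have "N = ?a + Suc i" using ij by simp
        then have "?v ^ N = ?v ^ ?a * ?v ^ Suc i" by (metis power_add)
        then show ?thesis using v0[of "?\<sigma> t"] by (simp add: power_inverse field_simps)
      qed
      moreover have "inverse (?u ^ ?b) = inverse (?u ^ N) * ?u ^ Suc j"
      proof -
        have "N = ?b + Suc j" using ij by simp
        then have "?u ^ N = ?u ^ ?b * ?u ^ Suc j" by (metis power_add)
        then show ?thesis using u0[of "?\<sigma> t"] by (simp add: field_simps)
      qed
      ultimately show ?thesis
        unfolding F_def pt e v power_mult_distrib integrand_def phase_def power_divide divide_inverse
          inverse_mult_distrib
        by (simp add: mult_ac power_inverse)
    qed
    have cont: "continuous_on A (\<lambda>t. integrand R N i j (?\<sigma> t))" for A
    proof -
      have cu: "continuous_on A (\<lambda>t. upt_pt N (?\<sigma> t))"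
        unfolding upt_pt_def divide_inverse by (intro continuous_intros)
      have cv: "continuous_on A (\<lambda>t. vpt R N (?\<sigma> t))"
        unfolding vpt_def by (intro continuous_intros cu)
      show ?thesis
        unfolding integrand_def phase_def by (intro continuous_intros cu cv) (use u0 v0 in auto)
    qed
    have "c ?a ?b = ?r ^ ?a / ?r ^ ?b * integral {0..1} (\<lambda>t. integrand R N i j (?\<sigma> t))"
      unfolding c_def val by (rule integral_mult_right)
    also have "integral {0..1} (\<lambda>t. integrand R N i j (?\<sigma> t)) = (LINT t:{0..1}|lborel. integrand R N i j (?\<sigma> t))"
      by (intro set_borel_integral_eq_integral(2)[symmetric] borel_integrable_atLeastAtMost' cont)
    also have "\<dots> = (LINT t|lborel. indicator {- (pi * kap N)..pi * kap N} (- (pi * kap N) + (2 * pi * kap N) * t) *\<^sub>R integrand R N i j (- (pi * kap N) + (2 * pi * kap N) * t))"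
      unfolding set_lebesgue_integral_def
    proof (intro Bochner_Integration.integral_cong refl)
      fix t :: real
      have pk: "pi * kap N > 0" using k by simp
      have "t \<in> {0..1} \<longleftrightarrow> - P + 2 * P * t \<in> {- P..P}" if "P > 0" for P :: real
      proof -
        have "2 * P * t \<le> 2 * P * 1 \<longleftrightarrow> t \<le> 1" "2 * P * 0 \<le> 2 * P * t \<longleftrightarrow> 0 \<le> t"
          using that by (intro mult_le_cancel_left_pos; simp)+
        then show ?thesis by auto
      qed
      from this[OF pk] have "t \<in> {0..1} \<longleftrightarrow> - (pi * kap N) + (2 * pi * kap N) * t \<in> {- (pi * kap N)..pi * kap N}"
        by (simp only: mult.assoc)
      moreover have "?\<sigma> t = - (pi * kap N) + (2 * pi * kap N) * t" by (simp add: algebra_simps)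
      ultimately show "indicator {0..1} t *\<^sub>R integrand R N i j (?\<sigma> t) = indicator {- (pi * kap N)..pi * kap N} (- (pi * kap N) + (2 * pi * kap N) * t) *\<^sub>R integrand R N i j (- (pi * kap N) + (2 * pi * kap N) * t)"
        by (simp add: indicator_def)
    qed
    also have "\<dots> = of_real (1 / (2 * pi * kap N)) * (LINT x|lborel. indicator {- (pi * kap N)..pi * kap N} x *\<^sub>R integrand R N i j x)"
      using lborel_integral_real_affine[of "2 * pi * kap N" "\<lambda>x. indicator {- (pi * kap N)..pi * kap N} x *\<^sub>R integrand R N i j x" "- (pi * kap N)"] k
      by (simp add: scaleR_conv_of_real)
    finally have "c ?a ?b = of_real (sqrt (real N) ^ ?a / sqrt (real N) ^ ?b * (1 / (2 * pi * kap N))) * (LINT x|lborel. indicator {- (pi * kap N)..pi * kap N} x *\<^sub>R integrand R N i j x)"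
      by simp
    then have "H ?a ?b = sqrt (real N) ^ ?a / sqrt (real N) ^ ?b * (1 / (2 * pi * kap N)) * Re (LINT x|lborel. indicator {- (pi * kap N)..pi * kap N} x *\<^sub>R integrand R N i j x)"
      unfolding H_def by (simp only: Re_complex_of_real Im_complex_of_real times_complex.sel mult_zero_left diff_zero)
    then show ?thesis by (simp add: scaled_entry_def)
  qed
  ultimately show thesis using that by blast
qed

text \<open>Counting indices down from \<open>N - 1\<close> moves the edge to index 0; the row and
  column powers of \<open>sqrt N\<close> are a diagonal conjugation and cancel.\<close>

lemma wall_determinant:
  fixes m :: real
  assumes N: "N \<ge> 1" and k: "kap N > 1" "kap N > 4 * \<bar>R\<bar>" and m: "2 * m = sqrt (real N) * qpt R N"
  obtains H where "\<And>a z::real. (\<lambda>b. H a b * z ^ b) sums (exp (2 * m * z - 2 * m\<^sup>2) * (2 * m - z) ^ a)"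
    and "sdet {..<N} (\<lambda>a b. (if a = b then 1 else 0) - H a b) = sdet {..<N} (\<lambda>i j. (if i = j then 1 else 0) + - (scaled_entry R N i j / kap N))"
proof -
  obtain H where H: "\<And>a z::real. (\<lambda>b. H a b * z ^ b) sums (exp (2 * m * z - 2 * m\<^sup>2) * (2 * m - z) ^ a)"
    and Hs: "\<And>i j. i < N \<Longrightarrow> j < N \<Longrightarrow>
      H (N - 1 - i) (N - 1 - j) = sqrt (real N) ^ (N - 1 - i) / sqrt (real N) ^ (N - 1 - j) * (scaled_entry R N i j / kap N)"
    using wall_taylor_coefficients[OF assms] by blast
  define c where "c i = sqrt (real N) ^ (N - 1 - i)" for i
  have c0: "c i \<noteq> 0" for i using N by (simp add: c_def)
  have e: "bij_betw (\<lambda>i. N - 1 - i) {..<N} {..<N}"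
    by (rule bij_betwI[of _ _ _ "\<lambda>i. N - 1 - i"]) auto
  have "sdet {..<N} (\<lambda>a b. (if a = b then 1 else 0) - H a b)
     = sdet {..<N} (\<lambda>i j. (if N - 1 - i = N - 1 - j then 1 else 0) - H (N - 1 - i) (N - 1 - j))"
    using sdet_reindex[OF e, of "\<lambda>a b. (if a = b then 1 else 0) - H a b"] by simp
  also have "\<dots> = sdet {..<N} (\<lambda>i j. c i * (((if i = j then 1 else 0) + - (scaled_entry R N i j / kap N)) * inverse (c j)))"
  proof (rule sdet_cong)
    fix i j assume ij: "i \<in> {..<N}" "j \<in> {..<N}"
    then have "N - 1 - i = N - 1 - j \<longleftrightarrow> i = j" by auto
    then show "(if N - 1 - i = N - 1 - j then 1 else 0) - H (N - 1 - i) (N - 1 - j) = c i * (((if i = j then 1 else 0) + - (scaled_entry R N i j / kap N)) * inverse (c j))"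
    proof -
      have "H (N - 1 - i) (N - 1 - j) = c i / c j * (scaled_entry R N i j / kap N)"
        unfolding c_def using ij by (intro Hs) auto
      then show ?thesis using \<open>N - 1 - i = N - 1 - j \<longleftrightarrow> i = j\<close> c0[of i] c0[of j] by (simp add: field_simps)
    qed
  qed
  also have "\<dots> = (\<Prod>i<N. c i) * (sdet {..<N} (\<lambda>i j. (if i = j then 1 else 0) + - (scaled_entry R N i j / kap N)) * (\<Prod>i<N. inverse (c i)))"
    by (simp only: sdet_mult_rows sdet_mult_columns finite_lessThan)
  also have "\<dots> = sdet {..<N} (\<lambda>i j. (if i = j then 1 else 0) + - (scaled_entry R N i j / kap N))"
  proof -
    have "(\<Prod>i<N. c i) * (\<Prod>i<N. inverse (c i)) = 1"
      using c0 by (simp add: prod.distrib[symmetric])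
    moreover have "X * (Z * Y) = Z" if "X * Y = 1" for X Y Z :: real
      using that by (simp add: mult.left_commute[of X Z Y])
    ultimately show ?thesis by blast
  qed
  finally show thesis using H that by blast
qed

section \<open>Convergence of the Fredholm determinants\<close>

text \<open>The expansion into principal minors, sorted by size and written with index tuples, is a
  Fredholm series that stops after size \<open>N\<close>.\<close>

lemma sdet_one_minus_sums:
  fixes A :: "nat \<Rightarrow> nat \<Rightarrow> real"
  shows "(\<lambda>n. (-1) ^ n / fact n * (\<Sum>f\<in>{..<n} \<rightarrow>\<^sub>E {..<N}. sdet {..<n} (\<lambda>a b. A (f a) (f b))))
    sums sdet {..<N} (\<lambda>i j. (if i = j then 1 else 0) + - A i j)"
proof -
  let ?t = "\<lambda>n. (-1) ^ n / fact n * (\<Sum>f\<in>{..<n} \<rightarrow>\<^sub>E {..<N}. sdet {..<n} (\<lambda>a b. A (f a) (f b)))"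
  have neg: "sdet T (\<lambda>i j. - A i j) = (-1) ^ card T * sdet T A" if "T \<subseteq> {..<N}" for T
    using sdet_mult_rows[of T "\<lambda>_. -1" A] finite_subset[OF that] by simp
  have t: "?t n = (\<Sum>T\<in>{T \<in> Pow {..<N}. card T = n}. sdet T (\<lambda>i j. - A i j))" for n
  proof -
    have "?t n = (-1) ^ n * (\<Sum>T | T \<subseteq> {..<N} \<and> card T = n. sdet T A)"
      using sum_sdet_functions[of "{..<N}" n A] by simp
    also have "\<dots> = (\<Sum>T\<in>{T \<in> Pow {..<N}. card T = n}. sdet T (\<lambda>i j. - A i j))"
      unfolding sum_distrib_left by (intro sum.cong) (auto simp: neg)
    finally show ?thesis .
  qed
  have "?t sums (\<Sum>n\<le>N. ?t n)"
  proof (rule sums_finite)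
    fix n assume "n \<notin> {..N}"
    then have "{T \<in> Pow {..<N}. card T = n} = {}"
      using card_mono[of "{..<N}"] by fastforce
    then show "?t n = 0" by (simp only: t sum.empty)
  qed simp
  also have "(\<Sum>n\<le>N. ?t n) = (\<Sum>T\<in>Pow {..<N}. sdet T (\<lambda>i j. - A i j))"
    unfolding t using card_mono[of "{..<N}"] by (intro sum.group) fastforce+
  also have "\<dots> = sdet {..<N} (\<lambda>i j. (if i = j then 1 else 0) + - A i j)"
    by (rule sdet_one_plus[symmetric]) simp
  finally show ?thesis .
qed

text \<open>The cells are open on the left, so they partition \<open>(0, \<infinity>)\<close>
  exactly. For \<open>x \<le> 0\<close> (and positive \<open>\<kappa>\<close>) the index is also 0,
  hence the explicit positivity tests in \<open>step_kernel\<close>.\<close>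

definition cell_index :: "real \<Rightarrow> real \<Rightarrow> nat" where
  "cell_index \<kappa> x = nat (\<lceil>\<kappa> * x\<rceil> - 1)"

definition cell :: "real \<Rightarrow> nat \<Rightarrow> real set" where
  "cell \<kappa> i = {real i / \<kappa><..(real i + 1) / \<kappa>}"

lemma cell_index_bounds:
  assumes "\<kappa> > 0" "x > 0"
  shows "real (cell_index \<kappa> x) < \<kappa> * x" "\<kappa> * x \<le> real (cell_index \<kappa> x) + 1"
proof -
  have "\<lceil>\<kappa> * x\<rceil> \<ge> 1" using mult_pos_pos[OF assms] by linarith
  then have "real (cell_index \<kappa> x) = of_int \<lceil>\<kappa> * x\<rceil> - 1" by (simp add: cell_index_def)
  then show "real (cell_index \<kappa> x) < \<kappa> * x" "\<kappa> * x \<le> real (cell_index \<kappa> x) + 1" by linarith+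
qed

lemma mem_cell_iff:
  assumes "\<kappa> > 0"
  shows "x \<in> cell \<kappa> i \<longleftrightarrow> x > 0 \<and> cell_index \<kappa> x = i"
proof
  assume "x \<in> cell \<kappa> i"
  then have x: "real i < \<kappa> * x" "\<kappa> * x \<le> real i + 1"
    using assms by (auto simp: cell_def field_simps)
  then have "\<kappa> * x > 0" by linarith
  then have "x > 0" using assms by (simp add: zero_less_mult_iff)
  then show "x > 0 \<and> cell_index \<kappa> x = i" using cell_index_bounds[OF assms, of x] x by linarith
next
  assume "x > 0 \<and> cell_index \<kappa> x = i"
  then show "x \<in> cell \<kappa> i"
    using cell_index_bounds[OF assms, of x] assms by (auto simp: cell_def field_simps)
qed

definition step_kernel :: "real \<Rightarrow> nat \<Rightarrow> (nat \<Rightarrow> nat \<Rightarrow> real) \<Rightarrow> real \<Rightarrow> real \<Rightarrow> real" where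
  "step_kernel \<kappa> N K x y =
     (if 0 < x \<and> 0 < y \<and> cell_index \<kappa> x < N \<and> cell_index \<kappa> y < N then K (cell_index \<kappa> x) (cell_index \<kappa> y) else 0)"

text \<open>Only the tuple of cell indices of \<open>x\<close> survives in the sum; if some
  coordinate lies in no admissible cell, its row is 0.\<close>

lemma sdet_step_kernel:
  fixes n :: nat
  assumes k: "\<kappa> > 0"
  shows "sdet {..<n} (\<lambda>a b. step_kernel \<kappa> N K (x a) (x b)) =
    (\<Sum>f\<in>{..<n} \<rightarrow>\<^sub>E {..<N}. sdet {..<n} (\<lambda>a b. K (f a) (f b)) * (\<Prod>a<n. indicator (cell \<kappa> (f a)) (x a)))"
proof (cases "\<forall>a<n. 0 < x a \<and> cell_index \<kappa> (x a) < N")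
  case True
  define g where "g = restrict (\<lambda>a. cell_index \<kappa> (x a)) {..<n}"
  have g: "g \<in> {..<n} \<rightarrow>\<^sub>E {..<N}" using True by (auto simp: g_def)
  have ind: "(\<Prod>a<n. indicator (cell \<kappa> (f a)) (x a)) = (if f = g then 1 else 0 :: real)"
    if f: "f \<in> {..<n} \<rightarrow>\<^sub>E {..<N}" for f
  proof (cases "f = g")
    case False
    then obtain a where "a < n" "f a \<noteq> g a" using PiE_ext[OF f g] by auto
    then have "indicator (cell \<kappa> (f a)) (x a) = (0 :: real)"
      by (auto simp: indicator_def mem_cell_iff[OF k] g_def)
    then show ?thesis using False \<open>a < n\<close> by (auto intro!: prod_zero)
  qed (use True in \<open>simp add: g_def mem_cell_iff[OF k]\<close>)
  have "(\<Sum>f\<in>{..<n} \<rightarrow>\<^sub>E {..<N}. sdet {..<n} (\<lambda>a b. K (f a) (f b)) * (\<Prod>a<n. indicator (cell \<kappa> (f a)) (x a)))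
    = (\<Sum>f\<in>{..<n} \<rightarrow>\<^sub>E {..<N}. if f = g then sdet {..<n} (\<lambda>a b. K (f a) (f b)) else 0)"
    by (intro sum.cong refl) (simp add: ind)
  also have "\<dots> = sdet {..<n} (\<lambda>a b. K (g a) (g b))"
    using g by (subst sum.delta) (auto intro!: finite_PiE)
  also have "\<dots> = sdet {..<n} (\<lambda>a b. step_kernel \<kappa> N K (x a) (x b))"
    using True by (intro sdet_cong) (simp add: g_def step_kernel_def)
  finally show ?thesis by simp
next
  case False
  then obtain a where a: "a < n" "\<not> (0 < x a \<and> cell_index \<kappa> (x a) < N)" by blast
  have zero: "(\<Prod>a<n. indicator (cell \<kappa> (f a)) (x a)) = (0 :: real)" if "f \<in> {..<n} \<rightarrow>\<^sub>E {..<N}" for f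
  proof (rule prod_zero)
    have "f a < N" using that a by auto
    then have "indicator (cell \<kappa> (f a)) (x a) = (0 :: real)"
      using a by (auto simp: indicator_def mem_cell_iff[OF k])
    then show "\<exists>a\<in>{..<n}. indicator (cell \<kappa> (f a)) (x a) = (0 :: real)" using a by blast
  qed simp
  have "sdet {..<n} (\<lambda>a b. step_kernel \<kappa> N K (x a) (x b)) = 0"
    unfolding sdet_def
  proof (intro sum.neutral ballI)
    fix p
    have "step_kernel \<kappa> N K (x a) (x (p a)) = 0" using a by (auto simp: step_kernel_def)
    then have "(\<Prod>i<n. step_kernel \<kappa> N K (x i) (x (p i))) = 0" using a by (intro prod_zero) auto
    then show "of_int (sign p) * (\<Prod>i<n. step_kernel \<kappa> N K (x i) (x (p i))) = 0" by simp
  qed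
  then show ?thesis by (simp only: zero mult_zero_right sum.neutral_const cong: sum.cong)
qed

section \<open>The Fredholm series of a step kernel\<close>

lemma product_sigma_finite_lborel: "product_sigma_finite (\<lambda>_. lborel :: real measure)"
  by (simp add: product_sigma_finite_def lborel.sigma_finite_measure_axioms)

lemma measurable_sdet_step_kernel:
  fixes n :: nat
  assumes k: "\<kappa> > 0"
  shows "(\<lambda>x. sdet {..<n} (\<lambda>a b. step_kernel \<kappa> N K (x a) (x b))) \<in> borel_measurable (\<Pi>\<^sub>M i\<in>{..<n}. lborel)"
proof -
  have [measurable]: "cell \<kappa> i \<in> sets borel" for i by (simp add: cell_def)
  show ?thesis unfolding sdet_step_kernel[OF k] by measurable
qed

text \<open>A product of \<open>n\<close> cells has volume \<open>1 / \<kappa> ^ n\<close>, one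
  factor for each row.\<close>

lemma integral_sdet_step_kernel:
  fixes n :: nat
  assumes k: "\<kappa> > 0"
  shows "(LINT x|(\<Pi>\<^sub>M i\<in>{..<n}. lborel). sdet {..<n} (\<lambda>a b. step_kernel \<kappa> N K (x a) (x b))) =
    (\<Sum>f\<in>{..<n} \<rightarrow>\<^sub>E {..<N}. sdet {..<n} (\<lambda>a b. K (f a) (f b) / \<kappa>))"
proof -
  interpret product_sigma_finite "\<lambda>_::nat. lborel :: real measure" by (rule product_sigma_finite_lborel)
  have cell: "integrable lborel (indicator (cell \<kappa> i) :: real \<Rightarrow> real)"
    "(LINT x|lborel. indicator (cell \<kappa> i) x) = 1 / \<kappa>" for i
  proof -
    have "(LINT x|lborel. indicator (cell \<kappa> i) x) = measure lborel (cell \<kappa> i)" by simp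
    also have "\<dots> = 1 / \<kappa>"
      unfolding cell_def using k by (subst measure_lborel_Ioc) (auto simp: field_simps)
    finally show "(LINT x|lborel. indicator (cell \<kappa> i) x) = 1 / \<kappa>" .
    show "integrable lborel (indicator (cell \<kappa> i) :: real \<Rightarrow> real)"
      unfolding cell_def using k by (intro integrable_real_indicator) (auto simp: emeasure_lborel_Ioc divide_right_mono)
  qed
  have int: "integrable (\<Pi>\<^sub>M i\<in>{..<n}. lborel) (\<lambda>x. \<Prod>a<n. indicator (cell \<kappa> (f a)) (x a) :: real)" for f :: "nat \<Rightarrow> nat"
    by (rule product_integrable_prod[of "{..<n}" "\<lambda>a. indicator (cell \<kappa> (f a))"]) (simp_all add: cell)
  have "(LINT x|(\<Pi>\<^sub>M i\<in>{..<n}. lborel). sdet {..<n} (\<lambda>a b. step_kernel \<kappa> N K (x a) (x b))) =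
    (\<Sum>f\<in>{..<n} \<rightarrow>\<^sub>E {..<N}. sdet {..<n} (\<lambda>a b. K (f a) (f b)) * (LINT x|(\<Pi>\<^sub>M i\<in>{..<n}. lborel). (\<Prod>a<n. indicator (cell \<kappa> (f a)) (x a))))"
    unfolding sdet_step_kernel[OF k] using int by simp
  also have "\<dots> = (\<Sum>f\<in>{..<n} \<rightarrow>\<^sub>E {..<N}. sdet {..<n} (\<lambda>a b. K (f a) (f b) / \<kappa>))"
  proof (intro sum.cong refl)
    fix f
    have "(LINT x|(\<Pi>\<^sub>M i\<in>{..<n}. lborel). (\<Prod>a<n. indicator (cell \<kappa> (f a)) (x a))) = (\<Prod>a<n. LINT t|lborel. (indicator (cell \<kappa> (f a)) t :: real))"
      by (rule product_integral_prod[of "{..<n}" "\<lambda>a. indicator (cell \<kappa> (f a))"]) (simp_all add: cell(1))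
    also have "\<dots> = (\<Prod>a<n. 1 / \<kappa>)" by (simp only: cell(2))
    finally have "(LINT x|(\<Pi>\<^sub>M i\<in>{..<n}. lborel). (\<Prod>a<n. indicator (cell \<kappa> (f a)) (x a))) = (\<Prod>a<n. 1 / \<kappa>)" .
    moreover have "sdet {..<n} (\<lambda>a b. K (f a) (f b) / \<kappa>) = (\<Prod>a<n. 1 / \<kappa>) * sdet {..<n} (\<lambda>a b. K (f a) (f b))"
      using sdet_mult_rows[of "{..<n}" "\<lambda>_. 1 / \<kappa>" "\<lambda>a b. K (f a) (f b)"] by simp
    ultimately show "sdet {..<n} (\<lambda>a b. K (f a) (f b)) * (LINT x|(\<Pi>\<^sub>M i\<in>{..<n}. lborel). (\<Prod>a<n. indicator (cell \<kappa> (f a)) (x a)))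
      = sdet {..<n} (\<lambda>a b. K (f a) (f b) / \<kappa>)" by simp
  qed
  finally show ?thesis .
qed

text \<open>From \<open>n ^ n \<le> exp n * n!\<close> the terms are at most
  \<open>(q * exp (1 / 2)) ^ n / sqrt (n!)\<close>, which the ratio test handles.\<close>

lemma summable_Hadamard_series:
  fixes q :: real assumes q: "q \<ge> 0"
  shows "summable (\<lambda>n. sqrt (real n ^ n) * q ^ n / fact n)"
proof (rule summable_comparison_test)
  let ?h = "\<lambda>n. (q * exp (1 / 2)) ^ n / sqrt (fact n)"
  have "sqrt (real n ^ n) * q ^ n / fact n \<le> ?h n" for n
  proof -
    have "real n ^ n / fact n \<le> exp (real n)"
    proof -
      have "(\<lambda>k. real n ^ k / fact k) sums exp (real n)"
        using exp_converges[of "real n"] by (simp add: divide_inverse mult.commute)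
      then show ?thesis using sum_le_suminf[of "\<lambda>k. real n ^ k / fact k" "{n}"] by (auto simp: sums_iff)
    qed
    then have "real n ^ n \<le> exp (real n) * fact n" by (simp add: divide_le_eq)
    then have "sqrt (real n ^ n) \<le> sqrt (exp (real n) * fact n)" by (rule real_sqrt_le_mono)
    also have "\<dots> = exp (1 / 2) ^ n * sqrt (fact n)"
    proof -
      have "exp (real n) = (exp (1 / 2) ^ n)\<^sup>2"
        by (simp add: exp_of_nat_mult[symmetric] exp_double[symmetric])
      then show ?thesis by (simp add: real_sqrt_mult)
    qed
    finally have "sqrt (real n ^ n) * q ^ n / fact n \<le> (exp (1 / 2) ^ n * sqrt (fact n)) * q ^ n / fact n"
      using q by (intro divide_right_mono mult_right_mono) auto
    also have "\<dots> = ?h n"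
      by (simp add: power_mult_distrib field_simps)
    finally show ?thesis .
  qed
  then show "\<exists>N. \<forall>n\<ge>N. norm (sqrt (real n ^ n) * q ^ n / fact n) \<le> ?h n" using q by (simp add: abs_mult)
  let ?q = "q * exp (1 / 2)"
  show "summable ?h"
  \<comment> \<open>The threshold from which the ratio \<open>?q / sqrt (Suc n)\<close> is at most
    \<open>1 / 2\<close>.\<close>
  proof (rule summable_ratio_test[of "1 / 2" "nat \<lceil>4 * ?q\<^sup>2\<rceil>"])
    fix n assume "nat \<lceil>4 * ?q\<^sup>2\<rceil> \<le> n"
    then have "(2 * ?q)\<^sup>2 \<le> real (Suc n)" by (simp add: power_mult_distrib)
    then have "2 * ?q \<le> sqrt (real (Suc n))" by (rule real_le_rsqrt)
    then have "?q / sqrt (real (Suc n)) \<le> 1 / 2" by (simp add: divide_le_eq)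
    then have "?q / sqrt (real (Suc n)) * ?h n \<le> 1 / 2 * ?h n" using q by (intro mult_right_mono) auto
    moreover have "?h (Suc n) = ?q / sqrt (real (Suc n)) * ?h n"
      by (simp add: real_sqrt_mult[of "1 + real n"])
    ultimately show "norm (?h (Suc n)) \<le> 1 / 2 * norm (?h n)" using q by (simp only: real_norm_def abs_of_nonneg[of "?h _"] zero_le_divide_iff zero_le_power mult_nonneg_nonneg) simp
  qed simp
qed

section \<open>Passage to the limit in the kernels\<close>

lemma integrable_exp_neg_abs: "integrable lborel (\<lambda>x::real. exp (- (\<bar>x\<bar> / 2)))"
proof -
  have 1: "integrable lborel (\<lambda>x::real. indicator {0<..} x * exp (- (x / 2)))"
    using integrable_I0i_exp_mscale[of "1 / 2"] by (simp add: set_integrable_def)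
  have "integrable lborel (\<lambda>x::real. indicator {0<..} (0 + (-1) * x) * exp (- ((0 + (-1) * x) / 2)))"
    using lborel_integrable_real_affine[OF 1, of "-1" 0] by simp
  from Bochner_Integration.integrable_add[OF 1 this]
  show ?thesis
    by (rule integrable_cong_AE_imp)
      (use AE_lborel_singleton[of "0::real"] in \<open>auto simp: indicator_def elim!: eventually_mono\<close>)
qed

lemma cell_index_tendsto:
  assumes x: "x > 0"
  shows "(\<lambda>N. real (cell_index (kap N) x) / kap N) \<longlonglongrightarrow> x"
proof (rule tendsto_sandwich[of "\<lambda>N. x - inverse (kap N)" _ _ "\<lambda>_. x"])
  show "\<forall>\<^sub>F N in sequentially. x - inverse (kap N) \<le> real (cell_index (kap N) x) / kap N"
    using kap_gt[of 0]
  proof eventually_elim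
    case (elim N)
    then have "kap N * x - 1 \<le> real (cell_index (kap N) x)" using cell_index_bounds(2)[of "kap N" x] x by simp
    then have "(kap N * x - 1) / kap N \<le> real (cell_index (kap N) x) / kap N" using elim by (simp add: divide_right_mono)
    then show ?case using elim by (simp add: diff_divide_distrib inverse_eq_divide)
  qed
  show "\<forall>\<^sub>F N in sequentially. real (cell_index (kap N) x) / kap N \<le> x"
    using kap_gt[of 0]
  proof eventually_elim
    case (elim N)
    then show ?case using cell_index_bounds(1)[of "kap N" x] x by (simp add: field_simps)
  qed
  show "(\<lambda>N. x - inverse (kap N)) \<longlonglongrightarrow> x" using tendsto_diff[OF tendsto_const inverse_kap_tendsto, of x] by (simp add: inverse_eq_divide)
qed simp

text \<open>The matrix size is \<open>kap N ^ 3 / 2\<close> and the index only about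
  \<open>kap N * x\<close>, so in the scaled variable the matrix exhausts the half-line.\<close>

lemma eventually_cell_index_less:
  assumes x: "x > 0"
  shows "\<forall>\<^sub>F N in sequentially. cell_index (kap N) x < N"
  using kap_gt[of 1] kap_gt[of "2 * x"]
proof eventually_elim
  case (elim N)
  have "real (cell_index (kap N) x) < kap N * x" using elim x by (intro cell_index_bounds) auto
  also have "\<dots> \<le> kap N * (kap N / 2)" using elim by (intro mult_left_mono) auto
  also have "\<dots> \<le> kap N * (kap N / 2) * kap N" using elim by simp
  also have "\<dots> = real N" using kap_cube[of N] by (simp add: power3_eq_cube)
  finally show ?case by simp
qed

lemma step_kernel_tendsto:
  "(\<lambda>N. step_kernel (kap N) N (scaled_entry R N) x y) \<longlonglongrightarrow> PBP_kernel R x y"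
proof (cases "x > 0 \<and> y > 0")
  case True
  then have xy: "x > 0" "y > 0" by auto
  have "(\<lambda>N. scaled_entry R N (cell_index (kap N) x) (cell_index (kap N) y)) \<longlonglongrightarrow> airy (R + x + y)"
    using xy by (intro scaled_entry_tendsto cell_index_tendsto) auto
  moreover have "\<forall>\<^sub>F N in sequentially.
      scaled_entry R N (cell_index (kap N) x) (cell_index (kap N) y) = step_kernel (kap N) N (scaled_entry R N) x y"
    using eventually_cell_index_less[OF xy(1)] eventually_cell_index_less[OF xy(2)]
    by eventually_elim (use xy in \<open>simp add: step_kernel_def\<close>)
  ultimately have "(\<lambda>N. step_kernel (kap N) N (scaled_entry R N) x y) \<longlonglongrightarrow> airy (R + x + y)"
    by (rule Lim_transform_eventually)
  then show ?thesis using xy by (simp add: PBP_kernel_def B_kernel_def add_ac)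
next
  case False
  then have "step_kernel (kap N) N (scaled_entry R N) x y = 0" for N by (auto simp: step_kernel_def)
  moreover have "PBP_kernel R x y = 0" using False by (auto simp: PBP_kernel_def)
  ultimately show ?thesis by simp
qed

text \<open>Rounding \<open>x\<close> down to its cell loses at most \<open>1 / kap N\<close>, which
  is below 1, so each variable costs at most \<open>exp (1 / 4)\<close>.\<close>

lemma step_kernel_bound:
  obtains D where "D > 0" "\<forall>\<^sub>F N in sequentially. \<forall>x y.
    \<bar>step_kernel (kap N) N (scaled_entry R N) x y\<bar> \<le> D * exp (- (\<bar>x\<bar> / 4)) * exp (- (\<bar>y\<bar> / 4))"
proof -
  obtain C where C: "C > 0" and bnd: "\<forall>\<^sub>F N in sequentially. \<forall>i j.
      \<bar>scaled_entry R N i j\<bar> \<le> C * (exp (- (real i / (4 * kap N))) * exp (- (real j / (4 * kap N))))"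
    using scaled_entry_bound by blast
  have "\<forall>\<^sub>F N in sequentially. \<forall>x y.
    \<bar>step_kernel (kap N) N (scaled_entry R N) x y\<bar> \<le> (C * (exp (1 / 4) * exp (1 / 4))) * exp (- (\<bar>x\<bar> / 4)) * exp (- (\<bar>y\<bar> / 4))"
    using bnd kap_gt[of 1]
  proof eventually_elim
    case (elim N)
    have e: "exp (- (real (cell_index (kap N) x) / (4 * kap N))) \<le> exp (1 / 4) * exp (- (\<bar>x\<bar> / 4))" if "x > 0" for x
    proof -
      have "x * kap N \<le> real (cell_index (kap N) x) + kap N"
        using cell_index_bounds(2)[of "kap N" x] elim that by (simp add: mult.commute)
      then have "- (real (cell_index (kap N) x) / (4 * kap N)) \<le> 1 / 4 + - (\<bar>x\<bar> / 4)"
        using elim that by (simp add: field_simps)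
      then show ?thesis by (simp only: exp_add[symmetric] exp_le_cancel_iff)
    qed
    show ?case
    proof (intro allI)
      fix x y :: real
      show "\<bar>step_kernel (kap N) N (scaled_entry R N) x y\<bar>
        \<le> (C * (exp (1 / 4) * exp (1 / 4))) * exp (- (\<bar>x\<bar> / 4)) * exp (- (\<bar>y\<bar> / 4))"
      proof (cases "0 < x \<and> 0 < y \<and> cell_index (kap N) x < N \<and> cell_index (kap N) y < N")
        case True
        then have "\<bar>step_kernel (kap N) N (scaled_entry R N) x y\<bar> \<le>
            C * (exp (- (real (cell_index (kap N) x) / (4 * kap N))) * exp (- (real (cell_index (kap N) y) / (4 * kap N))))"
          using elim(1) by (simp add: step_kernel_def)
        also have "\<dots> \<le> C * ((exp (1 / 4) * exp (- (\<bar>x\<bar> / 4))) * (exp (1 / 4) * exp (- (\<bar>y\<bar> / 4))))"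
          using C True by (intro mult_left_mono mult_mono e) auto
        finally show ?thesis by (simp add: mult_ac)
      next
        case False
        then show ?thesis using C by (auto simp: step_kernel_def)
      qed
    qed
  qed
  then show thesis using C by (intro that[of "C * (exp (1 / 4) * exp (1 / 4))"]) auto
qed

text \<open>Hadamard's inequality with the two exponential factors as row and column weights
  dominates every determinant by a product of integrable functions of one variable; \<open>q\<close>
  is the integral of that function.\<close>

lemma integral_sdet_step_kernel_limit:
  obtains q where "q \<ge> 0"
    "\<forall>\<^sub>F N in sequentially. \<forall>n. \<bar>LINT x|(\<Pi>\<^sub>M i\<in>{..<n}. lborel). sdet {..<n} (\<lambda>a b. step_kernel (kap N) N (scaled_entry R N) (x a) (x b))\<bar> \<le> sqrt (real n ^ n) * q ^ n"
    "\<And>n::nat. (\<lambda>N. LINT x|(\<Pi>\<^sub>M i\<in>{..<n}. lborel). sdet {..<n} (\<lambda>a b. step_kernel (kap N) N (scaled_entry R N) (x a) (x b)))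
      \<longlonglongrightarrow> (LINT x|(\<Pi>\<^sub>M i\<in>{..<n}. lborel). sdet {..<n} (\<lambda>a b. PBP_kernel R (x a) (x b)))"
proof -
  interpret product_sigma_finite "\<lambda>_::nat. lborel :: real measure" by (rule product_sigma_finite_lborel)
  obtain D where D: "D > 0" and bnd: "\<forall>\<^sub>F N in sequentially. \<forall>x y.
      \<bar>step_kernel (kap N) N (scaled_entry R N) x y\<bar> \<le> D * exp (- (\<bar>x\<bar> / 4)) * exp (- (\<bar>y\<bar> / 4))"
    using step_kernel_bound by blast
  define w where "w = (\<lambda>x::real. D * exp (- (\<bar>x\<bar> / 2)))"
  define S where "S n N x = sdet {..<n} (\<lambda>a b. step_kernel (kap N) N (scaled_entry R N) (x a) (x b))" for n N and x :: "nat \<Rightarrow> real"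
  let ?M = "\<lambda>n. \<Pi>\<^sub>M i\<in>{..<n::nat}. (lborel :: real measure)"
  have "\<forall>\<^sub>F N in sequentially. kap N > 0 \<and> (\<forall>n x. \<bar>S n N x\<bar> \<le> sqrt (real n ^ n) * (\<Prod>i<n. w (x i)))"
    using bnd kap_gt[of 0]
  proof eventually_elim
    case (elim N)
    have "\<bar>S n N x\<bar> \<le> sqrt (real n ^ n) * (\<Prod>i<n. (D * exp (- (\<bar>x i\<bar> / 4))) * exp (- (\<bar>x i\<bar> / 4)))" for n x
      unfolding S_def using elim D by (intro Hadamard_weighted) auto
    moreover have "(D * exp (- (\<bar>t\<bar> / 4))) * exp (- (\<bar>t\<bar> / 4)) = w t" for t
      by (simp add: w_def mult.assoc exp_add[symmetric])
    ultimately show ?case using elim by simp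
  qed
  then obtain N0 where N0: "\<And>N. N \<ge> N0 \<Longrightarrow> kap N > 0"
      "\<And>N n x. N \<ge> N0 \<Longrightarrow> \<bar>S n N x\<bar> \<le> sqrt (real n ^ n) * (\<Prod>i<n. w (x i))"
    unfolding eventually_sequentially by blast
  define q where "q = (LINT x|lborel. w x)"
  have w: "integrable lborel w" unfolding w_def using integrable_exp_neg_abs by (intro integrable_mult_right) auto
  have "q \<ge> 0" unfolding q_def w_def using D by (intro Bochner_Integration.integral_nonneg) auto
  have wint: "integrable (?M n) (\<lambda>x. sqrt (real n ^ n) * (\<Prod>i<n. w (x i)))" for n
    by (intro integrable_mult_right product_integrable_prod w) auto
  have wval: "(LINT x|?M n. sqrt (real n ^ n) * (\<Prod>i<n. w (x i))) = sqrt (real n ^ n) * q ^ n" for n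
    using product_integral_prod[of "{..<n}" "\<lambda>_. w"] w by (simp add: q_def)
  have meas: "S n N \<in> borel_measurable (?M n)" if "N \<ge> N0" for n N
    unfolding S_def using N0(1)[OF that] by (rule measurable_sdet_step_kernel)
  have "\<forall>\<^sub>F N in sequentially. \<forall>n. \<bar>LINT x|?M n. S n N x\<bar> \<le> sqrt (real n ^ n) * q ^ n"
    using eventually_ge_at_top[of N0]
  proof eventually_elim
    case (elim N)
    have "\<bar>LINT x|?M n. S n N x\<bar> \<le> (LINT x|?M n. sqrt (real n ^ n) * (\<Prod>i<n. w (x i)))" for n
    proof -
      have int: "integrable (?M n) (S n N)"
        using N0(2)[OF elim] meas[OF elim]
        by (intro Bochner_Integration.integrable_bound[OF wint]) (auto intro: order_trans[OF _ abs_ge_self])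
      have "\<bar>LINT x|?M n. S n N x\<bar> \<le> (LINT x|?M n. \<bar>S n N x\<bar>)" by (rule integral_abs_bound)
      also have "\<dots> \<le> (LINT x|?M n. sqrt (real n ^ n) * (\<Prod>i<n. w (x i)))"
        using int N0(2)[OF elim] wint by (intro integral_mono) auto
      finally show ?thesis .
    qed
    then show ?case unfolding wval by blast
  qed
  moreover have "(\<lambda>N. LINT x|?M n. S n N x) \<longlonglongrightarrow> (LINT x|?M n. sdet {..<n} (\<lambda>a b. PBP_kernel R (x a) (x b)))" for n
  proof (rule LIMSEQ_offset[of _ N0])
    have lim: "(\<lambda>N. S n (N + N0) x) \<longlonglongrightarrow> sdet {..<n} (\<lambda>a b. PBP_kernel R (x a) (x b))" for x
    proof (rule LIMSEQ_ignore_initial_segment)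
      show "(\<lambda>N. S n N x) \<longlonglongrightarrow> sdet {..<n} (\<lambda>a b. PBP_kernel R (x a) (x b))"
        unfolding S_def sdet_def by (intro tendsto_intros step_kernel_tendsto)
    qed
    have meas': "S n (N + N0) \<in> borel_measurable (?M n)" for N by (rule meas) simp
    show "(\<lambda>N. LINT x|?M n. S n (N + N0) x) \<longlonglongrightarrow> (LINT x|?M n. sdet {..<n} (\<lambda>a b. PBP_kernel R (x a) (x b)))"
    proof (rule integral_dominated_convergence[where w = "\<lambda>x. sqrt (real n ^ n) * (\<Prod>i<n. w (x i))"])
      \<comment> \<open>The limiting determinant is measurable as a pointwise limit, which avoids
        studying the regularity of \<open>airy\<close>.\<close>
      show "(\<lambda>x. sdet {..<n} (\<lambda>a b. PBP_kernel R (x a) (x b))) \<in> borel_measurable (?M n)"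
        by (rule borel_measurable_LIMSEQ_real[OF lim meas'])
    qed (use lim meas' wint N0(2) in auto)
  qed
  ultimately show thesis using \<open>q \<ge> 0\<close> that unfolding S_def by blast
qed

text \<open>Tannery's theorem: every term of the Fredholm series converges, and the Hadamard bound
  is summable uniformly in \<open>N\<close>.\<close>

lemma wall_determinant_limit:
  "(\<lambda>N. sdet {..<N} (\<lambda>i j. (if i = j then 1 else 0) + - (scaled_entry R N i j / kap N))) \<longlonglongrightarrow> F_GOE R"
proof -
  define T :: "nat \<Rightarrow> nat \<Rightarrow> real" where "T n N = (LINT x|(\<Pi>\<^sub>M i\<in>{..<n}. lborel). sdet {..<n} (\<lambda>a b. step_kernel (kap N) N (scaled_entry R N) (x a) (x b)))" for n N
  obtain q where q: "q \<ge> 0" and bnd: "\<forall>\<^sub>F N in sequentially. \<forall>n. \<bar>T n N\<bar> \<le> sqrt (real n ^ n) * q ^ n"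
    and lim: "\<And>n. T n \<longlonglongrightarrow> (LINT x|(\<Pi>\<^sub>M i\<in>{..<n}. lborel). sdet {..<n} (\<lambda>a b. PBP_kernel R (x a) (x b)))"
    using integral_sdet_step_kernel_limit[of R] unfolding T_def by blast
  have "(\<lambda>N. \<Sum>n. (-1) ^ n / fact n * T n N)
    \<longlonglongrightarrow> (\<Sum>n. (-1) ^ n / fact n * (LINT x|(\<Pi>\<^sub>M i\<in>{..<n}. lborel). sdet {..<n} (\<lambda>a b. PBP_kernel R (x a) (x b))))"
  proof (rule tannerys_theorem[THEN conjunct2, THEN conjunct2])
    show "(\<lambda>N. (-1) ^ n / fact n * T n N) \<longlonglongrightarrow> (-1) ^ n / fact n * (LINT x|(\<Pi>\<^sub>M i\<in>{..<n}. lborel). sdet {..<n} (\<lambda>a b. PBP_kernel R (x a) (x b)))" for n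
      by (intro tendsto_intros lim)
    show "summable (\<lambda>n. sqrt (real n ^ n) * q ^ n / fact n)" using q by (rule summable_Hadamard_series)
    have "\<forall>\<^sub>F N in sequentially. \<forall>n. norm ((-1) ^ n / fact n * T n N) \<le> sqrt (real n ^ n) * q ^ n / fact n"
      using bnd by eventually_elim (auto simp: abs_mult divide_right_mono)
    then show "\<forall>\<^sub>F (n, N) in at_top \<times>\<^sub>F sequentially. norm ((-1) ^ n / fact n * T n N) \<le> sqrt (real n ^ n) * q ^ n / fact n"
      unfolding eventually_prod_filter
      by (intro exI[of _ "\<lambda>_. True"] exI[of _ "\<lambda>N. \<forall>n. norm ((-1) ^ n / fact n * T n N) \<le> sqrt (real n ^ n) * q ^ n / fact n"]) auto
  qed simp
  also have "(\<Sum>n. (-1) ^ n / fact n * (LINT x|(\<Pi>\<^sub>M i\<in>{..<n}. lborel). sdet {..<n} (\<lambda>a b. PBP_kernel R (x a) (x b)))) = F_GOE R"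
    by (simp add: F_GOE_def fredholm_det_def det_mat_eq_sdet)
  finally show ?thesis
  proof (rule Lim_transform_eventually)
    show "\<forall>\<^sub>F N in sequentially. (\<Sum>n. (-1) ^ n / fact n * T n N)
      = sdet {..<N} (\<lambda>i j. (if i = j then 1 else 0) + - (scaled_entry R N i j / kap N))"
      using kap_gt[of 0]
    proof eventually_elim
      case (elim N)
      then show ?case
        using sdet_one_minus_sums[of "\<lambda>i j. scaled_entry R N i j / kap N" N]
        by (simp add: T_def integral_sdet_step_kernel sums_iff)
    qed
  qed
qed

theorem theorem1p1:
  fixes M :: "nat \<Rightarrow> 'a measure"
    and B :: "nat \<Rightarrow> nat \<Rightarrow> real \<Rightarrow> 'a \<Rightarrow> real"
    and r :: real
  assumes "\<And>N. 1 \<le> N \<Longrightarrow> nonintersecting_bridges (M N) N (B N)"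
  shows "(\<lambda>N. \<P>(\<omega> in M N.
            2 * real N powr (1 / 6) * ((SUP t\<in>{0..1}. B N N t \<omega>) - sqrt (real N)) \<le> r))
         \<longlonglongrightarrow> F_GOE (4 powr (1 / 3) * r)"
proof (rule Lim_transform_eventually[OF wall_determinant_limit])
  let ?R = "4 powr (1 / 3) * r"
  show "\<forall>\<^sub>F N in sequentially. sdet {..<N} (\<lambda>i j. (if i = j then 1 else 0) + - (scaled_entry ?R N i j / kap N)) =
    \<P>(\<omega> in M N. 2 * real N powr (1 / 6) * ((SUP t\<in>{0..1}. B N N t \<omega>) - sqrt (real N)) \<le> r)"
    using kap_gt[of 1] kap_gt[of "4 * \<bar>?R\<bar>"] eventually_ge_at_top[of 1]
  proof eventually_elim
    case (elim N)
    define m where "m = sqrt (real N) + r / (2 * real N powr (1 / 6))"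
    have N: "real N > 0" using elim by simp
    \<comment> \<open>The source of \<open>4 powr (1 / 3)\<close>: it cancels in
      \<open>?R / (kap N)\<^sup>2\<close>, leaving \<open>r / N powr (2 / 3)\<close> and thus the
      stated fluctuation scale.\<close>
    have kap2: "(kap N)\<^sup>2 = 4 powr (1 / 3) * real N powr (2 / 3)"
    proof -
      have "(kap N)\<^sup>2 = (2 * real N) powr (2 / 3)"
        using N by (simp add: kap_def powr_powr flip: powr_numeral)
      also have "\<dots> = 4 powr (1 / 3) * real N powr (2 / 3)"
      proof -
        have "(4 :: real) powr (1 / 3) = (2 powr 2) powr (1 / 3)" by simp
        also have "\<dots> = 2 powr (2 / 3)" by (simp only: powr_powr) simp
        finally show ?thesis using N by (simp add: powr_mult)
      qed
      finally show ?thesis .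
    qed
    have sq: "real N powr (2 / 3) = sqrt (real N) * real N powr (1 / 6)"
      using N by (simp add: powr_half_sqrt[symmetric] powr_add[symmetric])
    have m: "2 * m = sqrt (real N) * qpt ?R N"
      unfolding qpt_def kap2 sq m_def using N by (simp add: field_simps)
    \<comment> \<open>Holds only for large \<open>N\<close> if \<open>r\<close> is negative;
      \<open>max_probability\<close> needs it at the pinned ends.\<close>
    have "m > 0"
    proof -
      have "\<bar>?R\<bar> < kap N / 4" using elim by simp
      also have "\<dots> \<le> kap N * kap N / 4" using elim by simp
      finally have "\<bar>?R / (kap N)\<^sup>2\<bar> < 1"
        using elim by (simp add: abs_divide power2_eq_square divide_less_eq)
      then have "- 1 < ?R / (kap N)\<^sup>2" by linarith
      then have "qpt ?R N > 0" unfolding qpt_def by linarith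
      then have "0 < sqrt (real N) * qpt ?R N" using N by simp
      then show ?thesis using m by linarith
    qed
    obtain H where H: "\<And>a z::real. (\<lambda>b. H a b * z ^ b) sums (exp (2 * m * z - 2 * m\<^sup>2) * (2 * m - z) ^ a)"
      and det: "sdet {..<N} (\<lambda>a b. (if a = b then 1 else 0) - H a b)
        = sdet {..<N} (\<lambda>i j. (if i = j then 1 else 0) + - (scaled_entry ?R N i j / kap N))"
      using wall_determinant[OF _ _ _ m] elim by blast
    have "2 * real N powr (1 / 6) * (s - sqrt (real N)) \<le> r \<longleftrightarrow> s \<le> m" for s
      unfolding m_def using N by (simp add: field_simps)
    then have "\<P>(\<omega> in M N. 2 * real N powr (1 / 6) * ((SUP t\<in>{0..1}. B N N t \<omega>) - sqrt (real N)) \<le> r)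
      = measure (M N) {\<omega> \<in> space (M N). (SUP t\<in>{0..1}. B N N t \<omega>) \<le> m}" by simp
    also have "\<dots> = sdet {..<N} (\<lambda>a b. (if a = b then 1 else 0) - H a b)"
      using elim assms[of N] by (intro max_probability[OF _ _ \<open>m > 0\<close> H]) auto
    finally show ?case by (simp only: det)
  qed
qed

end
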